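(* Let $(\mathcal{X}_1',\mathcal{X}_1),\dots,(\mathcal{X}_N',\mathcal{X}_N)$ be dual pairs of Banach spaces, let $\|\cdot\|_{\mathcal{Z}}$ be an absolute norm on $\mathbb{R}^N$ with $\mathcal{Z}=(\mathbb{R}^N,\|\cdot\|_{\mathcal{Z}})$ and dual $\mathcal{Z}'$, and let $\mathcal{X}=(\mathcal{X}_1\times\dots\times\mathcal{X}_N)_{\mathcal{Z}}$ and $\mathcal{X}'=(\mathcal{X}_1'\times\dots\times\mathcal{X}_N')_{\mathcal{Z}'}$. Let $\nu_1,\dots,\nu_M\in\mathcal{X}$ be linearly independent, with $\nu_m=(\nu_{m,1},\dots,\nu_{m,N})$, $\nu_{m,n}\in\mathcal{X}_n$, and let $\boldsymbol{\nu}:\mathcal{X}'\to\mathbb{R}^M$, $\boldsymbol{\nu}(f)=(\langle\nu_1,f\rangle,\dots,\langle\nu_M,f\rangle)$. Let $E:\mathbb{R}^M\times\mathbb{R}^M\to\mathbb{R}^+\cup\{+\infty\}$ be a proper, lower-semicontinuous, strictly convex loss functional, and let $\psi:\mathbb{R}^+\to\mathbb{R}^+$ be strictly increasing and strictly convex. Fix $\boldsymbol{b}\in\mathbb{R}^M$ (the data vector) and consider $$S=\arg\min_{f\in\mathcal{X}'}\Big(E\big(\boldsymbol{b},\boldsymbol{\nu}(f)\big)+\psi\big(\|f\|_{\mathcal{X}'}\big)\Big).$$ Then the solutions $f_0=(f_{0,1},\dots,f_{0,N})\in S\subset\mathcal{X}'$ are $(\mathcal{X}',\mathcal{X})$-Banach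 conjugates of a common $$\nu_0=(\nu_{0,1},\dots,\nu_{0,N})=\sum_{m=1}^M a_m\nu_m$$ for a suitable set of coefficients $\boldsymbol{a}=(a_m)\in\mathbb{R}^M$. Moreover, depending on the properties of the constituent spaces, the solution components $f_{0,n}\in\mathcal{X}_n'$ have the following characterization, with scaling constants $$\alpha_n=\begin{cases}\dfrac{y_n}{y_n^*}>0,& y_n\neq0\\ 0,&\text{otherwise,}\end{cases}$$ where $\boldsymbol{y}=(y_n)=(\|f_{0,1}\|_{\mathcal{X}_1'},\dots,\|f_{0,N}\|_{\mathcal{X}_N'})\in\mathcal{Z}'$ and $\boldsymbol{y}^*=(y_n^* )\in\mathcal{Z}$ is the Banach conjugate $\boldsymbol{y}^*=\mathrm{J}_{\mathcal{Z}'}\{\boldsymbol{y}\}$: 1. If $\mathcal{X}_n'$ is a Hilbert space and $\mathcal{Z}'$ is strictly convex, then $f_{0,n}$ is unique and $$f_{0,n}=\alpha_n\sum_{m=1}^M a_m\varphi_{m,n}\qquad(\mathrm{H})$$ with $\varphi_{m,n}=\mathrm{J}_{\mathcal{X}_n}\{\nu_{m,n}\}\in\mathcal{X}_n'$, where $\mathrm{J}_{\mathcal{X}_n}$ is the Riesz map $\mathcal{X}_n\to\mathcal{X}_n'$. 2. If $\mathcal{X}_n'$ is a strictly convex Banach space and $\mathcal{Z}'$ is strictly convex, then the component $f_{0,n}$ is unique and $$f_{0,n}=\alpha_n\,\mathrm{J}_{\mathcal{X}_n}\Big\{\sum_{m=1}^M a_m\nu_{m,n}\Big\},\qquad(\mathrm{B})$$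 where $\mathrm{J}_{\mathcal{X}_n}:\mathcal{X}_n\to\mathcal{X}_n'$ is the (nonlinear) duality operator. 3. If $\mathcal{X}_n'$ is a non-strictly convex Banach space, then the component solution set $S|_{\mathcal{X}_n'}$ is the weak*-closure of the convex hull of its extremal points, which can all be expressed as $$f_{0,n}=\sum_{k=1}^{K_0}c_{k,n}e_{k,n},$$ where $e_{1,n},\dots,e_{K_0,n}\in\mathcal{X}_n'$ are some extremal points of the unit ball in $\mathcal{X}_n'$ and $c_{1,n},\dots,c_{K_0,n}\in\mathbb{R}$ are appropriate weights; the (minimal) number of atoms $K_0\le M$ is common to all the components associated with non-reflexive Banach spaces. In the particular case where $\|\cdot\|_{\mathcal{Z}'}=\|\cdot\|_1$, the expansion in item 3 can be replaced by $$f_{0,n}=\sum_{k=1}^{K_n}c_{k,n}e_{k,n}\quad\text{with}\quad\sum_{n=1}^N K_n\le M.$$ In addition (still for $\|\cdot\|_{\mathcal{Z}'}=\|\cdot\|_1$), formula (B) (resp. (H)) remains valid for the components for which $\mathcal{X}_n'$ is strictly convex (resp. Hilbertian), except that the solution is no longer guaranteed to be unique; such a component then contributes a degenerate version of the last expansion with $K_n=1$, $c_{1,n}=\|f_{0,n}\|_{\mathcal{X}_n'}$, and $e_{1,n}=f_{0,n}/\|f_{0,n}\|_{\mathcal{X}_n'}$.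
   Context: All spaces are real; $\mathbb{R}^+=[0,\infty)$. A dual pair $(\mathcal{X},\mathcal{X}')$ consists of a Banach space $\mathcal{X}$ and its continuous dual $\mathcal{X}'$, with duality product $\langle\nu,f\rangle=\langle f,\nu\rangle$ for $\nu\in\mathcal{X}$, $f\in\mathcal{X}'$. A norm on $\mathbb{R}^N$ is absolute if $\|(z_n)\|=\|(|z_n|)\|$ for all $(z_n)\in\mathbb{R}^N$. For $\mathcal{Z}=(\mathbb{R}^N,\|\cdot\|_{\mathcal{Z}})$, $\mathcal{Z}'$ is $\mathbb{R}^N$ with the dual norm. $(\mathcal{X}_1\times\dots\times\mathcal{X}_N)_{\mathcal{Z}}$ is the direct product with norm $\|(x_1,\dots,x_N)\|=\|(\|x_1\|_{\mathcal{X}_1},\dots,\|x_N\|_{\mathcal{X}_N})\|_{\mathcal{Z}}$ (and similarly with $\mathcal{Z}'$). The dual of $\mathcal{X}=(\mathcal{X}_1\times\dots\times\mathcal{X}_N)_{\mathcal{Z}}$ is $\mathcal{X}'=(\mathcal{X}'_1\times\dots\times\mathcal{X}'_N)_{\mathcal{Z}'}$ via $\langle y,x\rangle=\sum_n\langle y_n,x_n\rangle$. Elements $\nu^*\in\mathcal{X}'$ and $\nu\in\mathcal{X}$ are $(\mathcal{X}',\mathcal{X})$-(Banach) conjugates if $\|\nu^*\|_{\mathcal{X}'}=\|\nu\|_{\mathcal{X}}$ and $\langle\nu,\nu^*\rangle=\|\nu\|_{\mathcal{X}}\|\nu^*\|_{\mathcal{X}'}$. The duality mapping $J(\nu)\subset\mathcal{X}'$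 is the (nonempty) set of all conjugates of $\nu$; when it is single-valued (e.g. when $\mathcal{X}'$ is strictly convex), the duality operator $\mathrm{J}_{\mathcal{X}}:\mathcal{X}\to\mathcal{X}'$ is defined by $\nu^*=\mathrm{J}_{\mathcal{X}}\{\nu\}$. For Hilbert $\mathcal{X}$ it is the Riesz map. If the duality mapping of $\mathcal{Z}'$ is not single-valued at $\boldsymbol{y}$, $\mathrm{J}_{\mathcal{Z}'}\{\boldsymbol{y}\}$ is to be read as a (suitable) Banach conjugate of $\boldsymbol{y}$ in $\mathcal{Z}$. A Banach space is strictly convex if $\|\lambda f_1+(1-\lambda)f_2\|<1$ for all $\lambda\in(0,1)$ and all $f_1\ne f_2$ of unit norm. An extremal point of a convex set $C$ is $f\in C$ such that $f=tf_1+(1-t)f_2$ with $f_1,f_2\in C$, $t\in(0,1)$ implies $f=f_1=f_2$. $S|_{\mathcal{X}_n'}$ denotes the set of $n$th components $\{f_{0,n}: f_0=(f_{0,1},\dots,f_{0,N})\in S\}$. The properness, lower semicontinuity and (strict) convexity of $E$ are understood with respect to its second argument, the first being the fixed data vector.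
   Formalization: Positivity of α_n is asserted only when Z' is strictly convex or has the 1-norm, where (H) and (B) are claimed (it fails for the sup norm); in the 1-norm case a zero strictly convex component contributes K_n=0 instead of K_n=1, since f/‖f‖ is undefined. *)

theory Defs
  imports "HOL-Analysis.Analysis" "HOL-Library.Function_Algebras"
begin

(* Pointwise scalar multiplication (addition comes from Function_Algebras), so that sums,
   convex hulls and extreme points are available for sets of functionals. *)
instantiation "fun" :: (type, real_vector) real_vector
begin

definition scaleR_fun :: "real \<Rightarrow> ('a \<Rightarrow> 'b) \<Rightarrow> 'a \<Rightarrow> 'b" where
  "scaleR_fun c f = (\<lambda>x. c *\<^sub>R f x)"

instance
  by standard (auto simp: scaleR_fun_def plus_fun_def fun_eq_iff scaleR_add_right scaleR_add_left)

end

section \<open>Normed spaces with explicit carriers\<close>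

(* A normed space is a linear subspace of an ambient real vector space type together with its
   own norm, of which only the values on the carrier matter. Nothing relates the norms of
   different spaces over the same type, and every finite family of normed spaces is of this form
   up to isometric isomorphism, e.g. inside the algebraic direct sum. *)
record 'a nspace =
  carr :: "'a set"
  nrm :: "'a \<Rightarrow> real"

definition normed_space :: "'a::real_vector nspace \<Rightarrow> bool" where
  "normed_space E \<longleftrightarrow>
     subspace (carr E) \<and>
     (\<forall>x\<in>carr E. 0 \<le> nrm E x \<and> (nrm E x = 0 \<longleftrightarrow> x = 0)) \<and>
     (\<forall>c. \<forall>x\<in>carr E. nrm E (c *\<^sub>R x) = \<bar>c\<bar> * nrm E x) \<and>
     (\<forall>x\<in>carr E. \<forall>y\<in>carr E. nrm E (x + y) \<le> nrm E x + nrm E y)"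

definition banach_space :: "'a::real_vector nspace \<Rightarrow> bool" where
  "banach_space E \<longleftrightarrow>
     normed_space E \<and>
     (\<forall>u :: nat \<Rightarrow> 'a.
        (\<forall>i. u i \<in> carr E) \<and> (\<forall>\<epsilon>>0. \<exists>k. \<forall>i\<ge>k. \<forall>j\<ge>k. nrm E (u i - u j) < \<epsilon>) \<longrightarrow>
        (\<exists>l\<in>carr E. (\<lambda>i. nrm E (u i - l)) \<longlonglongrightarrow> 0))"

definition inner_product_on :: "'a::real_vector set \<Rightarrow> ('a \<Rightarrow> 'a \<Rightarrow> real) \<Rightarrow> bool" where
  "inner_product_on V ip \<longleftrightarrow>
     (\<forall>x\<in>V. \<forall>y\<in>V. ip x y = ip y x) \<and>
     (\<forall>x\<in>V. \<forall>y\<in>V. \<forall>z\<in>V. ip (x + y) z = ip x z + ip y z) \<and>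
     (\<forall>c. \<forall>x\<in>V. \<forall>y\<in>V. ip (c *\<^sub>R x) y = c * ip x y) \<and>
     (\<forall>x\<in>V. 0 \<le> ip x x \<and> (ip x x = 0 \<longleftrightarrow> x = 0))"

definition hilbert_space :: "'a::real_vector nspace \<Rightarrow> bool" where
  "hilbert_space E \<longleftrightarrow>
     banach_space E \<and>
     (\<exists>ip. inner_product_on (carr E) ip \<and> (\<forall>x\<in>carr E. nrm E x = sqrt (ip x x)))"

definition strictly_convex_space :: "'a::real_vector nspace \<Rightarrow> bool" where
  "strictly_convex_space E \<longleftrightarrow>
     (\<forall>x\<in>carr E. \<forall>y\<in>carr E. nrm E x = 1 \<and> nrm E y = 1 \<and> x \<noteq> y \<longrightarrow>
        (\<forall>t\<in>{0<..<1}. nrm E (t *\<^sub>R x + (1 - t) *\<^sub>R y) < 1))"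

definition unit_ball :: "'a nspace \<Rightarrow> 'a set" where
  "unit_ball E = {x \<in> carr E. nrm E x \<le> 1}"

section \<open>Duality\<close>

(* Functionals on the carrier are made canonical by letting them vanish outside of it. *)
definition dual :: "'a::real_vector nspace \<Rightarrow> ('a \<Rightarrow> real) nspace" where
  "dual E = \<lparr>
     carr = {f. (\<forall>x\<in>carr E. \<forall>y\<in>carr E. f (x + y) = f x + f y) \<and>
                (\<forall>c. \<forall>x\<in>carr E. f (c *\<^sub>R x) = c * f x) \<and>
                (\<exists>B. \<forall>x\<in>carr E. \<bar>f x\<bar> \<le> B * nrm E x) \<and>
                (\<forall>x. x \<notin> carr E \<longrightarrow> f x = 0)},
     nrm = (\<lambda>f. SUP x\<in>unit_ball E. \<bar>f x\<bar>) \<rparr>"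

definition weak_star :: "'a::real_vector nspace \<Rightarrow> ('a \<Rightarrow> real) topology" where
  "weak_star E =
     topology_generated_by {{f \<in> carr (dual E). f x \<in> U} | x U. x \<in> carr E \<and> open U}"

definition reflexive_space :: "'a::real_vector nspace \<Rightarrow> bool" where
  "reflexive_space E \<longleftrightarrow>
     (\<forall>\<Phi>\<in>carr (dual (dual E)). \<exists>x\<in>carr E. \<forall>f\<in>carr (dual E). \<Phi> f = f x)"

(* Conjugacy with respect to a duality product pr between E and F. *)
definition conjugates ::
  "'a nspace \<Rightarrow> 'b nspace \<Rightarrow> ('a \<Rightarrow> 'b \<Rightarrow> real) \<Rightarrow> 'a \<Rightarrow> 'b \<Rightarrow> bool" where
  "conjugates E F pr x f \<longleftrightarrow>
     x \<in> carr E \<and> f \<in> carr F \<and> nrm F f = nrm E x \<and> pr x f = nrm E x * nrm F f"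

definition duality_map :: "'a::real_vector nspace \<Rightarrow> 'a \<Rightarrow> ('a \<Rightarrow> real) set" where
  "duality_map E x = {f. conjugates E (dual E) (\<lambda>x f. f x) x f}"

(* Only meaningful where the duality map is single-valued. *)
definition duality_op :: "'a::real_vector nspace \<Rightarrow> 'a \<Rightarrow> 'a \<Rightarrow> real" where
  "duality_op E x = (THE f. f \<in> duality_map E x)"

definition is_riesz_map :: "'a::real_vector nspace \<Rightarrow> ('a \<Rightarrow> 'a \<Rightarrow> real) \<Rightarrow> bool" where
  "is_riesz_map E R \<longleftrightarrow>
     (\<exists>ip. inner_product_on (carr E) ip \<and> (\<forall>x\<in>carr E. nrm E x = sqrt (ip x x)) \<and>
        (\<forall>x\<in>carr E. R x = (\<lambda>z. if z \<in> carr E then ip x z else 0)))"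

section \<open>Direct products\<close>

definition absolute_norm :: "(real^'n) nspace \<Rightarrow> bool" where
  "absolute_norm Z \<longleftrightarrow> (\<forall>z. nrm Z z = nrm Z (\<chi> n. \<bar>z $ n\<bar>))"

(* The dual of a normed space on all of R^N, identified with R^N through the dot product. *)
definition vec_dual :: "(real^'n) nspace \<Rightarrow> (real^'n) nspace" where
  "vec_dual Z = \<lparr> carr = UNIV, nrm = (\<lambda>y. nrm (dual Z) (\<lambda>z. y \<bullet> z)) \<rparr>"

definition direct_product ::
  "(real^'n) nspace \<Rightarrow> ('n \<Rightarrow> 'b nspace) \<Rightarrow> ('b^'n) nspace" where
  "direct_product Z E = \<lparr>
     carr = {x. \<forall>n. x $ n \<in> carr (E n)},
     nrm = (\<lambda>x. nrm Z (\<chi> n. nrm (E n) (x $ n))) \<rparr>"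

definition pairing :: "'a^'n \<Rightarrow> ('a \<Rightarrow> real)^'n \<Rightarrow> real" where
  "pairing x f = (\<Sum>n\<in>UNIV. (f $ n) (x $ n))"

section \<open>Loss functionals and regularisation\<close>

definition proper_fun :: "('a \<Rightarrow> ennreal) \<Rightarrow> bool" where
  "proper_fun F \<longleftrightarrow> (\<exists>z. F z < \<infinity>)"

definition lsc_fun :: "('a::topological_space \<Rightarrow> ennreal) \<Rightarrow> bool" where
  "lsc_fun F \<longleftrightarrow> (\<forall>z. F z \<le> Liminf (at z) F)"

(* Strictness can only be asked for on the effective domain; when one of the two values is
   infinite, the convexity inequality holds trivially. *)
definition strictly_convex_fun :: "('a::real_vector \<Rightarrow> ennreal) \<Rightarrow> bool" where
  "strictly_convex_fun F \<longleftrightarrow>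
     (\<forall>x y. \<forall>t\<in>{0<..<1}. x \<noteq> y \<and> F x < \<infinity> \<and> F y < \<infinity> \<longrightarrow>
        F (t *\<^sub>R x + (1 - t) *\<^sub>R y) < ennreal t * F x + ennreal (1 - t) * F y)"

definition strictly_convex_on :: "real set \<Rightarrow> (real \<Rightarrow> real) \<Rightarrow> bool" where
  "strictly_convex_on A g \<longleftrightarrow>
     convex A \<and>
     (\<forall>x\<in>A. \<forall>y\<in>A. \<forall>t\<in>{0<..<1}. x \<noteq> y \<longrightarrow>
        g (t * x + (1 - t) * y) < t * g x + (1 - t) * g y)"

section \<open>Solutions and their representation\<close>

definition solution_set ::
  "(real^'n) nspace \<Rightarrow> ('n \<Rightarrow> 'a::real_vector nspace) \<Rightarrow> ('m \<Rightarrow> 'a^'n) \<Rightarrow>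
   (real^'m \<Rightarrow> real^'m \<Rightarrow> ennreal) \<Rightarrow> (real \<Rightarrow> real) \<Rightarrow> real^'m \<Rightarrow> (('a \<Rightarrow> real)^'n) set" where
  "solution_set Z X \<nu> E \<psi> b =
     (let PX' = direct_product (vec_dual Z) (\<lambda>n. dual (X n))
      in {f. is_arg_min (\<lambda>f. E b (\<chi> m. pairing (\<nu> m) f) + ennreal (\<psi> (nrm PX' f)))
                        (\<lambda>f. f \<in> carr PX') f})"

definition scaling :: "real^'n \<Rightarrow> real^'n \<Rightarrow> 'n \<Rightarrow> real" where
  "scaling y ystar n = (if y $ n \<noteq> 0 then y $ n / ystar $ n else 0)"

(* The e k need not be distinct and weights may be zero, so K bounds the number of atoms used. *)
definition atomic_expansion ::
  "'a::real_vector nspace \<Rightarrow> nat \<Rightarrow> (nat \<Rightarrow> real) \<Rightarrow> (nat \<Rightarrow> 'a) \<Rightarrow> 'a \<Rightarrow> bool" where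
  "atomic_expansion E K c e g \<longleftrightarrow>
     (\<forall>k<K. e k extreme_point_of unit_ball E) \<and> g = (\<Sum>k<K. c k *\<^sub>R e k)"

end

theory Submission
  imports Defs
begin

text \<open>Strict convexity makes both terms of the objective constant on the solution set: two
  solutions with different measurements, or with different norms, would be beaten by their midpoint.
  Hence the solution set consists of the functionals of norm at most \<open>r\<close> with a
  prescribed measurement vector \<open>z\<close>, where \<open>r\<close> is the least norm that such
  a functional can have (theorem \<open>solution_set_eq\<close>). By the Hahn--Banach theorem this
  least norm is the dual norm of \<open>z\<close> with respect to the norm that the span of the
  measurement elements induces on coefficient vectors. So the existence of a solution is a
  minimisation over a finite-dimensional space, and a coefficient vector \<open>a\<close> at which
  the dual norm is attained yields an element \<open>\<nu>0\<close> of the span that is conjugate to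
  all solutions at once.

  The pairing of \<open>\<nu>0\<close> with a solution is bounded by the pairing of the vectors of
  component norms, which in turn is bounded by the product of the norms. Conjugacy turns both bounds
  into equalities: the two vectors of component norms are conjugate, and in every factor the
  component of the solution is a norming functional of the component of \<open>\<nu>0\<close>, up to
  scaling. A strictly convex dual admits only one norming functional, which gives the formula with
  the duality operator. If the dual is a Hilbert space, the norming functional represents the
  evaluation map, so it depends linearly on the element and the formula becomes linear in the
  coefficients.

  For the remaining factors the solution set is seen as a compact convex set of functions with the
  topology of pointwise convergence, by the Banach--Alaoglu theorem. The Krein--Milman theorem
  describes each set of components, and it lifts an extreme component to an extreme solution. An
  extreme solution \<open>f0\<close> is an extreme point of a slice of the ball of radius
  \<open>r\<close>. The directions in which one can move from \<open>f0\<close> to both sides inside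
  of the ball form a space on which the measurement map is injective. Since the slice touches the
  ball, the image of this space is orthogonal to \<open>a\<close>, so its dimension is less than the
  number \<open>M\<close> of measurements (for \<open>r = 0\<close> the only solution is 0).
  Minkowski's and Caratheodory's theorems then write \<open>f0\<close> as a convex combination of at
  most \<open>M\<close> extreme points of the ball (theorem \<open>extreme_slice_atoms\<close>). A
  nonzero component of such a point is a multiple of an extreme point of the unit ball of the
  factor, and for the 1-norm only one component is nonzero, so that the atoms are shared out among
  the factors.\<close>

section \<open>Normed spaces and their duals\<close>

lemma normed_spaceD:
  assumes "normed_space E"
  shows normed_subspace: "subspace (carr E)"
    and normed_nonneg: "\<And>x. x \<in> carr E \<Longrightarrow> 0 \<le> nrm E x"
    and normed_eq_0: "\<And>x. x \<in> carr E \<Longrightarrow> nrm E x = 0 \<longleftrightarrow> x = 0"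
    and normed_scale: "\<And>c x. x \<in> carr E \<Longrightarrow> nrm E (c *\<^sub>R x) = \<bar>c\<bar> * nrm E x"
    and normed_triangle: "\<And>x y. x \<in> carr E \<Longrightarrow> y \<in> carr E \<Longrightarrow> nrm E (x + y) \<le> nrm E x + nrm E y"
    and normed_zero_mem: "0 \<in> carr E"
    and normed_zero: "nrm E 0 = 0"
  using assms by (auto simp: normed_space_def subspace_def)

lemma dual_carr_iff:
  "f \<in> carr (dual E) \<longleftrightarrow>
     (\<forall>x\<in>carr E. \<forall>y\<in>carr E. f (x + y) = f x + f y) \<and>
     (\<forall>c. \<forall>x\<in>carr E. f (c *\<^sub>R x) = c * f x) \<and>
     (\<exists>B. \<forall>x\<in>carr E. \<bar>f x\<bar> \<le> B * nrm E x) \<and>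
     (\<forall>x. x \<notin> carr E \<longrightarrow> f x = 0)"
  by (simp add: dual_def)

lemma dualD:
  assumes "f \<in> carr (dual E)"
  shows dual_add: "\<And>x y. x \<in> carr E \<Longrightarrow> y \<in> carr E \<Longrightarrow> f (x + y) = f x + f y"
    and dual_scale: "\<And>c x. x \<in> carr E \<Longrightarrow> f (c *\<^sub>R x) = c * f x"
    and dual_outside: "\<And>x. x \<notin> carr E \<Longrightarrow> f x = 0"
  using assms by (auto simp: dual_carr_iff)

lemma dual_zero:
  assumes "normed_space E" "f \<in> carr (dual E)"
  shows "f 0 = 0"
  using dual_scale[OF assms(2) normed_zero_mem[OF assms(1)], of 0] by simp

text \<open>The dual norm is a supremum over the unit ball and thus only meaningful once the values
  are known to be bounded there; all later estimates of dual norms go through this characterisation.\<close>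

lemma dual_nrm_le_iff:
  assumes E: "normed_space E" and f: "f \<in> carr (dual E)" and r: "0 \<le> r"
  shows "nrm (dual E) f \<le> r \<longleftrightarrow> (\<forall>x\<in>carr E. \<bar>f x\<bar> \<le> r * nrm E x)"
proof -
  obtain B where B: "\<forall>x\<in>carr E. \<bar>f x\<bar> \<le> B * nrm E x"
    using f by (auto simp: dual_carr_iff)
  have "\<bar>f x\<bar> \<le> \<bar>B\<bar>" if "x \<in> unit_ball E" for x
  proof -
    have x: "x \<in> carr E" "nrm E x \<le> 1" using that by (auto simp: unit_ball_def)
    have "\<bar>f x\<bar> \<le> B * nrm E x" using B x by blast
    also have "\<dots> \<le> \<bar>B\<bar> * nrm E x"
      using normed_nonneg[OF E x(1)] by (intro mult_right_mono) auto
    also have "\<dots> \<le> \<bar>B\<bar> * 1" using x by (intro mult_left_mono) auto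
    finally show ?thesis by simp
  qed
  then have bdd: "bdd_above ((\<lambda>x. \<bar>f x\<bar>) ` unit_ball E)" by (intro bdd_aboveI2) auto
  have "0 \<in> unit_ball E"
    by (simp add: unit_ball_def normed_zero_mem[OF E] normed_zero[OF E])
  then have ne: "unit_ball E \<noteq> {}" by auto
  have "nrm (dual E) f \<le> r \<longleftrightarrow> (\<forall>x\<in>unit_ball E. \<bar>f x\<bar> \<le> r)"
    by (simp add: dual_def cSUP_le_iff[OF ne bdd])
  also have "\<dots> \<longleftrightarrow> (\<forall>x\<in>carr E. \<bar>f x\<bar> \<le> r * nrm E x)"
  proof (intro iffI ballI)
    fix x assume *: "\<forall>x\<in>unit_ball E. \<bar>f x\<bar> \<le> r" and x: "x \<in> carr E"
    show "\<bar>f x\<bar> \<le> r * nrm E x"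
    proof (cases "x = 0")
      case True then show ?thesis using dual_zero[OF E f] by (simp add: normed_zero[OF E])
    next
      case False
      then have p: "nrm E x > 0"
        using normed_nonneg[OF E x] normed_eq_0[OF E x] by linarith
      have "(1 / nrm E x) *\<^sub>R x \<in> unit_ball E"
        using x p by (simp add: unit_ball_def normed_scale[OF E] subspace_scale[OF normed_subspace[OF E]])
      then have "\<bar>f ((1 / nrm E x) *\<^sub>R x)\<bar> \<le> r" using * by blast
      then show ?thesis using p by (simp add: dual_scale[OF f x] abs_mult field_simps)
    qed
  next
    fix x assume *: "\<forall>x\<in>carr E. \<bar>f x\<bar> \<le> r * nrm E x" and "x \<in> unit_ball E"
    then have x: "x \<in> carr E" "nrm E x \<le> 1" by (auto simp: unit_ball_def)
    have "\<bar>f x\<bar> \<le> r * nrm E x" using * x by blast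
    also have "\<dots> \<le> r * 1" using x r by (intro mult_left_mono) auto
    finally show "\<bar>f x\<bar> \<le> r" by simp
  qed
  finally show ?thesis .
qed

lemma dual_nrm_nonneg:
  assumes E: "normed_space E" and f: "f \<in> carr (dual E)"
  shows "0 \<le> nrm (dual E) f"
proof (rule ccontr)
  assume n: "\<not> 0 \<le> nrm (dual E) f"
  then have "\<forall>x\<in>carr E. \<bar>f x\<bar> \<le> 0 * nrm E x"
    using dual_nrm_le_iff[OF E f, of 0] by simp
  then have "(SUP x\<in>unit_ball E. \<bar>f x\<bar>) = (SUP x\<in>unit_ball E. 0)"
    by (intro SUP_cong) (auto simp: unit_ball_def)
  moreover have "0 \<in> unit_ball E"
    by (simp add: unit_ball_def normed_zero_mem[OF E] normed_zero[OF E])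
  moreover have "(SUP x\<in>unit_ball E. 0) = (0::real)" if "0 \<in> unit_ball E"
    using that by (intro cSUP_const) auto
  ultimately have "nrm (dual E) f = 0" by (simp add: dual_def)
  with n show False by simp
qed

lemma dual_bound:
  assumes E: "normed_space E" and f: "f \<in> carr (dual E)" and x: "x \<in> carr E"
  shows "\<bar>f x\<bar> \<le> nrm (dual E) f * nrm E x"
  using dual_nrm_le_iff[OF E f dual_nrm_nonneg[OF E f]] x by simp

lemma dual_carrI:
  assumes "\<And>x y. x \<in> carr E \<Longrightarrow> y \<in> carr E \<Longrightarrow> f (x + y) = f x + f y"
    "\<And>c x. x \<in> carr E \<Longrightarrow> f (c *\<^sub>R x) = c * f x"
    "\<And>x. x \<in> carr E \<Longrightarrow> \<bar>f x\<bar> \<le> B * nrm E x"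
    "\<And>x. x \<notin> carr E \<Longrightarrow> f x = 0"
  shows "f \<in> carr (dual E)"
  unfolding dual_carr_iff using assms by blast

lemma scaleR_fun_apply [simp]: "(c *\<^sub>R f) x = c *\<^sub>R f x"
  by (simp add: scaleR_fun_def)

lemma subspace_dual:
  assumes E: "normed_space E"
  shows "subspace (carr (dual E))"
proof (rule subspaceI)
  show "0 \<in> carr (dual E)" by (rule dual_carrI[where B=0]) auto
next
  fix f g assume f: "f \<in> carr (dual E)" and g: "g \<in> carr (dual E)"
  show "f + g \<in> carr (dual E)"
  proof (rule dual_carrI)
    fix x assume x: "x \<in> carr E"
    show "\<bar>(f + g) x\<bar> \<le> (nrm (dual E) f + nrm (dual E) g) * nrm E x"
      using dual_bound[OF E f x] dual_bound[OF E g x] by (simp add: algebra_simps)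
  qed (auto simp: dual_add[OF f] dual_add[OF g] dual_scale[OF f] dual_scale[OF g]
      dual_outside[OF f] dual_outside[OF g] algebra_simps)
next
  fix c f assume f: "f \<in> carr (dual E)"
  show "c *\<^sub>R f \<in> carr (dual E)"
  proof (rule dual_carrI)
    fix x assume x: "x \<in> carr E"
    show "\<bar>(c *\<^sub>R f) x\<bar> \<le> (\<bar>c\<bar> * nrm (dual E) f) * nrm E x"
      using mult_left_mono[OF dual_bound[OF E f x], of "\<bar>c\<bar>"] by (simp add: abs_mult algebra_simps)
  qed (auto simp: dual_add[OF f] dual_scale[OF f] dual_outside[OF f] algebra_simps)
qed

lemma normed_dual:
  assumes E: "normed_space E"
  shows "normed_space (dual E)"
  unfolding normed_space_def
proof (intro conjI ballI allI)
  note sub = subspace_dual[OF E]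
  show "subspace (carr (dual E))" by (fact sub)
  fix f assume f: "f \<in> carr (dual E)"
  show "0 \<le> nrm (dual E) f" by (rule dual_nrm_nonneg[OF E f])
  show "nrm (dual E) f = 0 \<longleftrightarrow> f = 0"
  proof
    assume "nrm (dual E) f = 0"
    then have "f x = 0" for x
      using dual_bound[OF E f, of x] dual_outside[OF f, of x] by (cases "x \<in> carr E") auto
    then show "f = 0" by (auto simp: fun_eq_iff)
  next
    assume "f = 0"
    then have "nrm (dual E) f \<le> 0" by (subst dual_nrm_le_iff[OF E f]) auto
    with dual_nrm_nonneg[OF E f] show "nrm (dual E) f = 0" by simp
  qed
  have le: "nrm (dual E) (c *\<^sub>R f) \<le> \<bar>c\<bar> * nrm (dual E) f" if f: "f \<in> carr (dual E)" for c f
  proof (subst dual_nrm_le_iff[OF E subspace_scale[OF sub f]]; (intro ballI)?)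
    fix x assume x: "x \<in> carr E"
    show "\<bar>(c *\<^sub>R f) x\<bar> \<le> \<bar>c\<bar> * nrm (dual E) f * nrm E x"
      using mult_left_mono[OF dual_bound[OF E f x], of "\<bar>c\<bar>"] by (simp add: abs_mult algebra_simps)
  qed (simp add: dual_nrm_nonneg[OF E f])
  fix c
  show "nrm (dual E) (c *\<^sub>R f) = \<bar>c\<bar> * nrm (dual E) f"
  proof (cases "c = 0")
    case True
    then show ?thesis using le[OF f, of c] dual_nrm_nonneg[OF E subspace_scale[OF sub f, of c]] by simp
  next
    case False
    then show ?thesis
      using le[OF f, of c] le[OF subspace_scale[OF sub f, of c], of "1 / c"]
      by (simp add: field_simps abs_mult)
  qed
next
  note sub = subspace_dual[OF E]
  fix f g assume f: "f \<in> carr (dual E)" and g: "g \<in> carr (dual E)"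
  show "nrm (dual E) (f + g) \<le> nrm (dual E) f + nrm (dual E) g"
  proof (subst dual_nrm_le_iff[OF E subspace_add[OF sub f g]]; (intro ballI)?)
    fix x assume x: "x \<in> carr E"
    show "\<bar>(f + g) x\<bar> \<le> (nrm (dual E) f + nrm (dual E) g) * nrm E x"
      using dual_bound[OF E f x] dual_bound[OF E g x] by (simp add: algebra_simps)
  qed (simp add: dual_nrm_nonneg[OF E f] dual_nrm_nonneg[OF E g])
qed

section \<open>Norms on R^n\<close>

lemma fin_nrm_upper:
  fixes Z :: "(real^'n) nspace"
  assumes Z: "normed_space Z" and U: "carr Z = UNIV"
  shows "\<exists>C\<ge>0. \<forall>z. nrm Z z \<le> C * norm z"
proof (intro exI conjI allI)
  let ?C = "\<Sum>i\<in>(UNIV::'n set). nrm Z (axis i 1)"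
  show "0 \<le> ?C" by (intro sum_nonneg) (simp add: normed_nonneg[OF Z] U)
  fix z
  have sum_le: "nrm Z (\<Sum>i\<in>I. f i) \<le> (\<Sum>i\<in>I. nrm Z (f i))" if "finite I" for I and f :: "'n \<Rightarrow> _"
    using that
  proof induction
    case (insert i I)
    then show ?case using normed_triangle[OF Z, of "f i" "\<Sum>i\<in>I. f i"] by (simp add: U)
  qed (simp add: normed_zero[OF Z])
  have "nrm Z z = nrm Z (\<Sum>i\<in>UNIV. z $ i *\<^sub>R axis i 1)"
    by (metis basis_expansion scalar_mult_eq_scaleR)
  also have "\<dots> \<le> (\<Sum>i\<in>UNIV. \<bar>z $ i\<bar> * nrm Z (axis i 1))"
    using sum_le[of UNIV "\<lambda>i. z $ i *\<^sub>R axis i 1"] by (simp add: normed_scale[OF Z] U)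
  also have "\<dots> \<le> (\<Sum>i\<in>UNIV. norm z * nrm Z (axis i 1))"
    by (intro sum_mono mult_right_mono component_le_norm_cart) (simp add: normed_nonneg[OF Z] U)
  finally show "nrm Z z \<le> ?C * norm z" by (simp add: sum_distrib_left mult.commute)
qed

lemma fin_nrm_continuous:
  fixes Z :: "(real^'n) nspace"
  assumes Z: "normed_space Z" and U: "carr Z = UNIV"
  shows "continuous_on A (nrm Z)"
proof -
  obtain C where C: "C \<ge> 0" "\<And>z. nrm Z z \<le> C * norm z" using fin_nrm_upper[OF Z U] by blast
  have *: "nrm Z x - nrm Z y \<le> C * dist x y" for x y
    using normed_triangle[OF Z, of "x - y" y] C(2)[of "x - y"] by (simp add: U dist_norm)
  then have abs: "dist (nrm Z x) (nrm Z y) \<le> C * dist x y" for x y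
    using *[of x y] *[of y x] by (simp add: dist_real_def abs_le_iff dist_commute)
  have "C-lipschitz_on A (nrm Z)"
    by (rule lipschitz_onI) (use abs C in auto)
  then show ?thesis by (rule lipschitz_on_continuous_on)
qed

text \<open>The minimum of the norm over the compact Euclidean unit sphere is positive.\<close>

lemma fin_nrm_lower:
  fixes Z :: "(real^'n) nspace"
  assumes Z: "normed_space Z" and U: "carr Z = UNIV"
  shows "\<exists>c>0. \<forall>z. c * norm z \<le> nrm Z z"
proof -
  obtain w where w: "w \<in> sphere (0::real^'n) 1" "\<forall>z\<in>sphere 0 1. nrm Z w \<le> nrm Z z"
    using continuous_attains_inf[OF compact_sphere _ fin_nrm_continuous[OF Z U]]
    by (metis sphere_empty not_one_less_zero not_less_iff_gr_or_eq sphere_eq_empty zero_less_one)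
  have "w \<noteq> 0" using w by auto
  then have pos: "nrm Z w > 0"
    using normed_nonneg[OF Z, of w] normed_eq_0[OF Z, of w] by (simp add: U)
  have "nrm Z w * norm z \<le> nrm Z z" for z
  proof (cases "z = 0")
    case False
    then have "nrm Z w \<le> nrm Z ((1 / norm z) *\<^sub>R z)" using w(2) by simp
    then show ?thesis using False by (simp add: normed_scale[OF Z] U field_simps)
  qed (simp add: normed_zero[OF Z])
  with pos show ?thesis by blast
qed

lemma inner_in_dual:
  fixes Z :: "(real^'n) nspace"
  assumes Z: "normed_space Z" and U: "carr Z = UNIV"
  shows "(\<lambda>z. y \<bullet> z) \<in> carr (dual Z)"
proof -
  obtain c where c: "c > 0" "\<And>z. c * norm z \<le> nrm Z z" using fin_nrm_lower[OF Z U] by blast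
  show ?thesis
  proof (rule dual_carrI)
    fix z
    have "\<bar>y \<bullet> z\<bar> \<le> norm y * norm z" by (rule Cauchy_Schwarz_ineq2)
    also have "\<dots> \<le> norm y * (nrm Z z / c)"
      using c by (intro mult_left_mono) (auto simp: field_simps)
    finally show "\<bar>y \<bullet> z\<bar> \<le> (norm y / c) * nrm Z z" by simp
  qed (auto simp: U inner_add_right)
qed

lemma vec_dual_carr [simp]: "carr (vec_dual Z) = UNIV"
  by (simp add: vec_dual_def)

lemma vec_dual_le_iff:
  fixes Z :: "(real^'n) nspace"
  assumes Z: "normed_space Z" and U: "carr Z = UNIV" and "0 \<le> r"
  shows "nrm (vec_dual Z) y \<le> r \<longleftrightarrow> (\<forall>z. \<bar>y \<bullet> z\<bar> \<le> r * nrm Z z)"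
  using dual_nrm_le_iff[OF Z inner_in_dual[OF Z U] \<open>0 \<le> r\<close>] by (simp add: vec_dual_def U)

lemma vec_dual_nonneg:
  fixes Z :: "(real^'n) nspace"
  assumes Z: "normed_space Z" and U: "carr Z = UNIV"
  shows "0 \<le> nrm (vec_dual Z) y"
  using dual_nrm_nonneg[OF Z inner_in_dual[OF Z U]] by (simp add: vec_dual_def)

lemma vec_dual_bound:
  fixes Z :: "(real^'n) nspace"
  assumes Z: "normed_space Z" and U: "carr Z = UNIV"
  shows "\<bar>y \<bullet> z\<bar> \<le> nrm (vec_dual Z) y * nrm Z z"
  using dual_bound[OF Z inner_in_dual[OF Z U]] by (simp add: vec_dual_def U)

lemma normed_vec_dual:
  fixes Z :: "(real^'n) nspace"
  assumes Z: "normed_space Z" and U: "carr Z = UNIV"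
  shows "normed_space (vec_dual Z)"
proof -
  note D = normed_dual[OF Z] and I = inner_in_dual[OF Z U]
  have *: "(\<lambda>z. y \<bullet> z) + (\<lambda>z. y' \<bullet> z) = (\<lambda>z. (y + y') \<bullet> z)"
    "c *\<^sub>R (\<lambda>z. y \<bullet> z) = (\<lambda>z. (c *\<^sub>R y) \<bullet> z)" for y y' :: "real^'n" and c
    by (auto simp: fun_eq_iff inner_add_left)
  have "(\<lambda>z. y \<bullet> z) = 0 \<longleftrightarrow> y = 0" for y :: "real^'n"
    by (auto simp: fun_eq_iff)
  then show ?thesis
    unfolding normed_space_def vec_dual_def
    using normed_nonneg[OF D I] normed_eq_0[OF D I] normed_scale[OF D I] normed_triangle[OF D I I] 
    by (auto simp: * simp del: inner_scaleR_left)
qed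

text \<open>The unit sphere of the norm is compact, so the supremum that defines the dual norm is
  attained.\<close>

lemma vec_dual_conjugate_exists:
  fixes Z :: "(real^'n) nspace"
  assumes Z: "normed_space Z" and U: "carr Z = UNIV"
  shows "\<exists>ystar. conjugates (vec_dual Z) Z (\<bullet>) y ystar"
proof -
  obtain c where c: "c > 0" "\<And>z. c * norm z \<le> nrm Z z" using fin_nrm_lower[OF Z U] by blast
  let ?K = "{z. nrm Z z = 1}"
  have "closed ?K"
    by (intro closed_Collect_eq fin_nrm_continuous[OF Z U] continuous_intros)
  moreover have "bounded ?K"
  proof (rule boundedI[where B="1/c"])
    fix z assume "z \<in> ?K"
    then show "norm z \<le> 1 / c" using c(1) c(2)[of z] by (simp add: field_simps)
  qed
  ultimately have K: "compact ?K" by (simp add: compact_eq_bounded_closed)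
  have unit: "(1 / nrm Z z) *\<^sub>R z \<in> ?K" and pos: "nrm Z z > 0" if "z \<noteq> 0" for z
    using that normed_eq_0[OF Z, of z] normed_nonneg[OF Z, of z] by (auto simp: normed_scale[OF Z] U)
  have "axis undefined 1 \<noteq> (0::real^'n)" by (simp add: axis_eq_0_iff)
  then have ne: "?K \<noteq> {}" using unit by blast
  obtain w where w: "w \<in> ?K" "\<And>z. z \<in> ?K \<Longrightarrow> y \<bullet> z \<le> y \<bullet> w"
    using continuous_attains_sup[OF K ne, of "\<lambda>z. y \<bullet> z"] by (force intro: continuous_intros)
  define m where "m = y \<bullet> w"
  have "- w \<in> ?K" using w(1) normed_scale[OF Z, of w "-1"] by (simp add: U)
  then have m0: "m \<ge> 0" using w(2)[of "-w"] by (simp add: m_def)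
  have le: "y \<bullet> z \<le> m * nrm Z z" for z
  proof (cases "z = 0")
    case False
    then show ?thesis using w(2)[OF unit[OF False]] pos[OF False] by (simp add: m_def field_simps)
  qed (simp add: normed_zero[OF Z])
  have "\<bar>y \<bullet> z\<bar> \<le> m * nrm Z z" for z
    using le[of z] le[of "-z"] normed_scale[OF Z, of z "-1"] by (simp add: U abs_le_iff)
  then have "nrm (vec_dual Z) y \<le> m" by (simp add: vec_dual_le_iff[OF Z U m0])
  moreover have "m \<le> nrm (vec_dual Z) y"
    using vec_dual_bound[OF Z U, of y w] w(1) by (simp add: m_def)
  ultimately have "conjugates (vec_dual Z) Z (\<bullet>) y (m *\<^sub>R w)"
    using w(1) m0 by (simp add: conjugates_def U normed_scale[OF Z]) (simp add: m_def)
  then show ?thesis by blast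
qed

lemma absolute_norm_sign:
  assumes A: "absolute_norm Z" and s: "\<And>n. \<bar>z $ n\<bar> = \<bar>w $ n\<bar>"
  shows "nrm Z z = nrm Z w"
proof -
  have "nrm Z z = nrm Z (\<chi> n. \<bar>z $ n\<bar>)" "nrm Z w = nrm Z (\<chi> n. \<bar>w $ n\<bar>)"
    using A unfolding absolute_norm_def by blast+
  then show ?thesis by (simp add: s)
qed

text \<open>Shrinking one coordinate of a vector replaces the vector by a convex combination of
  itself and its reflection in that coordinate, which has the same absolute norm. The coordinates
  are shrunk one after the other.\<close>

lemma absolute_norm_mono:
  fixes Z :: "(real^'n) nspace"
  assumes Z: "normed_space Z" and U: "carr Z = UNIV" and A: "absolute_norm Z"
    and le: "\<And>n. \<bar>z $ n\<bar> \<le> \<bar>w $ n\<bar>"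
  shows "nrm Z z \<le> nrm Z w"
proof -
  have "nrm Z (\<chi> n. if n \<in> I then z $ n else w $ n) \<le> nrm Z w" if "finite I" for I
    using that
  proof induction
    case empty
    then show ?case by simp
  next
    case (insert k I)
    define v where "v = (\<chi> n. if n \<in> I then z $ n else w $ n)"
    define v' where "v' = (\<chi> n. if n = k then - (v $ n) else v $ n)"
    define t where "t = (if w $ k = 0 then 1 else (1 + z $ k / w $ k) / 2)"
    have "\<bar>z $ k / w $ k\<bar> \<le> 1" using le[of k] by (simp add: abs_divide divide_le_eq_1)
    then have "-1 \<le> z $ k / w $ k" "z $ k / w $ k \<le> 1" by linarith+
    then have t: "0 \<le> t" "t \<le> 1" unfolding t_def by (simp_all del: divide_le_eq_1)
    have vk: "v $ k = w $ k" using insert by (simp add: v_def)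
    have zk: "z $ k = 0" if "w $ k = 0" using le[of k] that by simp
    have eq: "(\<chi> n. if n \<in> insert k I then z $ n else w $ n) = t *\<^sub>R v + (1 - t) *\<^sub>R v'"
    proof (rule vec_eq_iff[THEN iffD2], rule allI)
      fix n
      show "(\<chi> n. if n \<in> insert k I then z $ n else w $ n) $ n = (t *\<^sub>R v + (1 - t) *\<^sub>R v') $ n"
      proof (cases "n = k")
        case True
        then show ?thesis using zk vk by (simp add: v'_def t_def field_simps)
      next
        case False
        then show ?thesis by (simp add: v'_def algebra_simps) (simp add: v_def)
      qed
    qed
    have v': "nrm Z v' = nrm Z v" by (rule absolute_norm_sign[OF A]) (simp add: v'_def)
    have "nrm Z (t *\<^sub>R v + (1 - t) *\<^sub>R v') \<le> t * nrm Z v + (1 - t) * nrm Z v'"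
      using normed_triangle[OF Z, of "t *\<^sub>R v" "(1 - t) *\<^sub>R v'"] t
      by (simp add: U normed_scale[OF Z])
    also have "\<dots> = nrm Z v" by (simp add: v' algebra_simps)
    also have "\<dots> \<le> nrm Z w" using insert unfolding v_def by simp
    finally show ?case by (simp only: eq)
  qed
  from this[of UNIV] show ?thesis by simp
qed

lemma absolute_norm_vec_dual:
  fixes Z :: "(real^'n) nspace"
  assumes Z: "normed_space Z" and U: "carr Z = UNIV" and A: "absolute_norm Z"
  shows "absolute_norm (vec_dual Z)"
proof -
  have *: "nrm (vec_dual Z) y \<le> nrm (vec_dual Z) y'" if "\<And>n. \<bar>y $ n\<bar> = \<bar>y' $ n\<bar>" for y y'
  proof (subst vec_dual_le_iff[OF Z U vec_dual_nonneg[OF Z U]], intro allI)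
    fix z :: "real^'n"
    define z' where "z' = (\<chi> n. sgn (y $ n) * sgn (y' $ n) * z $ n)"
    have "y $ n * z $ n = y' $ n * z' $ n" for n
      using that[of n] by (auto simp: z'_def sgn_if abs_if split: if_splits)
    then have "y \<bullet> z = y' \<bullet> z'" by (simp add: inner_vec_def)
    also have "\<bar>\<dots>\<bar> \<le> nrm (vec_dual Z) y' * nrm Z z'" by (rule vec_dual_bound[OF Z U])
    also have "\<dots> \<le> nrm (vec_dual Z) y' * nrm Z z"
      by (intro mult_left_mono absolute_norm_mono[OF Z U A] vec_dual_nonneg[OF Z U])
        (auto simp: z'_def sgn_if abs_mult)
    finally show "\<bar>y \<bullet> z\<bar> \<le> nrm (vec_dual Z) y' * nrm Z z" .
  qed
  show ?thesis unfolding absolute_norm_def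
    by (intro allI antisym *) auto
qed

section \<open>The Hahn--Banach theorem\<close>

text \<open>Partial functionals are represented by their graphs, that is, by subspaces of the
  product with the reals. A subspace on which the second coordinate is dominated by r times the norm
  of the first is the graph of a function, because it contains no \<open>(0, t)\<close> with
  \<open>t \<noteq> 0\<close>, and unions of chains of such subspaces are again of this kind. A
  maximal one is defined on the whole carrier: the value at a further point can be chosen between
  the two bounds that the domination imposes on it.\<close>

theorem hahn_banach:
  fixes E :: "'a::real_vector nspace" and G0 :: "('a \<times> real) set"
  assumes E: "normed_space E" and r: "0 \<le> r"
    and G0: "subspace G0" "G0 \<subseteq> carr E \<times> UNIV" "\<And>x t. (x, t) \<in> G0 \<Longrightarrow> t \<le> r * nrm E x"
  shows "\<exists>F\<in>carr (dual E). nrm (dual E) F \<le> r \<and> (\<forall>(x,t)\<in>G0. F x = t)"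
proof -
  note C = normed_subspace[OF E]
  define A where "A = {G. subspace G \<and> G0 \<subseteq> G \<and> G \<subseteq> carr E \<times> UNIV \<and> (\<forall>(x,t)\<in>G. t \<le> r * nrm E x)}"
  have "\<exists>M\<in>A. \<forall>X\<in>A. M \<subseteq> X \<longrightarrow> X = M"
  proof (rule subset_Zorn_nonempty)
    show "A \<noteq> {}" using G0 by (auto simp: A_def)
  next
    fix \<C> assume ne: "\<C> \<noteq> {}" and ch: "subset.chain A \<C>"
    have sub: "subspace G" if "G \<in> \<C>" for G using ch that by (auto simp: subset.chain_def A_def)
    have "subspace (\<Union>\<C>)"
    proof (rule subspaceI)
      show "0 \<in> \<Union>\<C>" using ne sub by (auto intro: subspace_0)
    next
      fix p q assume "p \<in> \<Union>\<C>" "q \<in> \<Union>\<C>"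
      then obtain G H where "G \<in> \<C>" "H \<in> \<C>" "p \<in> G" "q \<in> H" by blast
      moreover have "G \<subseteq> H \<or> H \<subseteq> G" using ch calculation by (auto simp: subset.chain_def)
      ultimately show "p + q \<in> \<Union>\<C>" by (meson UnionI sub subsetD subspace_add)
    next
      fix c p assume "p \<in> \<Union>\<C>"
      then show "c *\<^sub>R p \<in> \<Union>\<C>" by (meson Union_iff sub subspace_scale)
    qed
    moreover have "G0 \<subseteq> G" if "G \<in> \<C>" for G
      using ch that by (auto simp: subset.chain_def A_def)
    then have "G0 \<subseteq> \<Union>\<C>" using ne by blast
    moreover have "\<Union>\<C> \<subseteq> carr E \<times> UNIV" using ch by (auto simp: subset.chain_def A_def)
    moreover have "\<forall>(x,t)\<in>\<Union>\<C>. t \<le> r * nrm E x" using ch by (auto simp: subset.chain_def A_def)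
    ultimately show "\<Union>\<C> \<in> A" by (simp add: A_def)
  qed
  then obtain G where GA: "G \<in> A" and max: "\<And>X. X \<in> A \<Longrightarrow> G \<subseteq> X \<Longrightarrow> X = G" by blast
  have G: "subspace G" "G0 \<subseteq> G" "\<And>x t. (x, t) \<in> G \<Longrightarrow> x \<in> carr E"
      "\<And>x t. (x, t) \<in> G \<Longrightarrow> t \<le> r * nrm E x"
    using GA by (auto simp: A_def)
  have fn: "t = s" if "(x, t) \<in> G" "(x, s) \<in> G" for x s t
  proof -
    have "(0, t - s) \<in> G" "(0, s - t) \<in> G"
      using subspace_diff[OF G(1) that] subspace_diff[OF G(1) that(2) that(1)] by auto
    then show ?thesis using G(4)[of 0 "t - s"] G(4)[of 0 "s - t"] by (simp add: normed_zero[OF E])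
  qed
  have total: "\<exists>t. (x0, t) \<in> G" if x0: "x0 \<in> carr E" for x0
  proof -
    let ?L = "(\<lambda>(x,t). t - r * nrm E (x - x0)) ` G"
    have G00: "(0, 0) \<in> G" using subspace_0[OF G(1)] by (simp add: zero_prod_def)
    then have ne: "?L \<noteq> {}" by blast
    have sep: "t - r * nrm E (x - x0) \<le> r * nrm E (x' + x0) - t'"
      if "(x, t) \<in> G" "(x', t') \<in> G" for x t x' t'
    proof -
      have "(x + x', t + t') \<in> G" using subspace_add[OF G(1) that] by simp
      then have "t + t' \<le> r * nrm E (x + x')" by (rule G(4))
      also have "\<dots> = r * nrm E ((x - x0) + (x' + x0))" by (simp add: algebra_simps)
      also have "\<dots> \<le> r * (nrm E (x - x0) + nrm E (x' + x0))"
        using G(3)[OF that(1)] G(3)[OF that(2)] x0 C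
        by (intro mult_left_mono normed_triangle[OF E] r subspace_add subspace_diff) auto
      finally show ?thesis by (simp add: algebra_simps)
    qed
    define s where "s = Sup ?L"
    have bdd: "bdd_above ?L" 
      by (rule bdd_aboveI2[where M="r * nrm E (0 + x0) - 0"]) (use sep[OF _ G00] in auto)
    have lo: "t - r * nrm E (x - x0) \<le> s" if "(x, t) \<in> G" for x t
      unfolding s_def by (rule cSup_upper[OF _ bdd]) (use that in force)
    have hi: "s \<le> r * nrm E (x + x0) - t" if "(x, t) \<in> G" for x t
      unfolding s_def by (rule cSup_least[OF ne]) (use sep[OF _ that] in auto)
    define H where "H = {g + k *\<^sub>R (x0, s) | g k. g \<in> G}"
    have Hsub: "subspace H"
    proof (rule subspaceI)
      show "0 \<in> H" unfolding H_def using subspace_0[OF G(1)]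
        by (intro CollectI exI[of _ 0] conjI) (auto simp: zero_prod_def)
    next
      fix p q assume "p \<in> H" "q \<in> H"
      then obtain g k h l where *: "p = g + k *\<^sub>R (x0, s)" "q = h + l *\<^sub>R (x0, s)" "g \<in> G" "h \<in> G"
        by (auto simp: H_def)
      then have "p + q = (g + h) + (k + l) *\<^sub>R (x0, s)" by (simp add: algebra_simps)
      then show "p + q \<in> H" unfolding H_def using subspace_add[OF G(1) *(3,4)] by blast
    next
      fix c p assume "p \<in> H"
      then obtain g k where *: "p = g + k *\<^sub>R (x0, s)" "g \<in> G" by (auto simp: H_def)
      then have "c *\<^sub>R p = c *\<^sub>R g + (c * k) *\<^sub>R (x0, s)" by (simp add: scaleR_add_right)
      then show "c *\<^sub>R p \<in> H" unfolding H_def using subspace_scale[OF G(1) *(2)] by blast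
    qed
    have GH: "G \<subseteq> H"
    proof
      fix g assume "g \<in> G"
      then show "g \<in> H" unfolding H_def by (intro CollectI exI[of _ g] exI[of _ 0]) (simp add: zero_prod_def)
    qed
    have dom: "t + k * s \<le> r * nrm E (x + k *\<^sub>R x0)" if xt: "(x, t) \<in> G" for x t k
    proof -
      have c: "x \<in> carr E" using G(3)[OF xt] .
      have inG: "((1 / \<bar>k\<bar>) *\<^sub>R x, t / \<bar>k\<bar>) \<in> G"
        using subspace_scale[OF G(1) xt, of "1 / \<bar>k\<bar>"] by simp
      consider "k = 0" | "k > 0" | "k < 0" by linarith
      then show ?thesis
      proof cases
        case 1 then show ?thesis using G(4)[OF xt] by simp
      next
        case 2
        have "s + t / k \<le> r * nrm E ((1 / k) *\<^sub>R x + x0)" using hi[OF inG] 2 by simp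
        also have "(1 / k) *\<^sub>R x + x0 = (1 / k) *\<^sub>R (x + k *\<^sub>R x0)" using 2 by (simp add: algebra_simps)
        also have "r * nrm E \<dots> = r * nrm E (x + k *\<^sub>R x0) / k"
          using 2 c x0 C by (subst normed_scale[OF E]) (auto intro: subspace_add subspace_scale)
        finally have "k * (s + t / k) \<le> k * (r * nrm E (x + k *\<^sub>R x0) / k)"
          using 2 by (intro mult_left_mono) auto
        then show ?thesis using 2 by (simp add: distrib_left)
      next
        case 3
        have "t / (- k) - s \<le> r * nrm E ((1 / (- k)) *\<^sub>R x - x0)" using lo[OF inG] 3 by simp
        also have "(1 / (- k)) *\<^sub>R x - x0 = (1 / (- k)) *\<^sub>R (x + k *\<^sub>R x0)" using 3 by (simp add: algebra_simps)
        also have "r * nrm E \<dots> = r * nrm E (x + k *\<^sub>R x0) / (- k)"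
          using 3 c x0 C by (subst normed_scale[OF E]) (auto intro: subspace_add subspace_scale)
        finally have "(- k) * (t / (- k) - s) \<le> (- k) * (r * nrm E (x + k *\<^sub>R x0) / (- k))"
          using 3 by (intro mult_left_mono) auto
        then show ?thesis using 3 by (simp add: right_diff_distrib)
      qed
    qed
    have "H \<in> A"
      unfolding A_def
    proof (intro CollectI conjI)
      show "subspace H" "G0 \<subseteq> H" using Hsub GH G(2) by auto
      show "H \<subseteq> carr E \<times> UNIV"
        using G(3) x0 C by (auto simp: H_def intro!: subspace_add subspace_scale)
      show "\<forall>(x, t)\<in>H. t \<le> r * nrm E x" using dom by (auto simp: H_def)
    qed
    then have "H = G" using max GH by blast
    moreover have "(x0, s) \<in> H"
      unfolding H_def using subspace_0[OF G(1)] by (intro CollectI exI[of _ 0] exI[of _ 1]) (auto simp: zero_prod_def)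
    ultimately show ?thesis by blast
  qed
  define F where "F x = (if x \<in> carr E then THE t. (x, t) \<in> G else 0)" for x
  have FG: "(x, F x) \<in> G" if "x \<in> carr E" for x
    unfolding F_def using total[OF that] fn that by (auto intro: theI2)
  have Feq: "F x = t" if "(x, t) \<in> G" for x t using FG[OF G(3)[OF that]] fn that by blast
  have Fle: "F x \<le> r * nrm E x" if "x \<in> carr E" for x using FG[OF that] by (rule G(4))
  have Fsc: "F (c *\<^sub>R x) = c * F x" if "x \<in> carr E" for c x
    using subspace_scale[OF G(1) FG[OF that], of c] by (intro Feq) simp
  have Fabs: "\<bar>F x\<bar> \<le> r * nrm E x" if "x \<in> carr E" for x
    using Fle[OF that] Fle[OF subspace_scale[OF C that, of "-1"]] Fsc[OF that, of "-1"]
      normed_scale[OF E that, of "-1"] by (simp add: abs_le_iff)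
  have F: "F \<in> carr (dual E)"
  proof (rule dual_carrI[OF _ Fsc Fabs])
    fix x y assume "x \<in> carr E" "y \<in> carr E"
    then show "F (x + y) = F x + F y"
      using subspace_add[OF G(1) FG FG, of x y] by (intro Feq) simp
  qed (simp_all add: F_def)
  moreover have "nrm (dual E) F \<le> r" using Fabs by (simp add: dual_nrm_le_iff[OF E F r])
  moreover have "\<forall>(x,t)\<in>G0. F x = t" using Feq G(2) by blast
  ultimately show ?thesis by blast
qed

corollary norming_functional:
  fixes E :: "'a::real_vector nspace"
  assumes E: "normed_space E" and x: "x \<in> carr E"
  shows "\<exists>f. f \<in> duality_map E x"
proof -
  define G0 where "G0 = range (\<lambda>k. (k *\<^sub>R x, k * nrm E x))"
  have "linear (\<lambda>k. (k *\<^sub>R x, k * nrm E x))"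
    by (rule linearI) (auto simp: algebra_simps)
  then have sub: "subspace G0" unfolding G0_def by (rule linear_subspace_image) simp
  have dom: "k * nrm E x \<le> 1 * nrm E (k *\<^sub>R x)" for k
    using normed_nonneg[OF E x] by (simp add: normed_scale[OF E x] mult_right_mono)
  obtain F where F: "F \<in> carr (dual E)" "nrm (dual E) F \<le> 1" "\<forall>(u,t)\<in>G0. F u = t"
    using hahn_banach[OF E zero_le_one sub] dom subspace_scale[OF normed_subspace[OF E] x]
    by (force simp: G0_def)
  have Fx: "F x = nrm E x" 
  proof -
    have "(1 *\<^sub>R x, 1 * nrm E x) \<in> G0" unfolding G0_def by blast
    then show ?thesis using F(3) by auto
  qed
  define f where "f = nrm E x *\<^sub>R F"
  have f: "f \<in> carr (dual E)" unfolding f_def by (rule subspace_scale[OF subspace_dual[OF E] F(1)])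
  have "nrm (dual E) f \<le> nrm E x"
    using F(2) normed_nonneg[OF E x]
    by (simp add: f_def normed_scale[OF normed_dual[OF E] F(1)] mult_left_le)
  moreover have fx: "f x = nrm E x * nrm E x" by (simp add: f_def Fx)
  moreover have "nrm E x \<le> nrm (dual E) f"
  proof (cases "nrm E x = 0")
    case False
    then show ?thesis using dual_bound[OF E f x] fx normed_nonneg[OF E x] by simp
  qed (simp add: dual_nrm_nonneg[OF E f])
  ultimately have "nrm (dual E) f = nrm E x" by simp
  then have "f \<in> duality_map E x" using f fx x by (simp add: duality_map_def conjugates_def)
  then show ?thesis by blast
qed

section \<open>The Krein--Milman theorem for pointwise convergence\<close>

lemma compact_imp_closed_fun:
  fixes K :: "('i \<Rightarrow> real) set"
  assumes "compact K" shows "closed K"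
proof -
  have "Hausdorff_space (euclidean :: ('i \<Rightarrow> real) topology)"
    by (metis Hausdorff_space_euclidean Hausdorff_space_product_topology euclidean_product_topology)
  then show ?thesis
    using compactin_imp_closedin[of euclidean K] assms by (simp add: compactin_euclidean_iff)
qed

lemma compact_fun_box:
  assumes "\<And>i. compact (B i)"
  shows "compact {f :: 'i \<Rightarrow> real. \<forall>i. f i \<in> B i}"
proof -
  have "compactin (product_topology (\<lambda>i. euclidean) UNIV) (PiE UNIV B)"
    by (subst compactin_PiE) (use assms in auto)
  moreover have "PiE UNIV B = {f. \<forall>i. f i \<in> B i}" by auto
  ultimately show ?thesis by (simp add: euclidean_product_topology)
qed

lemma open_fun_basic_nhd:
  fixes V :: "('i \<Rightarrow> real) set"
  assumes "open V" "f \<in> V"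
  shows "\<exists>T. finite {i. T i \<noteq> UNIV} \<and> (\<forall>i. open (T i)) \<and> (\<forall>i. f i \<in> T i) \<and>
    {h. \<forall>i. h i \<in> T i} \<subseteq> V"
proof -
  obtain T where "f \<in> PiE UNIV T" "\<forall>i. openin euclidean (T i)"
      "finite {i. T i \<noteq> topspace (euclidean :: real topology)}" "PiE UNIV T \<subseteq> V"
    using product_topology_open_contains_basis[OF assms(1)[unfolded open_fun_def] assms(2)] by blast
  then show ?thesis by (intro exI[of _ T]) (simp add: PiE_UNIV_domain Pi_def)
qed

text \<open>The topology on functions is that of pointwise convergence, so a neighbourhood restricts
  only finitely many coordinates.\<close>

lemma closure_fun_iff:
  fixes H :: "('i \<Rightarrow> real) set"
  shows "f \<in> closure H \<longleftrightarrow> (\<forall>I \<epsilon>. finite I \<and> 0 < \<epsilon> \<longrightarrow> (\<exists>h\<in>H. \<forall>i\<in>I. \<bar>h i - f i\<bar> < \<epsilon>))"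
proof
  assume f: "f \<in> closure H"
  show "\<forall>I \<epsilon>. finite I \<and> 0 < \<epsilon> \<longrightarrow> (\<exists>h\<in>H. \<forall>i\<in>I. \<bar>h i - f i\<bar> < \<epsilon>)"
  proof (intro allI impI, elim conjE)
    fix I :: "'i set" and \<epsilon> :: real assume I: "finite I" "0 < \<epsilon>"
    let ?U = "\<Inter>i\<in>I. {h. \<bar>h i - f i\<bar> < \<epsilon>}"
    have "open ?U"
      by (intro open_INT[OF I(1)] ballI open_Collect_less continuous_intros continuous_on_product_coordinates)
    moreover have "f \<in> ?U" using I by auto
    ultimately have "H \<inter> ?U \<noteq> {}" using f unfolding closure_iff_nhds_not_empty by blast
    then show "\<exists>h\<in>H. \<forall>i\<in>I. \<bar>h i - f i\<bar> < \<epsilon>" by auto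
  qed
next
  assume R: "\<forall>I \<epsilon>. finite I \<and> 0 < \<epsilon> \<longrightarrow> (\<exists>h\<in>H. \<forall>i\<in>I. \<bar>h i - f i\<bar> < \<epsilon>)"
  show "f \<in> closure H"
    unfolding closure_iff_nhds_not_empty
  proof (intro allI impI)
    fix A V assume V: "V \<subseteq> A" "open V" "f \<in> V"
    obtain W where W: "finite {i. W i \<noteq> UNIV}" "\<forall>i. open (W i)" "\<forall>i. f i \<in> W i"
        "{h. \<forall>i. h i \<in> W i} \<subseteq> V"
      using open_fun_basic_nhd[OF V(2,3)] by blast
    have "\<forall>i. \<exists>e>0. ball (f i) e \<subseteq> W i" using W(2,3) by (auto simp: open_contains_ball)
    then obtain e where e: "\<And>i. e i > 0" "\<And>i. ball (f i) (e i) \<subseteq> W i" by metis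
    define \<epsilon> where "\<epsilon> = Min (insert 1 (e ` {i. W i \<noteq> UNIV}))"
    have \<epsilon>: "\<epsilon> > 0" "\<And>i. W i \<noteq> UNIV \<Longrightarrow> \<epsilon> \<le> e i" using W(1) e(1) by (auto simp: \<epsilon>_def)
    obtain h where h: "h \<in> H" "\<And>i. W i \<noteq> UNIV \<Longrightarrow> \<bar>h i - f i\<bar> < \<epsilon>"
      using R[rule_format, OF conjI[OF W(1) \<epsilon>(1)]] by blast
    have "h i \<in> W i" for i
    proof (cases "W i = UNIV")
      case False
      then have "h i \<in> ball (f i) (e i)" using h(2)[of i] \<epsilon>(2)[of i] by (auto simp: dist_real_def)
      then show ?thesis using e(2) by blast
    qed auto
    then have "h \<in> V" using W(4) by blast
    then show "H \<inter> A \<noteq> {}" using h(1) V(1) by blast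
  qed
qed

text \<open>Checked on finitely many coordinates at a time, the estimate is the one for numbers.\<close>

lemma convex_closure_fun:
  fixes H :: "('i \<Rightarrow> real) set"
  assumes "convex H" shows "convex (closure H)"
proof (rule convexI)
  fix f g and u v :: real
  assume f: "f \<in> closure H" and g: "g \<in> closure H" and uv: "0 \<le> u" "0 \<le> v" "u + v = 1"
  show "u *\<^sub>R f + v *\<^sub>R g \<in> closure H"
    unfolding closure_fun_iff
  proof (intro allI impI, elim conjE)
    fix I :: "'i set" and \<epsilon> :: real assume I: "finite I" "0 < \<epsilon>"
    obtain h k where hk: "h \<in> H" "\<And>i. i \<in> I \<Longrightarrow> \<bar>h i - f i\<bar> < \<epsilon>" "k \<in> H" "\<And>i. i \<in> I \<Longrightarrow> \<bar>k i - g i\<bar> < \<epsilon>"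
      using f[unfolded closure_fun_iff, rule_format, OF conjI[OF I]]
        g[unfolded closure_fun_iff, rule_format, OF conjI[OF I]] by blast
    have "\<bar>(u *\<^sub>R h + v *\<^sub>R k) i - (u *\<^sub>R f + v *\<^sub>R g) i\<bar> < \<epsilon>" if i: "i \<in> I" for i
    proof -
      have "\<bar>(u *\<^sub>R h + v *\<^sub>R k) i - (u *\<^sub>R f + v *\<^sub>R g) i\<bar> = \<bar>u * (h i - f i) + v * (k i - g i)\<bar>"
        by (simp add: algebra_simps)
      also have "\<dots> \<le> u * \<bar>h i - f i\<bar> + v * \<bar>k i - g i\<bar>"
        using uv by (intro order_trans[OF abs_triangle_ineq]) (simp add: abs_mult)
      also have "\<dots> < \<epsilon>"
        by (rule convex_bound_lt[OF hk(2)[OF i] hk(4)[OF i] uv])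
      finally show ?thesis .
    qed
    then show "\<exists>h\<in>H. \<forall>i\<in>I. \<bar>h i - (u *\<^sub>R f + v *\<^sub>R g) i\<bar> < \<epsilon>"
      using convexD[OF assms hk(1,3) uv] by blast
  qed
qed

lemma maximum_face:
  fixes L :: "'v::real_vector \<Rightarrow> real"
  assumes K: "convex K" and L: "linear L" and max: "\<And>f. f \<in> K \<Longrightarrow> L f \<le> c"
  shows "{f \<in> K. L f = c} face_of K"
  unfolding face_of_def
proof (intro conjI ballI impI)
  have Llin: "L (u *\<^sub>R a + v *\<^sub>R b) = u * L a + v * L b" for u v a b
    by (simp add: linear_add[OF L] linear_scale[OF L])
  show "convex {f \<in> K. L f = c}"
  proof (rule convexI)
    fix a b and u v :: real
    assume ab: "a \<in> {f \<in> K. L f = c}" "b \<in> {f \<in> K. L f = c}" and uv: "0 \<le> u" "0 \<le> v" "u + v = 1"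
    have "L (u *\<^sub>R a + v *\<^sub>R b) = (u + v) * c" using ab by (simp add: Llin distrib_right)
    then show "u *\<^sub>R a + v *\<^sub>R b \<in> {f \<in> K. L f = c}" using ab uv convexD[OF K] by simp
  qed
  fix a b x assume a: "a \<in> K" and b: "b \<in> K" and x: "x \<in> {f \<in> K. L f = c}" and "x \<in> open_segment a b"
  then obtain u where u: "0 < u" "u < 1" "x = (1 - u) *\<^sub>R a + u *\<^sub>R b" by (auto simp: in_segment)
  have "(1 - u) * L a + u * L b = c" using x u(3) by (simp add: Llin)
  moreover have "(1 - u) * L a \<le> (1 - u) * c" "u * L b \<le> u * c" using max[OF a] max[OF b] u by auto
  moreover have "(1 - u) * c + u * c = c" by (simp add: algebra_simps)
  ultimately have "(1 - u) * L a = (1 - u) * c" "u * L b = u * c" by linarith+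
  then show "a \<in> {f \<in> K. L f = c}" "b \<in> {f \<in> K. L f = c}" using u a b by auto
qed auto

text \<open>Minimal nonempty compact faces are singletons, because a coordinate that is not constant
  on a compact face cuts out a smaller one.\<close>

theorem extreme_point_exists_fun:
  fixes K :: "('i \<Rightarrow> real) set"
  assumes K: "compact K" "convex K" "K \<noteq> {}"
  shows "\<exists>e. e extreme_point_of K"
proof -
  define \<F> where "\<F> = {F. F face_of K \<and> compact F \<and> F \<noteq> {}}"
  \<comment> \<open>Zorn's lemma yields maximal sets, so it is applied to the complements of the faces\<close>
  have "\<exists>F\<in>\<F>. \<forall>G\<in>\<F>. G \<subseteq> F \<longrightarrow> G = F"
  proof -
    have "\<exists>M\<in>uminus ` \<F>. \<forall>X\<in>uminus ` \<F>. M \<subseteq> X \<longrightarrow> X = M"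
    proof (rule subset_Zorn_nonempty)
      show "uminus ` \<F> \<noteq> {}" using K by (auto simp: \<F>_def intro: face_of_refl)
    next
      fix \<C> assume ne: "\<C> \<noteq> {}" and ch: "subset.chain (uminus ` \<F>) \<C>"
      define \<D> where "\<D> = uminus ` \<C>"
      have D: "\<D> \<noteq> {}" "\<D> \<subseteq> \<F>" "\<And>F G. F \<in> \<D> \<Longrightarrow> G \<in> \<D> \<Longrightarrow> F \<subseteq> G \<or> G \<subseteq> F"
        using ne ch by (auto simp: \<D>_def subset.chain_def)
      have cl: "closed F" "F face_of K" "F \<noteq> {}" "F \<subseteq> K" if "F \<in> \<D>" for F
        using D(2) that by (auto simp: \<F>_def intro: compact_imp_closed_fun dest: face_of_imp_subset)
      have "K \<inter> \<Inter>\<D> \<noteq> {}"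
      proof (rule compact_imp_fip[OF K(1)])
        show "closed T" if "T \<in> \<D>" for T using cl(1)[OF that] .
      next
        fix \<D>' assume D': "finite \<D>'" "\<D>' \<subseteq> \<D>"
        show "K \<inter> \<Inter>\<D>' \<noteq> {}"
        proof (cases "\<D>' = {}")
          case True then show ?thesis using K(3) by simp
        next
          case False
          have "\<Inter>\<D>' \<in> \<D>'"
            using D'(1) False D'(2)
          proof (induction rule: finite_ne_induct)
            case (insert F \<A>)
            then have "\<Inter>\<A> \<in> \<D>" "F \<in> \<D>" by auto
            then have "F \<inter> \<Inter>\<A> = F \<or> F \<inter> \<Inter>\<A> = \<Inter>\<A>" using D(3)[of F "\<Inter>\<A>"] by auto
            then show ?case using insert by auto
          qed auto
          then have "\<Inter>\<D>' \<in> \<D>" using D'(2) by blast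
          then show ?thesis using cl[of "\<Inter>\<D>'"] by blast
        qed
      qed
      then have "\<Inter>\<D> \<noteq> {}" by blast
      moreover have "\<Inter>\<D> face_of K" by (rule face_of_Inter[OF D(1)]) (rule cl(2))
      moreover have "compact (\<Inter>\<D>)"
      proof -
        have "compact (K \<inter> \<Inter>\<D>)" using K(1) cl(1) by (intro compact_Int_closed closed_Inter) auto
        moreover have "K \<inter> \<Inter>\<D> = \<Inter>\<D>" using D(1) cl(4) by blast
        ultimately show ?thesis by simp
      qed
      ultimately have "\<Inter>\<D> \<in> \<F>" by (simp add: \<F>_def)
      moreover have "\<Union>\<C> = - \<Inter>\<D>" by (auto simp: \<D>_def)
      ultimately show "\<Union>\<C> \<in> uminus ` \<F>" by blast
    qed
    then show ?thesis by (auto simp: Compl_subset_Compl_iff)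
  qed
  then obtain F where F: "F face_of K" "compact F" "F \<noteq> {}"
    and min: "\<And>G. G \<in> \<F> \<Longrightarrow> G \<subseteq> F \<Longrightarrow> G = F"
    by (auto simp: \<F>_def)
  obtain e where e: "e \<in> F" using F(3) by blast
  have "g = e" if g: "g \<in> F" for g
  proof
    fix i
    have ci: "continuous_on F (\<lambda>f. f i)"
      by (rule continuous_on_subset[OF continuous_on_product_coordinates]) simp
    obtain m where m: "m \<in> F" "\<And>f. f \<in> F \<Longrightarrow> f i \<le> m i"
      using continuous_attains_sup[OF F(2,3) ci] by blast
    define G where "G = {f \<in> F. f i = m i}"
    have "closed {f. f i = m i}"
      by (intro closed_Collect_eq continuous_on_product_coordinates continuous_on_const)
    then have "compact G"
      unfolding G_def using F(2) by (simp add: Collect_conj_eq compact_Int_closed)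
    moreover have "G face_of F"
      unfolding G_def
      by (rule maximum_face[OF face_of_imp_convex[OF F(1)]]) (auto intro: linearI m(2))
    ultimately have "G \<in> \<F>" using m(1) face_of_trans[OF _ F(1)] by (auto simp: \<F>_def G_def)
    then have "G = F" by (rule min) (auto simp: G_def)
    then have "g \<in> G" "e \<in> G" using g e by auto
    then show "g i = e i" by (simp add: G_def)
  qed
  then have "F = {e}" using e by blast
  then show ?thesis using F(1) by (auto simp: face_of_singleton)
qed

text \<open>A point outside of a compact convex set is separated from it by finitely many
  coordinates: project onto these coordinates and take the nearest point there.\<close>

lemma separation_fun:
  fixes C :: "('i \<Rightarrow> real) set"
  assumes C: "compact C" "convex C" "C \<noteq> {}" and f: "f \<notin> C"
  shows "\<exists>I c. finite I \<and> (\<forall>g\<in>C. (\<Sum>i\<in>I. c i * f i) < (\<Sum>i\<in>I. c i * g i))"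
proof -
  have "f \<notin> closure C" using f compact_imp_closed_fun[OF C(1)] by simp
  then obtain I \<epsilon> where I: "finite I" "\<epsilon> > (0::real)" "\<And>h. h \<in> C \<Longrightarrow> \<exists>i\<in>I. \<epsilon> \<le> \<bar>h i - f i\<bar>"
    unfolding closure_fun_iff by (auto simp: not_less)
  define q where "q h = (\<Sum>i\<in>I. (h i - f i)\<^sup>2)" for h
  have qpos: "q h > 0" if h: "h \<in> C" for h
  proof -
    obtain i where i: "i \<in> I" "\<epsilon> \<le> \<bar>h i - f i\<bar>" using I(3)[OF h] by blast
    then have "0 < (h i - f i)\<^sup>2" using I(2) by auto
    then show ?thesis unfolding q_def using I(1) i(1) by (intro sum_pos2[of I i]) auto
  qed
  have "continuous_on C q"
    unfolding q_def
    by (intro continuous_intros continuous_on_subset[OF continuous_on_product_coordinates]) auto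
  then obtain p where p: "p \<in> C" "\<And>h. h \<in> C \<Longrightarrow> q p \<le> q h"
    using continuous_attains_inf[OF C(1,3)] by blast
  define c where "c i = p i - f i" for i
  have qp: "q p = (\<Sum>i\<in>I. (c i)\<^sup>2)" by (simp add: q_def c_def)
  have "(\<Sum>i\<in>I. c i * f i) < (\<Sum>i\<in>I. c i * g i)" if g: "g \<in> C" for g
  proof -
    define A where "A = (\<Sum>i\<in>I. c i * (g i - p i))"
    define B where "B = (\<Sum>i\<in>I. (g i - p i)\<^sup>2)"
    \<comment> \<open>moving from the nearest point p towards g does not decrease the distance to f\<close>
    have *: "0 \<le> 2 * A + t * B" if t: "0 < t" "t \<le> 1" for t
    proof -
      have "(1 - t) *\<^sub>R p + t *\<^sub>R g \<in> C" using t by (intro convexD[OF C(2) p(1) g]) auto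
      then have "q p \<le> q ((1 - t) *\<^sub>R p + t *\<^sub>R g)" by (rule p(2))
      also have "\<dots> = (\<Sum>i\<in>I. (c i)\<^sup>2 + (2 * t) * (c i * (g i - p i)) + t\<^sup>2 * (g i - p i)\<^sup>2)"
        unfolding q_def c_def by (intro sum.cong refl) (simp add: power2_eq_square algebra_simps)
      also have "\<dots> = (\<Sum>i\<in>I. (c i)\<^sup>2) + (2 * t) * A + t\<^sup>2 * B"
        by (simp only: sum.distrib sum_distrib_left[symmetric] A_def B_def)
      also have "\<dots> = q p + t * (2 * A + t * B)"
        by (simp add: qp power2_eq_square algebra_simps)
      finally show ?thesis using t by (simp add: zero_le_mult_iff)
    qed
    have "A \<ge> 0"
    proof (rule ccontr)
      assume "\<not> A \<ge> 0"
      then have n: "A < 0" by simp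
      have B0: "B \<ge> 0" unfolding B_def by (intro sum_nonneg) auto
      define t where "t = min 1 (- A / (B + 1))"
      have "0 < - A / (B + 1)" using n B0 by (intro divide_pos_pos) auto
      then have "t > 0" "t \<le> 1" by (simp_all add: t_def)
      moreover have "t * B \<le> (- A / (B + 1)) * B" using B0 by (intro mult_right_mono) (auto simp: t_def)
      moreover have "(- A) * (B / (B + 1)) \<le> (- A) * 1" using n B0 by (intro mult_left_mono) auto
      ultimately show False using *[of t] n by simp
    qed
    then have "0 < A + q p" using qpos[OF p(1)] by simp
    also have "A + q p = (\<Sum>i\<in>I. c i * g i) - (\<Sum>i\<in>I. c i * f i)"
      unfolding A_def qp sum.distrib[symmetric] sum_subtractf[symmetric]
      by (intro sum.cong refl) (simp add: c_def power2_eq_square algebra_simps)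
    finally show ?thesis by simp
  qed
  then show ?thesis using I(1) by blast
qed

text \<open>If the closed convex hull of the extreme points missed a point, a separating combination
  of coordinates would attain its minimum over K on a face that is disjoint from the hull, although
  this face has an extreme point.\<close>

theorem krein_milman_fun:
  fixes K :: "('i \<Rightarrow> real) set"
  assumes K: "compact K" "convex K"
  shows "K = closure (convex hull {e. e extreme_point_of K})"
proof (cases "K = {}")
  case False
  define C where "C = closure (convex hull {e. e extreme_point_of K})"
  have ext: "e \<in> C" if "e extreme_point_of K" for e
    unfolding C_def by (rule subsetD[OF closure_subset hull_inc]) (use that in simp)
  have sub: "C \<subseteq> K"
    unfolding C_def using K by (intro closure_minimal hull_minimal compact_imp_closed_fun) (auto simp: extreme_point_of_def)
  then have "compact (K \<inter> C)" using K by (intro compact_Int_closed) (auto simp: C_def)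
  then have cC: "compact C" using sub by (simp add: Int_absorb1)
  obtain e0 where "e0 extreme_point_of K" using extreme_point_exists_fun[OF K False] by blast
  then have ne: "C \<noteq> {}" using ext by blast
  have "f \<in> C" if f: "f \<in> K" for f
  proof (rule ccontr)
    assume "f \<notin> C"
    then obtain I c where I: "finite I" "\<And>g. g \<in> C \<Longrightarrow> (\<Sum>i\<in>I. c i * f i) < (\<Sum>i\<in>I. c i * g i)"
      using separation_fun[OF cC _ ne] convex_closure_fun[OF convex_convex_hull] unfolding C_def by meson
    define L where "L g = (\<Sum>i\<in>I. c i * g i)" for g
    have contL: "continuous_on A L" for A
      unfolding L_def by (intro continuous_intros continuous_on_subset[OF continuous_on_product_coordinates]) auto
    obtain m where m: "m \<in> K" "\<And>g. g \<in> K \<Longrightarrow> L m \<le> L g"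
      using continuous_attains_inf[OF K(1) False contL] by blast
    define F where "F = {g \<in> K. L g = L m}"
    have "closed {g. L g = L m}" by (intro closed_Collect_eq contL continuous_on_const)
    then have "compact F" unfolding F_def using K(1) by (simp add: Collect_conj_eq compact_Int_closed)
    moreover have face: "F face_of K"
    proof -
      have "linear (\<lambda>g. - L g)"
        by (rule linearI) (simp_all add: L_def sum_distrib_left sum.distrib algebra_simps)
      then show ?thesis
        using maximum_face[OF K(2), of "\<lambda>g. - L g" "- L m"] m(2) by (simp add: F_def)
    qed
    ultimately obtain e where e: "e extreme_point_of F"
      using extreme_point_exists_fun[of F] m(1) face_of_imp_convex by (force simp: F_def)
    then have "e extreme_point_of K" "e \<in> F" using extreme_point_of_face[OF face] by auto
    then have "L f < L e" unfolding L_def using I(2) ext by blast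
    also have "L e = L m" using \<open>e \<in> F\<close> by (simp add: F_def)
    finally show False using m(2)[OF f] by simp
  qed
  then show ?thesis using sub unfolding C_def by blast
qed simp

section \<open>The weak* topology\<close>

text \<open>The functionals vanish outside of the carrier, so the coordinates that do not belong to
  points of the carrier are constant and the weak* topology is that of pointwise convergence.\<close>

lemma weak_star_eq:
  assumes E: "normed_space E"
  shows "weak_star E = top_of_set (carr (dual E))"
proof -
  let ?D = "carr (dual E)"
  let ?\<S> = "{{f \<in> ?D. f x \<in> U} | x U. x \<in> carr E \<and> open U}"
  have top: "topspace (weak_star E) = ?D"
  proof -
    have "{f \<in> ?D. f 0 \<in> UNIV} \<in> ?\<S>" using normed_zero_mem[OF E] by blast
    then have "?D \<subseteq> \<Union>?\<S>" by auto
    then show ?thesis unfolding weak_star_def topology_generated_by_topspace by auto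
  qed
  show ?thesis
  proof (rule topology_eq[THEN iffD2], intro allI iffI)
    fix W assume "openin (weak_star E) W"
    then have "generate_topology_on ?\<S> W"
      by (simp add: weak_star_def openin_topology_generated_by_iff)
    then show "openin (top_of_set ?D) W"
    proof induction
      case (Basis s)
      then obtain x U where s: "s = {f \<in> ?D. f x \<in> U}" "open U" by blast
      have "open ((\<lambda>f::'a \<Rightarrow> real. f x) -` U)"
        by (rule open_vimage[OF s(2) continuous_on_product_coordinates])
      moreover have "s = ?D \<inter> ((\<lambda>f. f x) -` U)" using s by auto
      ultimately show ?case by (simp add: openin_open_Int)
    qed (auto intro: openin_Union)
  next
    fix W assume "openin (top_of_set ?D) W"
    then obtain V where V: "open V" "W = ?D \<inter> V" by (auto simp: openin_open)
    show "openin (weak_star E) W"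
    proof (subst openin_subopen, intro ballI)
      fix f assume f: "f \<in> W"
      then have fV: "f \<in> V" and fD: "f \<in> ?D" using V by auto
      obtain T where T: "finite {i. T i \<noteq> UNIV}" "\<forall>i. open (T i)" "\<forall>i. f i \<in> T i"
          "{h. \<forall>i. h i \<in> T i} \<subseteq> V"
        using open_fun_basic_nhd[OF V(1) fV] by blast
      define J where "J = {i \<in> carr E. T i \<noteq> UNIV}"
      have J: "finite J" using T(1) by (auto simp: J_def intro: finite_subset)
      define N where "N = topspace (weak_star E) \<inter> (\<Inter>i\<in>J. {g \<in> ?D. g i \<in> T i})"
      have "openin (weak_star E) {g \<in> ?D. g i \<in> T i}" if "i \<in> J" for i
        unfolding weak_star_def
        by (rule topology_generated_by_Basis) (use that T(2) in \<open>auto simp: J_def\<close>)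
      then have "openin (weak_star E) N"
        unfolding N_def using J by (cases "J = {}") (auto intro!: openin_Int openin_INT2)
      moreover have "f \<in> N" using fD T(3) by (auto simp: N_def top)
      moreover have "N \<subseteq> W"
      proof
        fix g assume g: "g \<in> N"
        then have gD: "g \<in> ?D" by (simp add: N_def top)
        have "g i \<in> T i" for i
        proof (cases "i \<in> carr E")
          case True then show ?thesis using g by (cases "T i = UNIV") (auto simp: N_def J_def)
        next
          case False then show ?thesis using T(3)[rule_format, of i] dual_outside[OF gD] dual_outside[OF fD] by simp
        qed
        then show "g \<in> W" using V(2) gD T(4) by blast
      qed
      ultimately show "\<exists>T. openin (weak_star E) T \<and> f \<in> T \<and> T \<subseteq> W" by blast
    qed
  qed
qed

lemma dual_almost_attained:
  assumes E: "normed_space E" and f: "f \<in> carr (dual E)" and \<epsilon>: "0 < \<epsilon>"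
  shows "\<exists>x\<in>carr E. nrm E x \<le> 1 \<and> nrm (dual E) f - \<epsilon> \<le> f x"
proof (cases "nrm (dual E) f - \<epsilon> \<le> 0")
  case True
  then show ?thesis
    by (intro bexI[of _ 0]) (auto simp: normed_zero[OF E] dual_zero[OF E f] normed_zero_mem[OF E])
next
  case False
  then obtain x where x: "x \<in> carr E" "(nrm (dual E) f - \<epsilon>) * nrm E x < \<bar>f x\<bar>"
    using dual_nrm_le_iff[OF E f, of "nrm (dual E) f - \<epsilon>"] \<epsilon> by (auto simp: not_le)
  have "x \<noteq> 0" using x(2) by (auto simp: dual_zero[OF E f] normed_zero[OF E])
  then have p: "nrm E x > 0" using normed_nonneg[OF E x(1)] normed_eq_0[OF E x(1)] by linarith
  let ?c = "sgn (f x) / nrm E x"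
  have "nrm E (?c *\<^sub>R x) \<le> 1" using p by (simp add: normed_scale[OF E x(1)] abs_mult sgn_if)
  moreover have "nrm (dual E) f - \<epsilon> \<le> f (?c *\<^sub>R x)"
  proof -
    have "f (?c *\<^sub>R x) = \<bar>f x\<bar> / nrm E x" by (simp add: dual_scale[OF f x(1)] abs_sgn)
    moreover have "nrm (dual E) f - \<epsilon> \<le> \<bar>f x\<bar> / nrm E x"
      using x(2) p by (subst pos_le_divide_eq) auto
    ultimately show ?thesis by simp
  qed
  ultimately show ?thesis using subspace_scale[OF normed_subspace[OF E] x(1)] by blast
qed

section \<open>Direct products and their duals\<close>

lemma product_carr_iff [simp]: "x \<in> carr (direct_product Z E) \<longleftrightarrow> (\<forall>n. x $ n \<in> carr (E n))"
  by (simp add: direct_product_def)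

lemma product_nrm: "nrm (direct_product Z E) x = nrm Z (\<chi> n. nrm (E n) (x $ n))"
  by (simp add: direct_product_def)

lemma normed_direct_product:
  fixes Z :: "(real^'n) nspace" and E :: "'n \<Rightarrow> 'b::real_vector nspace"
  assumes Z: "normed_space Z" and U: "carr Z = UNIV" and A: "absolute_norm Z"
    and E: "\<And>n. normed_space (E n)"
  shows "normed_space (direct_product Z E)"
  unfolding normed_space_def
proof (intro conjI ballI allI)
  let ?P = "direct_product Z E"
  note sub = normed_subspace[OF E]
  show "subspace (carr ?P)"
    by (rule subspaceI) (auto intro: subspace_0[OF sub] subspace_add[OF sub] subspace_scale[OF sub])
  fix x assume "x \<in> carr ?P"
  then have x: "\<And>n. x $ n \<in> carr (E n)" by simp
  show "0 \<le> nrm ?P x" by (simp add: product_nrm normed_nonneg[OF Z] U)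
  have "nrm ?P x = 0 \<longleftrightarrow> (\<chi> n. nrm (E n) (x $ n)) = 0"
    by (simp add: product_nrm normed_eq_0[OF Z] U)
  then show "nrm ?P x = 0 \<longleftrightarrow> x = 0"
    by (simp add: vec_eq_iff normed_eq_0[OF E x])
  fix c
  have "(\<chi> n. nrm (E n) ((c *\<^sub>R x) $ n)) = \<bar>c\<bar> *\<^sub>R (\<chi> n. nrm (E n) (x $ n))"
    by (simp add: vec_eq_iff normed_scale[OF E x])
  then show "nrm ?P (c *\<^sub>R x) = \<bar>c\<bar> * nrm ?P x"
    by (simp add: product_nrm normed_scale[OF Z] U)
next
  let ?P = "direct_product Z E"
  fix x y assume "x \<in> carr ?P" "y \<in> carr ?P"
  then have x: "\<And>n. x $ n \<in> carr (E n)" and y: "\<And>n. y $ n \<in> carr (E n)" by simp_all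
  note sub = normed_subspace[OF E]
  have "nrm ?P (x + y) \<le> nrm Z ((\<chi> n. nrm (E n) (x $ n)) + (\<chi> n. nrm (E n) (y $ n)))"
    unfolding product_nrm
  proof (rule absolute_norm_mono[OF Z U A])
    fix n
    have "nrm (E n) ((x + y) $ n) \<ge> 0"
      using normed_nonneg[OF E subspace_add[OF sub x y]] by simp
    then show "\<bar>(\<chi> n. nrm (E n) ((x + y) $ n)) $ n\<bar>
        \<le> \<bar>((\<chi> n. nrm (E n) (x $ n)) + (\<chi> n. nrm (E n) (y $ n))) $ n\<bar>"
      using normed_triangle[OF E x[of n] y[of n]] by simp
  qed
  also have "\<dots> \<le> nrm ?P x + nrm ?P y"
    unfolding product_nrm by (rule normed_triangle[OF Z]) (simp_all add: U)
  finally show "nrm ?P (x + y) \<le> nrm ?P x + nrm ?P y" .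
qed

lemma dual_sum:
  assumes E: "normed_space E" and F: "F \<in> carr (dual E)" and "finite I" "\<And>i. i \<in> I \<Longrightarrow> x i \<in> carr E"
  shows "(\<Sum>i\<in>I. x i) \<in> carr E \<and> F (\<Sum>i\<in>I. x i) = (\<Sum>i\<in>I. F (x i))"
  using assms(3,4)
  by induction (auto simp: dual_zero[OF E F] normed_zero_mem[OF E] dual_add[OF F]
      subspace_add[OF normed_subspace[OF E]])

locale product_space =
  fixes Z :: "(real^'n) nspace" and X :: "'n \<Rightarrow> 'a::real_vector nspace"
  assumes normed_Z: "normed_space Z" and carr_Z: "carr Z = UNIV" and absolute_Z: "absolute_norm Z"
    and normed_X: "\<And>n. normed_space (X n)"
begin

abbreviation "Z' \<equiv> vec_dual Z"
abbreviation "X' n \<equiv> dual (X n)"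
abbreviation "PX \<equiv> direct_product Z X"
abbreviation "PX' \<equiv> direct_product Z' X'"

lemmas Z_facts = normed_Z carr_Z absolute_Z
lemmas normed_Z' = normed_vec_dual[OF normed_Z carr_Z]
lemmas absolute_Z' = absolute_norm_vec_dual[OF normed_Z carr_Z absolute_Z]
lemmas normed_X' = normed_dual[OF normed_X]
lemma normed_PX: "normed_space PX"
  by (rule normed_direct_product[OF Z_facts normed_X])

lemma normed_PX': "normed_space PX'"
  by (rule normed_direct_product[OF normed_Z' vec_dual_carr absolute_Z' normed_X'])

lemma pairing_add: "pairing x (f + g) = pairing x f + pairing x g"
  by (simp add: pairing_def sum.distrib)

lemma pairing_scale: "pairing x (c *\<^sub>R f) = c * pairing x f"
  by (simp add: pairing_def sum_distrib_left)

lemma pairing_add_left: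
  assumes f: "f \<in> carr PX'" and x: "x \<in> carr PX" "x' \<in> carr PX"
  shows "pairing (x + x') f = pairing x f + pairing x' f"
proof -
  have fn: "f $ n \<in> carr (X' n)" for n using f by simp
  show ?thesis using x by (simp add: pairing_def sum.distrib dual_add[OF fn])
qed

lemma pairing_scale_left:
  assumes f: "f \<in> carr PX'" and x: "x \<in> carr PX"
  shows "pairing (c *\<^sub>R x) f = c * pairing x f"
proof -
  have fn: "f $ n \<in> carr (X' n)" for n using f by simp
  show ?thesis using x by (simp add: pairing_def sum_distrib_left dual_scale[OF fn])
qed

lemma pairing_le_inner:
  assumes f: "f \<in> carr PX'" and x: "x \<in> carr PX"
  shows "\<bar>pairing x f\<bar> \<le> (\<chi> n. nrm (X' n) (f $ n)) \<bullet> (\<chi> n. nrm (X n) (x $ n))"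
proof -
  have "\<bar>pairing x f\<bar> \<le> (\<Sum>n\<in>UNIV. \<bar>(f $ n) (x $ n)\<bar>)" unfolding pairing_def by (rule sum_abs)
  also have "\<dots> \<le> (\<Sum>n\<in>UNIV. nrm (X' n) (f $ n) * nrm (X n) (x $ n))"
    using f x by (intro sum_mono dual_bound[OF normed_X]) auto
  finally show ?thesis by (simp add: inner_vec_def)
qed

lemma pairing_le:
  assumes f: "f \<in> carr PX'" and x: "x \<in> carr PX"
  shows "\<bar>pairing x f\<bar> \<le> nrm PX' f * nrm PX x"
proof -
  have "\<bar>pairing x f\<bar> \<le> (\<chi> n. nrm (X' n) (f $ n)) \<bullet> (\<chi> n. nrm (X n) (x $ n))"
    by (rule pairing_le_inner[OF f x])
  also have "\<dots> \<le> \<bar>(\<chi> n. nrm (X' n) (f $ n)) \<bullet> (\<chi> n. nrm (X n) (x $ n))\<bar>" by simp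
  also have "\<dots> \<le> nrm PX' f * nrm PX x"
    unfolding product_nrm by (rule vec_dual_bound[OF normed_Z carr_Z])
  finally show ?thesis .
qed

text \<open>The norm of the product of the duals is the norm of the dual of the product. For the
  nontrivial direction, vectors that almost norm the components are assembled with the weights of a
  vector of the finite-dimensional space Z.\<close>

lemma product_dual_nrm_le_iff:
  assumes f: "f \<in> carr PX'" and r: "0 \<le> r"
  shows "nrm PX' f \<le> r \<longleftrightarrow> (\<forall>x\<in>carr PX. \<bar>pairing x f\<bar> \<le> r * nrm PX x)"
proof (intro iffI ballI)
  fix x assume "nrm PX' f \<le> r" and x: "x \<in> carr PX"
  then have "nrm PX' f * nrm PX x \<le> r * nrm PX x"
    using normed_nonneg[OF normed_PX x] by (intro mult_right_mono)
  then show "\<bar>pairing x f\<bar> \<le> r * nrm PX x" using pairing_le[OF f x] by simp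
next
  assume *: "\<forall>x\<in>carr PX. \<bar>pairing x f\<bar> \<le> r * nrm PX x"
  define y where "y = (\<chi> n. nrm (X' n) (f $ n))"
  have fn: "f $ n \<in> carr (X' n)" for n using f by simp
  have "\<bar>y \<bullet> z\<bar> \<le> r * nrm Z z" for z
  proof -
    have y0: "y $ n \<ge> 0" for n by (simp add: y_def dual_nrm_nonneg[OF normed_X fn])
    have "\<bar>y \<bullet> z\<bar> \<le> (\<Sum>n\<in>UNIV. \<bar>z $ n\<bar> * y $ n)"
      unfolding inner_vec_def
      by (rule order_trans[OF sum_abs]) (simp add: abs_mult y0 mult.commute)
    also have "\<dots> \<le> r * nrm Z z"
    proof (rule field_le_epsilon)
      fix \<delta> :: real assume \<delta>: "0 < \<delta>"
      define s where "s = (\<Sum>n\<in>UNIV. \<bar>z $ n\<bar>)"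
      have s: "0 \<le> s" unfolding s_def by (intro sum_nonneg) auto
      define \<epsilon> where "\<epsilon> = \<delta> / (s + 1)"
      have \<epsilon>: "0 < \<epsilon>" using \<delta> s by (simp add: \<epsilon>_def)
      have "\<forall>n. \<exists>x\<in>carr (X n). nrm (X n) x \<le> 1 \<and> y $ n - \<epsilon> \<le> (f $ n) x"
        using dual_almost_attained[OF normed_X fn \<epsilon>] by (simp add: y_def)
      then obtain u where u: "\<And>n. u n \<in> carr (X n)" "\<And>n. nrm (X n) (u n) \<le> 1"
          "\<And>n. y $ n - \<epsilon> \<le> (f $ n) (u n)" by metis
      define x where "x = (\<chi> n. \<bar>z $ n\<bar> *\<^sub>R u n)"
      have x: "x \<in> carr PX" using u(1) subspace_scale[OF normed_subspace[OF normed_X]] by (simp add: x_def)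
      have "(\<Sum>n\<in>UNIV. \<bar>z $ n\<bar> * y $ n) - \<epsilon> * s = (\<Sum>n\<in>UNIV. \<bar>z $ n\<bar> * (y $ n - \<epsilon>))"
        by (simp add: s_def right_diff_distrib sum_subtractf sum_distrib_left mult.commute)
      also have "\<dots> \<le> (\<Sum>n\<in>UNIV. \<bar>z $ n\<bar> * (f $ n) (u n))"
        by (intro sum_mono mult_left_mono u(3)) auto
      also have "\<dots> = pairing x f" by (simp add: pairing_def x_def dual_scale[OF fn u(1)])
      also have "\<dots> \<le> r * nrm PX x" using * x by (auto dest: bspec)
      also have "\<dots> \<le> r * nrm Z z"
        unfolding product_nrm
      proof (intro mult_left_mono[OF _ r] absolute_norm_mono[OF Z_facts])
        fix n
        show "\<bar>(\<chi> n. nrm (X n) (x $ n)) $ n\<bar> \<le> \<bar>z $ n\<bar>"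
          using u(2)[of n] normed_nonneg[OF normed_X u(1)[of n]]
          by (simp add: x_def normed_scale[OF normed_X u(1)] abs_mult mult_left_le)
      qed
      finally have "(\<Sum>n\<in>UNIV. \<bar>z $ n\<bar> * y $ n) \<le> r * nrm Z z + \<epsilon> * s" by simp
      moreover have "\<epsilon> * s \<le> \<delta>" using \<delta> s by (simp add: \<epsilon>_def field_simps)
      ultimately show "(\<Sum>n\<in>UNIV. \<bar>z $ n\<bar> * y $ n) \<le> r * nrm Z z + \<delta>" by simp
    qed
    finally show ?thesis .
  qed
  then show "nrm PX' f \<le> r"
    unfolding product_nrm y_def[symmetric] by (simp add: vec_dual_le_iff[OF normed_Z carr_Z r])
qed

lemma axis_in_PX: "x \<in> carr (X n) \<Longrightarrow> axis n x \<in> carr PX"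
  by (auto simp: axis_def normed_zero_mem[OF normed_X])

lemma nrm_PX_axis:
  assumes "x \<in> carr (X n)"
  shows "nrm PX (axis n x) = nrm (X n) x * nrm Z (axis n 1)"
proof -
  have "(\<chi> i. nrm (X i) (axis n x $ i)) = nrm (X n) x *\<^sub>R axis n 1"
    by (auto simp: vec_eq_iff axis_def normed_zero[OF normed_X])
  then show ?thesis
    by (simp add: product_nrm normed_scale[OF normed_Z] carr_Z normed_nonneg[OF normed_X assms])
qed

text \<open>Every bounded functional on the product is given by a tuple of functionals, its
  restrictions to the factors.\<close>

lemma dual_of_product:
  assumes F: "F \<in> carr (dual PX)"
  shows "\<exists>f\<in>carr PX'. \<forall>x\<in>carr PX. pairing x f = F x"
proof -
  define f where "f = (\<chi> n. (\<lambda>x. if x \<in> carr (X n) then F (axis n x) else 0))"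
  have ax: "axis n (x + y) = axis n x + axis n y" "axis n (c *\<^sub>R x) = c *\<^sub>R axis n x" for n and x y :: 'a and c
    by (auto simp: vec_eq_iff axis_def)
  note sub = normed_subspace[OF normed_X]
  have "f $ n \<in> carr (X' n)" for n
  proof (rule dual_carrI)
    fix x assume x: "x \<in> carr (X n)"
    show "\<bar>(f $ n) x\<bar> \<le> (nrm (dual PX) F * nrm Z (axis n 1)) * nrm (X n) x"
      using dual_bound[OF normed_PX F axis_in_PX[OF x]] x by (simp add: f_def nrm_PX_axis algebra_simps)
  qed (simp_all add: f_def ax subspace_add[OF sub] subspace_scale[OF sub] dual_add[OF F axis_in_PX axis_in_PX]
      dual_scale[OF F axis_in_PX])
  then have "f \<in> carr PX'" by simp
  moreover have "pairing x f = F x" if x: "x \<in> carr PX" for x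
  proof -
    have "x = (\<Sum>n\<in>UNIV. axis n (x $ n))" by (simp add: vec_eq_iff axis_def)
    moreover have "F (\<Sum>n\<in>UNIV. axis n (x $ n)) = (\<Sum>n\<in>UNIV. F (axis n (x $ n)))"
      using dual_sum[OF normed_PX F, of UNIV "\<lambda>n. axis n (x $ n)"] axis_in_PX x by simp
    ultimately have "F x = (\<Sum>n\<in>UNIV. F (axis n (x $ n)))" by simp
    then show ?thesis using x by (simp add: pairing_def f_def)
  qed
  ultimately show ?thesis by blast
qed

end

section \<open>Minimal-norm interpolation\<close>

locale interpolation = product_space Z X
  for Z :: "(real^'n) nspace" and X :: "'n \<Rightarrow> 'a::real_vector nspace" +
  fixes \<nu> :: "'m::finite \<Rightarrow> 'a^'n"
  assumes \<nu>_carr: "\<And>m. \<nu> m \<in> carr (direct_product Z X)"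
    and \<nu>_inj: "inj \<nu>" and \<nu>_indep: "independent (range \<nu>)"
begin

definition comb :: "real^'m \<Rightarrow> 'a^'n" where
  "comb a = (\<Sum>m\<in>UNIV. (a $ m) *\<^sub>R \<nu> m)"

definition meas :: "('a \<Rightarrow> real)^'n \<Rightarrow> real^'m" where
  "meas f = (\<chi> m. pairing (\<nu> m) f)"

text \<open>The norm that the span of the measurement elements induces on the coefficient vectors.
  Its dual norm is the minimal norm of an interpolant, see below.\<close>

definition coef :: "(real^'m) nspace" where
  "coef = \<lparr> carr = UNIV, nrm = (\<lambda>a. nrm PX (comb a)) \<rparr>"

lemma linear_comb: "linear comb"
  by (rule linearI) (simp_all add: comb_def scaleR_add_left sum.distrib scaleR_sum_right)

lemma comb_carr: "comb a \<in> carr PX"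
  unfolding comb_def
  by (intro subspace_sum[OF normed_subspace[OF normed_PX]]
      subspace_scale[OF normed_subspace[OF normed_PX] \<nu>_carr])

lemma comb_eq_0: "comb a = 0 \<longleftrightarrow> a = 0"
proof
  assume a: "comb a = 0"
  define u where "u v = a $ inv \<nu> v" for v
  have "(\<Sum>v\<in>range \<nu>. u v *\<^sub>R v) = comb a"
    unfolding comb_def by (subst sum.reindex[OF \<nu>_inj]) (simp add: u_def inv_f_f[OF \<nu>_inj])
  then have "u v = 0" if "v \<in> range \<nu>" for v
    using \<nu>_indep a that dependent_finite[of "range \<nu>"] by force
  then have "u (\<nu> m) = 0" for m by blast
  then show "a = 0" by (simp add: vec_eq_iff u_def inv_f_f[OF \<nu>_inj])
qed (simp add: comb_def)

lemma normed_coef: "normed_space coef"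
  unfolding normed_space_def coef_def
  using normed_nonneg[OF normed_PX comb_carr] normed_eq_0[OF normed_PX comb_carr]
    normed_scale[OF normed_PX comb_carr] normed_triangle[OF normed_PX comb_carr comb_carr]
  by (auto simp: comb_eq_0 linear_scale[OF linear_comb] linear_add[OF linear_comb]
      simp del: product_carr_iff)

lemma carr_coef: "carr coef = UNIV" by (simp add: coef_def)
lemma nrm_coef: "nrm coef a = nrm PX (comb a)" by (simp add: coef_def)

lemma linear_meas: "linear meas"
  by (rule linearI) (simp_all add: meas_def vec_eq_iff pairing_add pairing_scale)

lemma pairing_comb:
  assumes f: "f \<in> carr PX'"
  shows "pairing (comb a) f = a \<bullet> meas f"
proof -
  have fn: "f $ n \<in> carr (X' n)" for n using f by simp
  have \<nu>n: "\<nu> m $ n \<in> carr (X n)" for m n using \<nu>_carr by simp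
  have "(f $ n) (comb a $ n) = (\<Sum>m\<in>UNIV. a $ m * (f $ n) (\<nu> m $ n))" for n
  proof -
    have "(f $ n) (\<Sum>m\<in>UNIV. a $ m *\<^sub>R \<nu> m $ n) = (\<Sum>m\<in>UNIV. (f $ n) (a $ m *\<^sub>R \<nu> m $ n))"
      using dual_sum[OF normed_X fn, of UNIV "\<lambda>m. a $ m *\<^sub>R \<nu> m $ n"]
        subspace_scale[OF normed_subspace[OF normed_X] \<nu>n] by simp
    then show ?thesis by (simp add: comb_def dual_scale[OF fn \<nu>n])
  qed
  then have "pairing (comb a) f = (\<Sum>n\<in>UNIV. \<Sum>m\<in>UNIV. a $ m * (f $ n) (\<nu> m $ n))"
    by (simp add: pairing_def)
  also have "\<dots> = (\<Sum>m\<in>UNIV. \<Sum>n\<in>UNIV. a $ m * (f $ n) (\<nu> m $ n))" by (rule sum.swap)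
  also have "\<dots> = a \<bullet> meas f" by (simp add: inner_vec_def meas_def pairing_def sum_distrib_left)
  finally show ?thesis .
qed

lemma meas_lower_bound:
  assumes f: "f \<in> carr PX'"
  shows "nrm (vec_dual coef) (meas f) \<le> nrm PX' f"
proof -
  have "\<bar>meas f \<bullet> a\<bar> \<le> nrm PX' f * nrm coef a" for a
    using pairing_le[OF f comb_carr, of a] pairing_comb[OF f, of a] by (simp add: nrm_coef inner_commute)
  then show ?thesis
    by (simp add: vec_dual_le_iff[OF normed_coef carr_coef normed_nonneg[OF normed_PX' f]])
qed

text \<open>The vector z defines a functional on the span of the measurement elements; a
  norm-preserving extension of it is an interpolant, and it attains the bound of the preceding
  lemma.\<close>

lemma interpolant_exists:
  "\<exists>f\<in>carr PX'. meas f = z \<and> nrm PX' f = nrm (vec_dual coef) z"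
proof -
  let ?r = "nrm (vec_dual coef) z"
  have r: "0 \<le> ?r" by (rule vec_dual_nonneg[OF normed_coef carr_coef])
  define G0 where "G0 = range (\<lambda>a. (comb a, a \<bullet> z))"
  have "linear (\<lambda>a. (comb a, a \<bullet> z))"
    by (rule linearI) (simp_all add: linear_add[OF linear_comb] linear_scale[OF linear_comb] inner_add_left)
  then have sub: "subspace G0" unfolding G0_def by (rule linear_subspace_image) simp
  have dom: "t \<le> ?r * nrm PX x" if "(x, t) \<in> G0" for x t
    using that vec_dual_bound[OF normed_coef carr_coef, of z]
    by (auto simp: G0_def nrm_coef inner_commute abs_le_iff)
  have "G0 \<subseteq> carr PX \<times> UNIV" using comb_carr by (auto simp: G0_def)
  then obtain F where F: "F \<in> carr (dual PX)" "nrm (dual PX) F \<le> ?r" "\<forall>(x,t)\<in>G0. F x = t"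
    using hahn_banach[OF normed_PX r sub _ dom] by blast
  obtain f where f: "f \<in> carr PX'" "\<And>x. x \<in> carr PX \<Longrightarrow> pairing x f = F x"
    using dual_of_product[OF F(1)] by blast
  have "a \<bullet> meas f = a \<bullet> z" for a
    using F(3) f(2)[OF comb_carr] pairing_comb[OF f(1)] by (auto simp: G0_def)
  then have m: "meas f = z" by (metis vector_eq_ldot)
  have "nrm PX' f \<le> ?r"
    using F(2) by (simp add: product_dual_nrm_le_iff[OF f(1) r] dual_nrm_le_iff[OF normed_PX F(1) r] f(2)
      del: product_carr_iff)
  then show ?thesis using meas_lower_bound[OF f(1)] f(1) m by force
qed

end

section \<open>Existence of minimisers\<close>

text \<open>If no minimum were attained, the open sets \<open>{z. G w < G z}\<close> with w in K
  would cover K. Among the points w of a finite subcover, one with the smallest value of G is not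
  covered.\<close>

lemma lsc_attains_min:
  fixes G :: "'a::topological_space \<Rightarrow> 'b::linorder"
  assumes K: "compact K" "K \<noteq> {}"
    and lsc: "\<And>z c. c < G z \<Longrightarrow> \<forall>\<^sub>F w in nhds z. c < G w"
  shows "\<exists>z\<in>K. \<forall>w\<in>K. G z \<le> G w"
proof (rule ccontr)
  assume "\<not> ?thesis"
  then have ex: "\<And>z. z \<in> K \<Longrightarrow> \<exists>w\<in>K. G w < G z" by (meson not_le)
  define U where "U w = {z. G w < G z}" for w
  have op: "open (U w)" for w
    unfolding U_def open_subopen[of "{z. G w < G z}"] using lsc by (force simp: eventually_nhds)
  have cov: "K \<subseteq> (\<Union>w\<in>K. U w)" using ex by (auto simp: U_def)
  obtain D where D: "D \<subseteq> K" "finite D" "K \<subseteq> (\<Union>w\<in>D. U w)"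
    using compactE_image[OF K(1) op cov] by metis
  have "D \<noteq> {}" using D(3) K(2) by auto
  have "Min (G ` D) \<in> G ` D" using D(2) \<open>D \<noteq> {}\<close> by simp
  then obtain w where w: "w \<in> D" "G w = Min (G ` D)" by auto
  then obtain v where "v \<in> D" "G v < G w" using D(1,3) by (force simp: U_def)
  moreover have "Min (G ` D) \<le> G v" using D(2) \<open>v \<in> D\<close> by simp
  ultimately show False using w(2) by simp
qed

lemma lsc_fun_eventually:
  assumes "lsc_fun F" "c < F z"
  shows "\<forall>\<^sub>F w in nhds z. c < F w"
proof -
  have "c < Liminf (at z) F" using assms by (metis lsc_fun_def less_le_trans)
  then have "\<forall>\<^sub>F w in at z. c < F w" by (rule less_LiminfD)
  then show ?thesis using assms(2) by (simp add: eventually_nhds_conv_at)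
qed

lemma lsc_add_continuous:
  fixes F :: "'a::topological_space \<Rightarrow> ennreal" and p :: "'a \<Rightarrow> real"
  assumes F: "lsc_fun F" and p: "continuous_on UNIV p" "\<And>z. 0 \<le> p z"
    and c: "c < F z + ennreal (p z)"
  shows "\<forall>\<^sub>F w in nhds z. c < F w + ennreal (p w)"
proof -
  have tend: "(p \<longlongrightarrow> p z) (nhds z)"
    using p(1) by (metis UNIV_I continuous_on_def at_within_open continuous_on_eq_continuous_at
        isCont_def open_UNIV tendsto_at_iff_tendsto_nhds)
  have cfin: "c \<noteq> \<infinity>" using c by auto
  then obtain k where k: "c = ennreal k" "0 \<le> k" by (cases c) auto
  show ?thesis
  proof (cases "k < p z")
    case True
    then have "\<forall>\<^sub>F w in nhds z. k < p w" by (rule order_tendstoD[OF tend])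
    then show ?thesis
    proof eventually_elim
      case (elim w)
      have "c < ennreal (p w)" using elim k by (simp add: ennreal_less_iff)
      also have "\<dots> \<le> F w + ennreal (p w)" by simp
      finally show ?case .
    qed
  next
    case False
    have "ennreal (k - p z) < F z"
    proof (rule ccontr)
      assume "\<not> ennreal (k - p z) < F z"
      then have "F z + ennreal (p z) \<le> ennreal (k - p z) + ennreal (p z)" by (intro add_right_mono) simp
      also have "\<dots> = c" using False k p(2) by (simp flip: ennreal_plus)
      finally show False using c by simp
    qed
    then obtain y where y: "ennreal (k - p z) < y" "y < F z" using dense by blast
    then have "y \<noteq> \<infinity>" by auto
    then obtain d where d: "y = ennreal d" "0 \<le> d" by (cases y) auto
    have kd: "k - p z < d" using y(1) d by (metis ennreal_leI not_le)
    have "\<forall>\<^sub>F w in nhds z. y < F w" by (rule lsc_fun_eventually[OF F y(2)])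
    moreover have "\<forall>\<^sub>F w in nhds z. k - d < p w" by (rule order_tendstoD[OF tend]) (use kd in simp)
    ultimately show ?thesis
    proof eventually_elim
      case (elim w)
      have "c < ennreal (d + p w)" using elim(2) k p(2)[of w] d by (simp add: ennreal_less_iff del: ennreal_plus)
      also have "\<dots> = y + ennreal (p w)" using d p(2) by simp
      also have "\<dots> \<le> F w + ennreal (p w)" using elim(1) by (intro add_right_mono) simp
      finally show ?case .
    qed
  qed
qed

text \<open>A regulariser is continuous up to the boundary point 0 and grows at least linearly,
  which makes the objective lower semicontinuous and coercive.\<close>

locale regulariser =
  fixes \<psi> :: "real \<Rightarrow> real"
  assumes nonneg: "\<And>t. 0 \<le> t \<Longrightarrow> 0 \<le> \<psi> t"
    and smono: "strict_mono_on {0..} \<psi>"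
    and sconvex: "strictly_convex_on {0..} \<psi>"
begin

lemma less: "0 \<le> s \<Longrightarrow> s < t \<Longrightarrow> \<psi> s < \<psi> t"
  using smono by (auto simp: strict_mono_on_def)

lemma mono: "0 \<le> s \<Longrightarrow> s \<le> t \<Longrightarrow> \<psi> s \<le> \<psi> t"
  using less[of s t] by (cases "s = t") auto

lemma convex_le:
  assumes "0 \<le> x" "0 \<le> y" "0 \<le> t" "t \<le> 1"
  shows "\<psi> (t * x + (1 - t) * y) \<le> t * \<psi> x + (1 - t) * \<psi> y"
proof (cases "x = y \<or> t = 0 \<or> t = 1")
  case True
  then show ?thesis by (auto simp: algebra_simps)
next
  case False
  then show ?thesis 
    using sconvex[unfolded strictly_convex_on_def, THEN conjunct2, rule_format, of x y t] assms by simp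
qed

lemma convex: "convex_on {0..} \<psi>"
proof (rule convex_onI)
  fix t x y :: real assume "0 < t" "t < 1" "x \<in> {0..}" "y \<in> {0..}"
  then show "\<psi> ((1 - t) *\<^sub>R x + t *\<^sub>R y) \<le> (1 - t) * \<psi> x + t * \<psi> y"
    using convex_le[of y x t] by (simp add: add.commute)
qed simp

lemma continuous: "continuous_on {0..} \<psi>"
proof -
  have pos: "continuous_on {0<..} \<psi>"
    by (rule convex_on_continuous[OF open_greaterThan convex_on_subset[OF convex]]) auto
  have "continuous (at t within {0..}) \<psi>" if t: "t \<in> {0..}" for t
  proof (cases "t = 0")
    case False
    then have "isCont \<psi> t" using pos t by (auto simp: continuous_on_eq_continuous_at)
    then show ?thesis by (rule continuous_at_imp_continuous_at_within)
  next
    case True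
    define d where "d = \<psi> 1 - \<psi> 0"
    have up: "\<forall>\<^sub>F s in at 0 within {0..}. \<psi> s \<le> \<psi> 0 + s * d"
    proof -
      have "\<forall>\<^sub>F s in at (0::real) within {0..}. s < 1"
        by (rule order_tendstoD[OF tendsto_ident_at]) simp
      moreover have "\<forall>\<^sub>F s in at (0::real) within {0..}. s \<in> {0..}"
        by (rule eventually_at_topological[THEN iffD2]) auto
      ultimately show ?thesis
      proof eventually_elim
        case (elim s)
        then show ?case using convex_le[of 1 0 s] by (simp add: d_def algebra_simps)
      qed
    qed
    have lo: "\<forall>\<^sub>F s in at 0 within {0..}. \<psi> 0 \<le> \<psi> s"
      by (rule eventually_at_topological[THEN iffD2]) (auto intro: mono)
    have "((\<lambda>s. \<psi> 0 + s * d) \<longlongrightarrow> \<psi> 0 + 0 * d) (at 0 within {0..})" by (intro tendsto_intros)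
    then have "(\<psi> \<longlongrightarrow> \<psi> 0) (at 0 within {0..})"
      by (intro tendsto_sandwich[OF lo up tendsto_const]) simp
    then show ?thesis using True by (simp add: continuous_within)
  qed
  then show ?thesis by (simp add: continuous_on_eq_continuous_within)
qed

lemma growth:
  assumes "1 \<le> t" shows "t * (\<psi> 1 - \<psi> 0) \<le> \<psi> t"
proof -
  have "\<psi> (1 / t * t + (1 - 1 / t) * 0) \<le> 1 / t * \<psi> t + (1 - 1 / t) * \<psi> 0"
    using assms by (intro convex_le) auto
  then have "t * \<psi> 1 \<le> t * (1 / t * \<psi> t + (1 - 1 / t) * \<psi> 0)" using assms by (intro mult_left_mono) auto
  also have "\<dots> = \<psi> t + (t - 1) * \<psi> 0" using assms by (simp add: field_simps)
  finally have "t * (\<psi> 1 - \<psi> 0) + \<psi> 0 \<le> \<psi> t" by (simp add: algebra_simps)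
  then show ?thesis using nonneg[of 0] by simp
qed

end

lemma (in regulariser) loss_min_exists:
  fixes W :: "(real^'m) nspace"
  assumes W: "normed_space W" "carr W = UNIV"
    and F: "proper_fun F" "lsc_fun F"
  shows "\<exists>z0. F z0 < \<infinity> \<and> (\<forall>z. F z0 + ennreal (\<psi> (nrm W z0)) \<le> F z + ennreal (\<psi> (nrm W z)))"
proof -
  define G where "G z = F z + ennreal (\<psi> (nrm W z))" for z
  have W0: "nrm W z \<ge> 0" for z by (simp add: normed_nonneg[OF W(1)] W(2))
  have cont: "continuous_on UNIV (\<lambda>z. \<psi> (nrm W z))"
    by (rule continuous_on_compose2[OF continuous fin_nrm_continuous[OF W]]) (use W0 in auto)
  obtain z1 where z1: "F z1 < \<infinity>" using F(1) by (auto simp: proper_fun_def)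
  then have "G z1 \<noteq> \<infinity>" by (simp add: G_def)
  then obtain g where g: "G z1 = ennreal g" "0 \<le> g" by (cases "G z1") auto
  define d where "d = \<psi> 1 - \<psi> 0"
  have d: "d > 0" using less[of 0 1] by (simp add: d_def)
  define R where "R = max (max 1 ((g + 1) / d)) (nrm W z1)"
  have big: "G z1 < G z" if "nrm W z > R" for z
  proof -
    have "1 \<le> nrm W z" "(g + 1) / d \<le> nrm W z" using that by (auto simp: R_def)
    then have "g < nrm W z * d" using d by (simp add: field_simps)
    also have "\<dots> \<le> \<psi> (nrm W z)" using growth[OF \<open>1 \<le> nrm W z\<close>] by (simp add: d_def)
    finally have "G z1 < ennreal (\<psi> (nrm W z))" using g by (simp add: ennreal_less_iff)
    also have "\<dots> \<le> G z" by (simp add: G_def)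
    finally show ?thesis .
  qed
  let ?K = "{z. nrm W z \<le> R}"
  obtain c where c: "c > 0" "\<And>z. c * norm z \<le> nrm W z" using fin_nrm_lower[OF W] by blast
  have "closed ?K" by (intro closed_Collect_le fin_nrm_continuous[OF W] continuous_on_const)
  moreover have "bounded ?K"
  proof (rule boundedI[where B="R/c"])
    fix z assume "z \<in> ?K"
    then show "norm z \<le> R / c" using c(1) c(2)[of z] by (simp add: field_simps)
  qed
  ultimately have K: "compact ?K" by (simp add: compact_eq_bounded_closed)
  have z1K: "z1 \<in> ?K" by (simp add: R_def)
  have "\<exists>z\<in>?K. \<forall>w\<in>?K. G z \<le> G w"
  proof (rule lsc_attains_min[OF K])
    show "?K \<noteq> {}" using z1K by blast
    show "\<And>z c. c < G z \<Longrightarrow> \<forall>\<^sub>F w in nhds z. c < G w"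
      unfolding G_def by (rule lsc_add_continuous[OF F(2) cont]) (auto intro: nonneg W0)
  qed
  then obtain z0 where z0: "z0 \<in> ?K" "\<And>w. w \<in> ?K \<Longrightarrow> G z0 \<le> G w" by blast
  have "G z0 \<le> G z" for z
    using z0(2)[OF z1K] z0(2)[of z] big[of z] by (cases "z \<in> ?K") auto
  moreover have "F z0 < \<infinity>"
  proof -
    have "F z0 \<le> G z0" by (simp add: G_def)
    also have "\<dots> \<le> G z1" by (rule z0(2)[OF z1K])
    also have "\<dots> < \<infinity>" using g by simp
    finally show ?thesis .
  qed
  ultimately show ?thesis unfolding G_def by blast
qed

text \<open>Midpoint estimate for a sum of two extended terms of which the first is strictly convex.
  The two sums at the end points are equal, so the mean of them may be replaced by either.\<close>

lemma ennreal_half_sum: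
  assumes "x \<noteq> \<infinity>" "y \<noteq> \<infinity>" "m < ennreal (1/2) * x + ennreal (1 - 1/2) * y" "x + p = y + q" "0 \<le> p'" "0 \<le> q'"
    "p = ennreal p'" "q = ennreal q'"  "k \<le> ennreal ((p' + q') / 2)"
  shows "m + k < x + p"
proof -
  obtain x' where x': "x = ennreal x'" "0 \<le> x'" using assms(1) by (cases x) auto
  obtain y' where y': "y = ennreal y'" "0 \<le> y'" using assms(2) by (cases y) auto
  note xy = x' y'
  have half: "ennreal (1/2 * x') = ennreal (1/2) * ennreal x'" "ennreal ((1 - 1/2) * y') = ennreal (1 - 1/2) * ennreal y'"
    by (rule ennreal_mult', simp)+
  have "ennreal (1/2) * x + ennreal (1 - 1/2) * y = ennreal (1/2 * x') + ennreal ((1 - 1/2) * y')"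
    by (simp only: half xy)
  also have "\<dots> = ennreal (1/2 * x' + (1 - 1/2) * y')"
    by (rule ennreal_plus[symmetric]) (use xy in auto)
  also have "\<dots> = ennreal ((x' + y') / 2)" by (rule arg_cong[of _ _ ennreal]) simp
  finally have e: "ennreal (1/2) * x + ennreal (1 - 1/2) * y = ennreal ((x' + y') / 2)" .
  have "ennreal (x' + p') = ennreal (y' + q')" using assms(4-8) xy by simp
  then have s: "x' + p' = y' + q'" by (subst (asm) ennreal_inj) (use xy assms(5,6) in auto)
  have "m + k \<le> m + ennreal ((p' + q') / 2)" using assms(9) by (rule add_left_mono)
  also have "\<dots> < ennreal ((x' + y') / 2) + ennreal ((p' + q') / 2)"
    using assms(3) unfolding e add.commute[of _ "ennreal ((p' + q') / 2)"]
    by (simp only: ennreal_add_left_cancel_less) simp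
  also have "\<dots> = ennreal (x' + p')"
  proof -
    have "ennreal ((x' + y') / 2) + ennreal ((p' + q') / 2) = ennreal ((x' + y') / 2 + (p' + q') / 2)"
      by (rule ennreal_plus[symmetric]) (use xy assms(5,6) in auto)
    also have "(x' + y') / 2 + (p' + q') / 2 = x' + p'" using s by (simp add: field_simps)
    finally show ?thesis .
  qed
  also have "\<dots> = x + p" using xy assms(5,7) by simp
  finally show ?thesis .
qed

section \<open>The solution set\<close>

context interpolation
begin

text \<open>Solution sets turn out to be of this form.\<close>

definition sublevel :: "real^'m \<Rightarrow> real \<Rightarrow> (('a \<Rightarrow> real)^'n) set" where
  "sublevel z r = {f \<in> carr PX'. meas f = z \<and> nrm PX' f \<le> r}"

text \<open>Replacing a functional by the interpolant of least norm with the same measurements does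
  not increase the objective, so that it suffices to minimise over the measurement vectors. A second
  minimiser has the same measurements by strict convexity of the loss, and then the same norm
  because the regulariser is strictly increasing. The coefficient vector is one that attains the
  dual norm of the measurements.\<close>

theorem solution_set_eq:
  fixes E :: "real^'m \<Rightarrow> real^'m \<Rightarrow> ennreal"
  assumes E: "proper_fun (E b)" "lsc_fun (E b)" "strictly_convex_fun (E b)"
    and \<psi>: "regulariser \<psi>"
  shows "\<exists>z r a. solution_set Z X \<nu> E \<psi> b = sublevel z r \<and> sublevel z r \<noteq> {} \<and>
    (\<forall>f\<in>sublevel z r. nrm PX' f = r) \<and> 0 \<le> r \<and> nrm PX (comb a) = r \<and> a \<bullet> z = r * r"
proof -
  interpret regulariser \<psi> by (fact \<psi>)
  let ?W = "vec_dual coef"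
  note normed_W = normed_vec_dual[OF normed_coef carr_coef]
  define J where "J f = E b (meas f) + ennreal (\<psi> (nrm PX' f))" for f
  obtain z where z: "E b z < \<infinity>"
      "\<And>w. E b z + ennreal (\<psi> (nrm ?W z)) \<le> E b w + ennreal (\<psi> (nrm ?W w))"
    using loss_min_exists[OF normed_W vec_dual_carr E(1,2)] by blast
  define r where "r = nrm ?W z"
  have r0: "0 \<le> r" unfolding r_def by (rule vec_dual_nonneg[OF normed_coef carr_coef])
  obtain f0 where f0: "f0 \<in> carr PX'" "meas f0 = z" "nrm PX' f0 = r"
    using interpolant_exists[of z] by (auto simp: r_def simp del: product_carr_iff)
  note P0 = normed_nonneg[OF normed_PX']
  have lower: "r \<le> nrm PX' f" if "f \<in> carr PX'" "meas f = z" for f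
    using meas_lower_bound[OF that(1)] that(2) by (simp add: r_def)
  have min: "J f0 \<le> J f" if f: "f \<in> carr PX'" for f
  proof -
    have "J f0 \<le> E b (meas f) + ennreal (\<psi> (nrm ?W (meas f)))"
      using z(2)[of "meas f"] by (simp add: J_def f0 r_def)
    also have "\<dots> \<le> J f"
      unfolding J_def using meas_lower_bound[OF f] vec_dual_nonneg[OF normed_coef carr_coef]
      by (intro add_left_mono ennreal_leI mono) auto
    finally show ?thesis .
  qed
  have J0: "J f0 < \<infinity>" using z(1) by (simp add: J_def f0)
  have unique: "meas f = z \<and> nrm PX' f = r" if f: "f \<in> carr PX'" and le: "J f \<le> J f0" for f
  proof -
    have eq: "J f = J f0" using le min[OF f] by simp
    define h where "h = (1/2) *\<^sub>R f + (1 - 1/2) *\<^sub>R f0"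
    have h: "h \<in> carr PX'"
      unfolding h_def using normed_subspace[OF normed_PX'] f f0(1)
      by (intro subspace_add subspace_scale)
    have mh: "meas h = (1/2) *\<^sub>R meas f + (1 - 1/2) *\<^sub>R meas f0"
      unfolding h_def by (simp add: linear_add[OF linear_meas] linear_scale[OF linear_meas])
    have nh: "nrm PX' h \<le> (1/2) * nrm PX' f + (1 - 1/2) * nrm PX' f0"
      unfolding h_def
      using normed_triangle[OF normed_PX', of "(1/2) *\<^sub>R f" "(1 - 1/2) *\<^sub>R f0"] f f0(1)
        normed_subspace[OF normed_PX']
      by (simp add: normed_scale[OF normed_PX' f] normed_scale[OF normed_PX' f0(1)] subspace_scale
          del: product_carr_iff)
    have \<psi>h: "\<psi> (nrm PX' h) \<le> (\<psi> (nrm PX' f) + \<psi> (nrm PX' f0)) / 2"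
      using mono[OF P0[OF h] nh] convex_le[OF P0[OF f] P0[OF f0(1)], of "1/2"]
      by simp
    have fin: "E b (meas f) \<noteq> \<infinity>" "E b (meas f0) \<noteq> \<infinity>"
      using J0[unfolded eq[symmetric]] J0 by (auto simp: J_def)
    have "meas f = z"
    proof (rule ccontr)
      assume ne: "meas f \<noteq> z"
      have "E b (meas h) < ennreal (1/2) * E b (meas f) + ennreal (1 - 1/2) * E b (meas f0)"
        unfolding mh using E(3)[unfolded strictly_convex_fun_def, rule_format, of "1/2" "meas f" "meas f0"] ne fin
        by (simp add: f0(2) less_top)
      then have "J h < J f"
        unfolding J_def
        using eq[unfolded J_def] nonneg[OF P0[OF f]] nonneg[OF P0[OF f0(1)]] refl refl ennreal_leI[OF \<psi>h]
        by (rule ennreal_half_sum[OF fin])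
      then show False using min[OF h] eq by simp
    qed
    moreover have "nrm PX' f \<le> r"
    proof (rule ccontr)
      assume "\<not> nrm PX' f \<le> r"
      then have "\<psi> (nrm PX' f0) < \<psi> (nrm PX' f)" using less[OF r0] f0(3) by simp
      then have "J f0 < J f"
        unfolding J_def using fin \<open>meas f = z\<close> nonneg[OF P0[OF f0(1)]]
        by (simp add: f0(2) ennreal_add_left_cancel_less ennreal_less_iff)
      then show False using eq by simp
    qed
    ultimately show ?thesis using lower[OF f] by force
  qed
  have sub_le: "J f \<le> J f0" if "f \<in> sublevel z r" for f
    using that P0[of f] unfolding J_def sublevel_def
    by (auto simp: f0 simp del: product_carr_iff intro!: add_left_mono ennreal_leI mono)
  have "solution_set Z X \<nu> E \<psi> b = {f. is_arg_min J (\<lambda>f. f \<in> carr PX') f}"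
  proof -
    have "J = (\<lambda>f. E b (\<chi> m. pairing (\<nu> m) f) + ennreal (\<psi> (nrm PX' f)))"
      by (simp add: fun_eq_iff J_def meas_def)
    then show ?thesis by (simp only: solution_set_def Let_def)
  qed
  also have "\<dots> = {f \<in> carr PX'. J f \<le> J f0}"
    unfolding is_arg_min_def using min f0(1) by (auto simp: not_less simp del: product_carr_iff intro: order_trans)
  also have "\<dots> = sublevel z r"
  proof (intro equalityI subsetI)
    fix f assume "f \<in> {f \<in> carr PX'. J f \<le> J f0}"
    then show "f \<in> sublevel z r" using unique[of f] by (simp add: sublevel_def)
  next
    fix f assume f: "f \<in> sublevel z r"
    then show "f \<in> {f \<in> carr PX'. J f \<le> J f0}" using sub_le[OF f] by (simp add: sublevel_def)
  qed
  finally have eq: "solution_set Z X \<nu> E \<psi> b = sublevel z r" .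
  have "f0 \<in> sublevel z r" using f0 by (simp add: sublevel_def)
  then have ne: "sublevel z r \<noteq> {}" by blast
  have nr: "\<forall>f\<in>sublevel z r. nrm PX' f = r" using lower by (force simp: sublevel_def)
  obtain a where "conjugates ?W coef (\<bullet>) z a"
    using vec_dual_conjugate_exists[OF normed_coef carr_coef] by blast
  then have a: "nrm PX (comb a) = r" "a \<bullet> z = r * r"
    by (simp_all add: conjugates_def nrm_coef r_def inner_commute)
  show ?thesis using eq ne nr r0 a by blast
qed

end

section \<open>Extreme points of slices\<close>

lemma extreme_point_of_inj_image:
  assumes T: "linear T" "inj_on T F" and e: "e \<in> F" "T e extreme_point_of (T ` F)"
  shows "e extreme_point_of F"
  unfolding extreme_point_of_def
proof (intro conjI ballI notI e(1))
  fix p q assume pq: "p \<in> F" "q \<in> F" "e \<in> open_segment p q"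
  then obtain u where u: "p \<noteq> q" "0 < u" "u < 1" "e = (1 - u) *\<^sub>R p + u *\<^sub>R q" by (auto simp: in_segment)
  have "T p \<noteq> T q" using T(2) pq u(1) by (auto dest: inj_onD)
  then have "T e \<in> open_segment (T p) (T q)"
    unfolding in_segment using u by (auto simp: linear_add[OF T(1)] linear_scale[OF T(1)])
  then show False using e(2) pq by (auto simp: extreme_point_of_def)
qed

text \<open>The theorem of Dubins and Klee for a slice that touches the set B, in a form without a
  topology on the ambient space. Let D be the space of directions in which one can move from
  \<open>f0\<close> to both sides inside of B. The face F of B that \<open>f0\<close> generates is
  the part of B in the affine space through \<open>f0\<close> with direction D. As \<open>f0\<close>
  is extreme in its slice, T is injective on D, so F can be studied through its image in
  \<open>\<real>^M\<close>, which is compact, convex and contained in a hyperplane because the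
  functional given by a is maximal at \<open>f0\<close>. There \<open>T f0\<close> is a convex
  combination of at most M extreme points, and these are images of extreme points of F and hence of
  B.\<close>

theorem extreme_slice_atoms:
  fixes B :: "'v::real_vector set" and T :: "'v \<Rightarrow> real^'m"
  assumes B: "convex B" and T: "linear T" "bounded (T ` B)"
    and closed: "\<And>g :: real^'m \<Rightarrow> 'v. linear g \<Longrightarrow> range g \<subseteq> span ((\<lambda>f. f - f0) ` B) \<Longrightarrow> closed {z. f0 + g z \<in> B}"
    and f0: "f0 extreme_point_of {f \<in> B. T f = T f0}"
    and a: "a \<noteq> 0" "\<And>f. f \<in> B \<Longrightarrow> a \<bullet> T f \<le> a \<bullet> T f0"
  shows "\<exists>A. finite A \<and> card A \<le> CARD('m) \<and> A \<subseteq> {e. e extreme_point_of B} \<and> f0 \<in> convex hull A"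
proof -
  have f0B: "f0 \<in> B" using f0 by (simp add: extreme_point_of_def)
  define D where "D = {d. \<exists>\<epsilon>>0. f0 + \<epsilon> *\<^sub>R d \<in> B \<and> f0 - \<epsilon> *\<^sub>R d \<in> B}"
  have shrink: "f0 + s *\<^sub>R d \<in> B" if "f0 + \<epsilon> *\<^sub>R d \<in> B" "0 \<le> s" "s \<le> \<epsilon>" "\<epsilon> > 0" for s \<epsilon> d
  proof -
    have "(1 - s / \<epsilon>) *\<^sub>R f0 + (s / \<epsilon>) *\<^sub>R (f0 + \<epsilon> *\<^sub>R d) \<in> B"
      using that f0B by (intro convexD[OF B]) auto
    moreover have "(1 - s / \<epsilon>) *\<^sub>R f0 + (s / \<epsilon>) *\<^sub>R (f0 + \<epsilon> *\<^sub>R d) = f0 + s *\<^sub>R d"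
      using that by (simp add: algebra_simps)
    ultimately show ?thesis by simp
  qed
  have D_iff: "d \<in> D \<longleftrightarrow> (\<exists>\<epsilon>>0. f0 + \<epsilon> *\<^sub>R d \<in> B \<and> f0 + \<epsilon> *\<^sub>R (- d) \<in> B)" for d
    by (simp add: D_def)
  have Dsub: "subspace D"
  proof (rule subspaceI)
    show "0 \<in> D" using f0B by (auto simp: D_def intro: exI[of _ 1])
  next
    fix x y assume "x \<in> D" "y \<in> D"
    then obtain e1 e2 where e: "e1 > 0" "f0 + e1 *\<^sub>R x \<in> B" "f0 + e1 *\<^sub>R (-x) \<in> B"
        "e2 > 0" "f0 + e2 *\<^sub>R y \<in> B" "f0 + e2 *\<^sub>R (-y) \<in> B" unfolding D_iff by blast
    define \<epsilon> where "\<epsilon> = min e1 e2"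
    have \<epsilon>: "\<epsilon> > 0" "\<epsilon> \<le> e1" "\<epsilon> \<le> e2" using e by (auto simp: \<epsilon>_def)
    have mid: "f0 + (\<epsilon>/2) *\<^sub>R (u + v) \<in> B" if "f0 + \<epsilon> *\<^sub>R u \<in> B" "f0 + \<epsilon> *\<^sub>R v \<in> B" for u v
    proof -
      have "(1/2) *\<^sub>R (f0 + \<epsilon> *\<^sub>R u) + (1/2) *\<^sub>R (f0 + \<epsilon> *\<^sub>R v) \<in> B"
        using that by (intro convexD[OF B]) auto
      moreover have "(1/2) *\<^sub>R (f0 + \<epsilon> *\<^sub>R u) + (1/2) *\<^sub>R (f0 + \<epsilon> *\<^sub>R v) = ((1/2) *\<^sub>R f0 + (1/2) *\<^sub>R f0) + (\<epsilon>/2) *\<^sub>R (u + v)"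
        by (simp add: algebra_simps)
      moreover have "(1/2) *\<^sub>R f0 + (1/2) *\<^sub>R f0 = f0" by (simp flip: scaleR_add_left)
      ultimately show ?thesis by simp
    qed
    have "f0 + (\<epsilon>/2) *\<^sub>R (x + y) \<in> B" "f0 + (\<epsilon>/2) *\<^sub>R ((-x) + (-y)) \<in> B"
      using e(1,4) \<epsilon> shrink[OF e(2)] shrink[OF e(3)] shrink[OF e(5)] shrink[OF e(6)] by (intro mid; simp)+
    moreover have "- (x + y) = (-x) + (-y)" by simp
    ultimately show "x + y \<in> D" unfolding D_iff using \<epsilon>(1) by (intro exI[of _ "\<epsilon>/2"]) simp
  next
    fix c :: real and x assume "x \<in> D"
    then obtain e1 where e: "e1 > 0" "f0 + e1 *\<^sub>R x \<in> B" "f0 + e1 *\<^sub>R (-x) \<in> B" unfolding D_iff by blast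
    show "c *\<^sub>R x \<in> D"
    proof (cases "c = 0")
      case True then show ?thesis using f0B by (auto simp: D_def intro: exI[of _ 1])
    next
      case False
      then have "f0 + (e1 / \<bar>c\<bar>) *\<^sub>R (c *\<^sub>R x) \<in> B" "f0 + (e1 / \<bar>c\<bar>) *\<^sub>R (- (c *\<^sub>R x)) \<in> B"
        using e by (cases "c > 0"; simp)+
      then show ?thesis unfolding D_iff using e(1) False by (intro exI[of _ "e1 / \<bar>c\<bar>"]) auto
    qed
  qed
  have Dspan: "D \<subseteq> span ((\<lambda>f. f - f0) ` B)"
  proof
    fix d assume "d \<in> D"
    then obtain \<epsilon> where e: "\<epsilon> > 0" "f0 + \<epsilon> *\<^sub>R d \<in> B" unfolding D_def by blast
    then have "(f0 + \<epsilon> *\<^sub>R d) - f0 \<in> span ((\<lambda>f. f - f0) ` B)" by (intro span_base) blast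
    then have "(1 / \<epsilon>) *\<^sub>R ((f0 + \<epsilon> *\<^sub>R d) - f0) \<in> span ((\<lambda>f. f - f0) ` B)" by (rule span_scale)
    then show "d \<in> span ((\<lambda>f. f - f0) ` B)" using e(1) by simp
  qed
  have Tadd: "T (x + y) = T x + T y" and Tsc: "T (c *\<^sub>R x) = c *\<^sub>R T x" and Tdiff: "T (x - y) = T x - T y" for x y c
    by (simp_all add: linear_add[OF T(1)] linear_scale[OF T(1)] linear_diff[OF T(1)])
  have inj0: "d = 0" if d: "d \<in> D" "T d = 0" for d
  proof (rule ccontr)
    assume "d \<noteq> 0"
    obtain \<epsilon> where e: "\<epsilon> > 0" "f0 + \<epsilon> *\<^sub>R d \<in> B" "f0 - \<epsilon> *\<^sub>R d \<in> B" using d(1) by (auto simp: D_def)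
    let ?u = "f0 + \<epsilon> *\<^sub>R d" and ?v = "f0 - \<epsilon> *\<^sub>R d"
    have "?u \<in> {f \<in> B. T f = T f0}" "?v \<in> {f \<in> B. T f = T f0}"
      using e d(2) by (auto simp: Tadd Tdiff Tsc)
    moreover have "f0 \<in> open_segment ?u ?v"
    proof -
      have "?u \<noteq> ?v"
      proof
        assume "?u = ?v"
        then have "(2 * \<epsilon>) *\<^sub>R d = 0" by (simp add: algebra_simps flip: scaleR_2)
        then show False using e(1) \<open>d \<noteq> 0\<close> by simp
      qed
      moreover have "f0 = (1 - 1/2) *\<^sub>R ?u + (1/2) *\<^sub>R ?v"
        by (simp add: algebra_simps flip: scaleR_add_left)
      ultimately show ?thesis unfolding in_segment by (intro conjI exI[of _ "1/2"]) auto
    qed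
    ultimately show False using f0 by (auto simp: extreme_point_of_def)
  qed
  have injD: "inj_on T D"
  proof (rule inj_onI)
    fix x y assume "x \<in> D" "y \<in> D" "T x = T y"
    then have "x - y = 0" using Dsub by (intro inj0) (auto simp: Tdiff intro: subspace_diff)
    then show "x = y" by simp
  qed
  obtain g where g: "range g \<subseteq> D" "linear g" "\<And>v. v \<in> D \<Longrightarrow> g (T v) = v"
    using linear_exists_left_inverse_on[OF T(1) Dsub injD] by blast
  define F where "F = {f \<in> B. f - f0 \<in> D}"
  have f0F: "f0 \<in> F" using f0B subspace_0[OF Dsub] by (simp add: F_def)
  have Fconv: "convex F"
  proof (rule convexI)
    fix x y and u v :: real assume xy: "x \<in> F" "y \<in> F" and uv: "0 \<le> u" "0 \<le> v" "u + v = 1"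
    have "u *\<^sub>R x + v *\<^sub>R y - f0 = u *\<^sub>R x + v *\<^sub>R y - (u + v) *\<^sub>R f0" using uv by simp
    also have "\<dots> = u *\<^sub>R (x - f0) + v *\<^sub>R (y - f0)" by (simp add: algebra_simps)
    also have "\<dots> \<in> D" using xy Dsub by (auto simp: F_def intro!: subspace_add subspace_scale)
    finally show "u *\<^sub>R x + v *\<^sub>R y \<in> F" using xy convexD[OF B _ _ uv] by (simp add: F_def)
  qed
  have face: "F face_of B"
    unfolding face_of_def
  proof (intro conjI ballI impI Fconv)
    show "F \<subseteq> B" by (auto simp: F_def)
    have key: "p \<in> F" if p: "p \<in> B" and q: "q \<in> B" and x: "x \<in> F" and u: "0 < u" "u < 1"
      and xe: "x = (1 - u) *\<^sub>R p + u *\<^sub>R q" for p q x u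
    proof -
      \<comment> \<open>from f0 one can move a little away from x inside of B, hence also away from p\<close>
      obtain \<epsilon> where e: "\<epsilon> > 0" "f0 + \<epsilon> *\<^sub>R (- (x - f0)) \<in> B" using x unfolding F_def D_iff by auto
      define \<alpha> where "\<alpha> = 1 / (1 + \<epsilon>)"
      define \<mu> where "\<mu> = \<epsilon> / (1 + \<epsilon>)"
      have lm: "0 < \<alpha>" "0 < \<mu>" "\<alpha> + \<mu> = 1" "\<alpha> * \<epsilon> = \<mu>" "\<alpha> * (1 + \<epsilon>) = 1"
        using e(1) by (auto simp: \<alpha>_def \<mu>_def add_divide_distrib[symmetric])
      \<comment> \<open>f0 is a convex combination of that point and x, hence of w and p with positive weight on p\<close>
      define k where "k = \<mu> * (1 - u)"
      have k: "0 < k" "k < 1"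
      proof -
        have "\<mu> < 1" using lm by simp
        then show "0 < k" "k < 1" using lm u mult_strict_mono[of \<mu> 1 "1 - u" 1] by (auto simp: k_def)
      qed
      define w where "w = (1 / (1 - k)) *\<^sub>R (\<alpha> *\<^sub>R (f0 + \<epsilon> *\<^sub>R (- (x - f0))) + (\<mu> * u) *\<^sub>R q)"
      have sum1: "\<alpha> / (1 - k) + (\<mu> * u) / (1 - k) = 1"
      proof -
        have "\<alpha> + \<mu> * u = 1 - k" using lm(3) by (simp add: k_def algebra_simps)
        then show ?thesis using k by (simp add: add_divide_distrib[symmetric])
      qed
      have "(\<alpha> / (1 - k)) *\<^sub>R (f0 + \<epsilon> *\<^sub>R (- (x - f0))) + ((\<mu> * u) / (1 - k)) *\<^sub>R q \<in> B"
        using lm u k sum1 by (intro convexD[OF B e(2) q]) auto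
      then have wB: "w \<in> B" by (simp add: w_def scaleR_add_right)
      have "(1 - k) *\<^sub>R w = \<alpha> *\<^sub>R (f0 + \<epsilon> *\<^sub>R (- (x - f0))) + (\<mu> * u) *\<^sub>R q"
        using k by (simp only: w_def) simp
      moreover have "\<mu> *\<^sub>R x = k *\<^sub>R p + (\<mu> * u) *\<^sub>R q"
        by (simp add: xe k_def scaleR_add_right)
      ultimately have "(1 - k) *\<^sub>R w + k *\<^sub>R p = \<alpha> *\<^sub>R (f0 + \<epsilon> *\<^sub>R (- (x - f0))) + \<mu> *\<^sub>R x"
        by (simp only: add_ac)
      also have "\<dots> = (\<alpha> * (1 + \<epsilon>)) *\<^sub>R f0 + (\<mu> - \<alpha> * \<epsilon>) *\<^sub>R x" by (simp add: algebra_simps)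
      also have "\<dots> = f0" using lm by simp
      finally have comb: "(1 - k) *\<^sub>R w + k *\<^sub>R p = f0" .
      define \<delta> where "\<delta> = min 1 (k / (1 - k))"
      have dl: "\<delta> > 0" "\<delta> \<le> 1" "\<delta> \<le> k / (1 - k)" using k by (auto simp: \<delta>_def)
      have "w - f0 = (k / (1 - k)) *\<^sub>R (- (p - f0))"
      proof -
        have "(1 - k) *\<^sub>R (w - f0) = k *\<^sub>R (- (p - f0))" using comb by (simp add: algebra_simps)
        then have "(1 / (1 - k)) *\<^sub>R ((1 - k) *\<^sub>R (w - f0)) = (1 / (1 - k)) *\<^sub>R (k *\<^sub>R (- (p - f0)))" by simp
        then show ?thesis using k by simp
      qed
      moreover have "f0 + (w - f0) \<in> B" using wB by simp
      ultimately have "f0 + (k / (1 - k)) *\<^sub>R (- (p - f0)) \<in> B" by (simp only:)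
      then have "f0 + \<delta> *\<^sub>R (- (p - f0)) \<in> B" by (rule shrink) (use dl k in simp_all)
      moreover have "f0 + 1 *\<^sub>R (p - f0) \<in> B" using p by simp
      then have "f0 + \<delta> *\<^sub>R (p - f0) \<in> B" by (rule shrink) (use dl in simp_all)
      ultimately have "p - f0 \<in> D" unfolding D_iff using dl(1) by blast
      then show ?thesis using p by (simp add: F_def)
    qed
    fix p q x assume p: "p \<in> B" and q: "q \<in> B" and x: "x \<in> F" and "x \<in> open_segment p q"
    then obtain u where u: "0 < u" "u < 1" "x = (1 - u) *\<^sub>R p + u *\<^sub>R q" by (auto simp: in_segment)
    show "p \<in> F" by (rule key[OF p q x u])
    show "q \<in> F" by (rule key[OF q p x, of "1 - u"]) (use u in auto)
  qed
  have TF: "T ` F = {w. w - T f0 \<in> T ` D \<and> f0 + g (w - T f0) \<in> B}"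
  proof (intro equalityI subsetI)
    fix w assume "w \<in> T ` F"
    then obtain f where f: "w = T f" "f \<in> B" "f - f0 \<in> D" by (auto simp: F_def)
    have "w - T f0 = T (f - f0)" by (simp add: f Tdiff)
    moreover from this have "f0 + g (w - T f0) = f" using g(3)[OF f(3)] by simp
    ultimately show "w \<in> {w. w - T f0 \<in> T ` D \<and> f0 + g (w - T f0) \<in> B}" using f by auto
  next
    fix w assume "w \<in> {w. w - T f0 \<in> T ` D \<and> f0 + g (w - T f0) \<in> B}"
    then obtain d where d: "d \<in> D" "w - T f0 = T d" "f0 + g (w - T f0) \<in> B" by auto
    then have "f0 + d \<in> F" using g(3) by (simp add: F_def)
    moreover have "w = T (f0 + d)" using d(2) by (simp add: Tadd algebra_simps)
    ultimately show "w \<in> T ` F" by blast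
  qed
  have "closed (T ` F)"
  proof -
    have cl1: "closed {z. f0 + g z \<in> B}" by (rule closed[OF g(2)]) (use g(1) Dspan in blast)
    have cl2: "closed (T ` D)" by (rule closed_subspace[OF linear_subspace_image[OF T(1) Dsub]])
    have "T ` F = (\<lambda>w. w - T f0) -` (T ` D \<inter> {z. f0 + g z \<in> B})" unfolding TF by auto
    moreover have "closed \<dots>"
      by (intro closed_vimage closed_Int cl1 cl2 continuous_intros)
    ultimately show ?thesis by simp
  qed
  moreover have "bounded (T ` F)" by (rule bounded_subset[OF T(2)]) (auto simp: F_def)
  ultimately have cTF: "compact (T ` F)" unfolding compact_eq_bounded_closed by blast
  have vTF: "convex (T ` F)" by (rule convex_linear_image[OF T(1) Fconv])
  have injF: "inj_on T F"
  proof (rule inj_onI)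
    fix x y assume "x \<in> F" "y \<in> F" "T x = T y"
    then have "x - f0 = y - f0" using injD by (auto simp: F_def inj_on_def Tdiff)
    then show "x = y" by simp
  qed
  \<comment> \<open>a maximum at an inner point of a segment is a maximum along the whole segment\<close>
  have hyper: "T ` F \<subseteq> {w. a \<bullet> w = a \<bullet> T f0}"
  proof
    fix w assume "w \<in> T ` F"
    then obtain f where f: "w = T f" "f \<in> B" "f - f0 \<in> D" by (auto simp: F_def)
    then obtain \<epsilon> where e: "\<epsilon> > 0" "f0 - \<epsilon> *\<^sub>R (f - f0) \<in> B" by (auto simp: D_def)
    have up: "a \<bullet> T f \<le> a \<bullet> T f0" by (rule a(2)[OF f(2)])
    have "a \<bullet> T (f0 - \<epsilon> *\<^sub>R (f - f0)) \<le> a \<bullet> T f0" by (rule a(2)[OF e(2)])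
    moreover have "a \<bullet> T (f0 - \<epsilon> *\<^sub>R (f - f0)) = a \<bullet> T f0 - \<epsilon> * (a \<bullet> T f - a \<bullet> T f0)"
      by (simp only: Tdiff Tsc inner_diff_right inner_scaleR_right)
    ultimately have "0 \<le> \<epsilon> * (a \<bullet> T f - a \<bullet> T f0)" by linarith
    then have "a \<bullet> T f0 \<le> a \<bullet> T f" using e(1) by (simp add: zero_le_mult_iff)
    then show "w \<in> {w. a \<bullet> w = a \<bullet> T f0}" using f up by simp
  qed
  define P where "P = {x. x extreme_point_of (T ` F)}"
  have PsubTF: "P \<subseteq> T ` F" by (auto simp: P_def extreme_point_of_def)
  have "T f0 \<in> convex hull P"
    using Krein_Milman_Minkowski[OF cTF vTF] f0F unfolding P_def by blast
  then obtain Q where Q: "finite Q" "Q \<subseteq> P" "int (card Q) \<le> aff_dim P + 1" "T f0 \<in> convex hull Q"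
    unfolding caratheodory_aff_dim[of P] by blast
  have "aff_dim P \<le> aff_dim {w. a \<bullet> w = a \<bullet> T f0}" by (rule aff_dim_subset) (use PsubTF hyper in blast)
  also have "\<dots> = int CARD('m) - 1" using aff_dim_hyperplane[OF a(1), of "a \<bullet> T f0"] by simp
  finally have cQ: "card Q \<le> CARD('m)" using Q(3) by simp
  define A where "A = the_inv_into F T ` Q"
  have QTF: "Q \<subseteq> T ` F" using Q(2) PsubTF by blast
  have inv: "the_inv_into F T w \<in> F" "T (the_inv_into F T w) = w" if "w \<in> Q" for w
    using that QTF the_inv_into_into[OF injF _ order_refl] f_the_inv_into_f[OF injF] by blast+
  have AF: "A \<subseteq> F" using inv by (auto simp: A_def)
  have TA: "T ` A = Q" unfolding A_def image_image using inv by force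
  have "T f0 \<in> T ` (convex hull A)" using Q(4) TA convex_hull_linear_image[OF T(1), of A] by simp
  then obtain f where f: "f \<in> convex hull A" "T f = T f0" by auto
  moreover have "f \<in> F" using f(1) hull_minimal[of A F convex] AF Fconv by auto
  ultimately have "f = f0" using injF f0F by (auto dest: inj_onD)
  have "e extreme_point_of B" if e: "e \<in> A" for e
  proof -
    have eF: "e \<in> F" and Te: "T e extreme_point_of (T ` F)" using e AF TA Q(2) by (auto simp: P_def)
    have "e extreme_point_of F" by (rule extreme_point_of_inj_image[OF T(1) injF eF Te])
    then show ?thesis using extreme_point_of_face[OF face] by blast
  qed
  then have "A \<subseteq> {e. e extreme_point_of B}" by blast
  moreover have "finite A" "card A \<le> CARD('m)"
    using Q(1) cQ card_image_le[OF Q(1), of "the_inv_into F T"] by (auto simp: A_def)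
  moreover have "f0 \<in> convex hull A" using f(1) \<open>f = f0\<close> by simp
  ultimately show ?thesis by blast
qed

section \<open>Strict convexity and the duality operator\<close>

text \<open>The definition of strict convexity speaks of unit spheres. Rescaling gives the form that
  all uniqueness arguments use, for spheres of any radius including 0.\<close>

lemma strictly_convex_mid:
  assumes E: "normed_space E" and sc: "strictly_convex_space E"
    and x: "x \<in> carr E" "nrm E x = r" and y: "y \<in> carr E" "nrm E y = r"
    and le: "r \<le> nrm E ((1/2) *\<^sub>R x + (1/2) *\<^sub>R y)"
  shows "x = y"
proof (rule ccontr)
  assume ne: "x \<noteq> y"
  note sub = normed_subspace[OF E]
  have r: "r > 0"
  proof (rule ccontr)
    assume "\<not> r > 0"
    then have "r = 0" using normed_nonneg[OF E x(1)] x(2) by simp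
    then show False using normed_eq_0[OF E x(1)] normed_eq_0[OF E y(1)] x y ne by simp
  qed
  let ?s = "1 / r"
  have "nrm E ((1/2) *\<^sub>R (?s *\<^sub>R x) + (1 - 1/2) *\<^sub>R (?s *\<^sub>R y)) < 1"
    using r ne x y sc[unfolded strictly_convex_space_def, rule_format, of "?s *\<^sub>R x" "?s *\<^sub>R y" "1/2"]
    by (simp add: normed_scale[OF E] subspace_scale[OF sub])
  moreover have "(1/2) *\<^sub>R (?s *\<^sub>R x) + (1 - 1/2) *\<^sub>R (?s *\<^sub>R y) = ?s *\<^sub>R ((1/2) *\<^sub>R x + (1/2) *\<^sub>R y)"
    by (simp add: scaleR_add_right mult.commute)
  moreover have "nrm E (?s *\<^sub>R ((1/2) *\<^sub>R x + (1/2) *\<^sub>R y)) = ?s * nrm E ((1/2) *\<^sub>R x + (1/2) *\<^sub>R y)"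
    using r x y by (subst normed_scale[OF E]) (auto intro: subspace_add[OF sub] subspace_scale[OF sub])
  ultimately have "?s * nrm E ((1/2) *\<^sub>R x + (1/2) *\<^sub>R y) < 1" by (simp only:)
  then have "nrm E ((1/2) *\<^sub>R x + (1/2) *\<^sub>R y) < r" using r by (simp add: field_simps)
  then show False using le by simp
qed

lemma strictly_convex_extreme:
  assumes E: "normed_space E" and sc: "strictly_convex_space E"
    and u: "u \<in> carr E" "nrm E u = 1"
  shows "u extreme_point_of unit_ball E"
  unfolding extreme_point_of_def
proof (intro conjI ballI notI)
  show "u \<in> unit_ball E" using u by (simp add: unit_ball_def)
  fix a b assume ab: "a \<in> unit_ball E" "b \<in> unit_ball E" "u \<in> open_segment a b"
  then obtain t where t: "a \<noteq> b" "0 < t" "t < 1" "u = (1 - t) *\<^sub>R a + t *\<^sub>R b" by (auto simp: in_segment)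
  have a: "a \<in> carr E" "nrm E a \<le> 1" and b: "b \<in> carr E" "nrm E b \<le> 1" using ab by (auto simp: unit_ball_def)
  have "1 \<le> (1 - t) * nrm E a + t * nrm E b"
    using normed_triangle[OF E, of "(1 - t) *\<^sub>R a" "t *\<^sub>R b"] a b t u(2)
    by (simp add: normed_scale[OF E] subspace_scale[OF normed_subspace[OF E]])
  then have 1: "0 \<le> (1 - t) * (nrm E a - 1) + t * (nrm E b - 1)" by (simp add: algebra_simps)
  have 2: "(1 - t) * (nrm E a - 1) \<le> 0" "t * (nrm E b - 1) \<le> 0"
    using a b t by (simp_all add: mult_nonneg_nonpos)
  have "p = 0 \<and> q = 0" if "0 \<le> p + q" "p \<le> 0" "q \<le> 0" for p q :: real
    using that by auto
  from this[OF 1 2] have "nrm E a = 1" "nrm E b = 1" using t by simp_all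
  then have "nrm E ((1 - t) *\<^sub>R a + (1 - (1 - t)) *\<^sub>R b) < 1"
    using sc[unfolded strictly_convex_space_def, rule_format, of a b "1 - t"] a b t by simp
  then show False using t u by simp
qed

lemma duality_map_unique:
  assumes E: "normed_space E" and sc: "strictly_convex_space (dual E)"
    and f: "f \<in> duality_map E x" and g: "g \<in> duality_map E x"
  shows "f = g"
proof (rule strictly_convex_mid[OF normed_dual[OF E] sc])
  have f': "x \<in> carr E" "f \<in> carr (dual E)" "nrm (dual E) f = nrm E x" "f x = nrm E x * nrm E x"
    and g': "g \<in> carr (dual E)" "nrm (dual E) g = nrm E x" "g x = nrm E x * nrm E x"
    using f g by (simp_all add: duality_map_def conjugates_def)
  show "f \<in> carr (dual E)" "nrm (dual E) f = nrm E x" "g \<in> carr (dual E)" "nrm (dual E) g = nrm E x"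
    by (fact f' g')+
  let ?h = "(1/2) *\<^sub>R f + (1/2) *\<^sub>R g"
  have h: "?h \<in> carr (dual E)"
    using f' g' subspace_dual[OF E] by (intro subspace_add subspace_scale)
  have "nrm E x * nrm E x \<le> nrm (dual E) ?h * nrm E x"
    using dual_bound[OF E h f'(1)] f' g' by simp
  then show "nrm E x \<le> nrm (dual E) ?h"
    using normed_nonneg[OF E f'(1)] dual_nrm_nonneg[OF E h]
    by (cases "nrm E x = 0") (auto simp: mult_le_cancel_right)
qed

lemma duality_op_eq:
  assumes "normed_space E" "strictly_convex_space (dual E)" "f \<in> duality_map E x"
  shows "duality_op E x = f"
  unfolding duality_op_def using assms duality_map_unique by blast

lemma duality_op_in:
  assumes "normed_space E" "strictly_convex_space (dual E)" "x \<in> carr E"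
  shows "duality_op E x \<in> duality_map E x"
  using norming_functional[OF assms(1,3)] duality_op_eq[OF assms(1,2)] by blast

text \<open>Rescaled to the norm of x, such a functional is a conjugate of x, and there is only one.\<close>

lemma aligned_eq_duality_op:
  assumes E: "normed_space E" and sc: "strictly_convex_space (dual E)"
    and f: "f \<in> carr (dual E)" and x: "x \<in> carr E" "nrm E x \<noteq> 0"
    and al: "f x = nrm (dual E) f * nrm E x"
  shows "f = (nrm (dual E) f / nrm E x) *\<^sub>R duality_op E x"
proof (cases "nrm (dual E) f = 0")
  case True
  then show ?thesis using normed_eq_0[OF normed_dual[OF E] f] by simp
next
  case False
  let ?c = "nrm E x / nrm (dual E) f"
  have c: "?c > 0" using False x normed_nonneg[OF E x(1)] dual_nrm_nonneg[OF E f] by simp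
  have "?c *\<^sub>R f \<in> duality_map E x"
    using f x c False al normed_nonneg[OF E x(1)] dual_nrm_nonneg[OF E f]
    by (simp add: duality_map_def conjugates_def subspace_scale[OF subspace_dual[OF E]]
        normed_scale[OF normed_dual[OF E] f])
  then have "duality_op E x = ?c *\<^sub>R f" by (rule duality_op_eq[OF E sc])
  then show ?thesis using False x by simp
qed

section \<open>Hilbert duals\<close>

text \<open>This extracts the first-order condition from an extremal problem with quadratic
  constraint.\<close>

lemma linear_le_quadratic:
  fixes A B :: real
  assumes "\<And>t. t * A \<le> t\<^sup>2 * B"
  shows "A = 0"
proof (rule ccontr)
  assume A: "A \<noteq> 0"
  define q where "q = \<bar>B\<bar> + 1"
  have q: "q > 0" "B < q" by (auto simp: q_def)
  have "(A / q) * A \<le> (A / q)\<^sup>2 * B" by (rule assms)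
  then have "(A / q) * A * q\<^sup>2 \<le> (A / q)\<^sup>2 * B * q\<^sup>2" by (rule mult_right_mono) simp
  then have "A\<^sup>2 * q \<le> A\<^sup>2 * B" using q by (simp add: power2_eq_square field_simps)
  then show False using A q by simp
qed

text \<open>Only the dual is given as a Hilbert space. That the space itself carries an inner
  product is part of what follows: it is obtained by pulling back the one of the dual along the
  duality operator.\<close>

locale hilbert_dual =
  fixes E :: "'a::real_vector nspace" and ip
  assumes E: "normed_space E" and ip: "inner_product_on (carr (dual E)) ip"
    and nrm_ip: "\<And>f. f \<in> carr (dual E) \<Longrightarrow> nrm (dual E) f = sqrt (ip f f)"
begin

abbreviation "V \<equiv> carr (dual E)"
abbreviation "J \<equiv> duality_op E"

lemma sub: "subspace V" by (rule subspace_dual[OF E])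

lemmas ip_props = ip[unfolded inner_product_on_def]
lemmas ip_sym = ip_props[THEN conjunct1, rule_format]
lemmas ip_add = ip_props[THEN conjunct2, THEN conjunct1, rule_format]
lemmas ip_scale = ip_props[THEN conjunct2, THEN conjunct2, THEN conjunct1, rule_format]
lemmas ip_pos = ip_props[THEN conjunct2, THEN conjunct2, THEN conjunct2, rule_format]
lemmas ip_nonneg = ip_pos[THEN conjunct1]
lemmas ip_eq_0 = ip_pos[THEN conjunct2]

lemma ip_add_right: "f \<in> V \<Longrightarrow> g \<in> V \<Longrightarrow> h \<in> V \<Longrightarrow> ip h (f + g) = ip h f + ip h g"
  using ip_add[of f g h] ip_sym[of h "f + g"] ip_sym[of h f] ip_sym[of h g] subspace_add[OF sub, of f g] by simp

lemma ip_scale_right: "f \<in> V \<Longrightarrow> g \<in> V \<Longrightarrow> ip g (c *\<^sub>R f) = c * ip g f"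
  using ip_scale[of f g c] ip_sym[of g "c *\<^sub>R f"] ip_sym[of g f] subspace_scale[OF sub, of f c] by simp

lemma nrm_sq: "f \<in> V \<Longrightarrow> (nrm (dual E) f)\<^sup>2 = ip f f"
  by (simp add: nrm_ip ip_nonneg)

lemma ip_expand:
  assumes "f \<in> V" "g \<in> V"
  shows "ip (s *\<^sub>R f + t *\<^sub>R g) (s *\<^sub>R f + t *\<^sub>R g) = s\<^sup>2 * ip f f + 2 * s * t * ip f g + t\<^sup>2 * ip g g"
  using assms ip_sym[of g f]
  by (simp add: ip_add ip_add_right ip_scale ip_scale_right subspace_scale[OF sub] subspace_add[OF sub]
      power2_eq_square algebra_simps)

lemma strictly_convex: "strictly_convex_space (dual E)"
  unfolding strictly_convex_space_def
proof (intro ballI impI, elim conjE)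
  fix f g and t :: real
  assume f: "f \<in> V" and g: "g \<in> V" and t: "t \<in> {0<..<1}"
    and n: "nrm (dual E) f = 1" "nrm (dual E) g = 1" and ne: "f \<noteq> g"
  have 1: "ip f f = 1" "ip g g = 1" using nrm_sq[OF f] nrm_sq[OF g] n by simp_all
  have d: "f - g \<in> V" using subspace_diff[OF sub f g] .
  have "0 < ip (f - g) (f - g)" using ip_nonneg[OF d] ip_eq_0[OF d] ne by simp
  then have "ip f g < 1" using ip_expand[OF f g, of 1 "-1"] 1 by simp
  then have "t * (1 - t) * ip f g < t * (1 - t) * 1"
    using t by (intro mult_strict_left_mono) auto
  then have "ip (t *\<^sub>R f + (1 - t) *\<^sub>R g) (t *\<^sub>R f + (1 - t) *\<^sub>R g) < t\<^sup>2 + 2 * t * (1 - t) + (1 - t)\<^sup>2"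
    using ip_expand[OF f g, of t "1 - t"] 1 by (simp add: mult.assoc)
  also have "\<dots> = 1" by (simp add: power2_eq_square algebra_simps)
  finally show "nrm (dual E) (t *\<^sub>R f + (1 - t) *\<^sub>R g) < 1"
    using f g by (subst nrm_ip) (auto intro: subspace_add[OF sub] subspace_scale[OF sub])
qed

lemma J_facts:
  assumes "x \<in> carr E"
  shows "J x \<in> V" "nrm (dual E) (J x) = nrm E x" "J x x = nrm E x * nrm E x"
  using duality_op_in[OF E strictly_convex assms] by (simp_all add: duality_map_def conjugates_def)

text \<open>The functional \<open>J x\<close> maximises the evaluation at x relative to the norm.
  The first variation of this extremal problem says that \<open>J x\<close> represents the
  evaluation at x.\<close>

lemma eval_eq_ip:
  assumes x: "x \<in> carr E" and h: "h \<in> V"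
  shows "h x = ip (J x) h"
proof (cases "nrm E x = 0")
  case True
  then have "x = 0" "J x = 0"
    using normed_eq_0[OF E x] normed_eq_0[OF normed_dual[OF E] J_facts(1)[OF x]] J_facts(2)[OF x] by simp_all
  then show ?thesis using ip_scale[OF h h, of 0] dual_zero[OF E h] by simp
next
  case False
  define s where "s = nrm E x"
  let ?g = "J x"
  have g: "?g \<in> V" "ip ?g ?g = s\<^sup>2" "?g x = s\<^sup>2"
    using J_facts[OF x] nrm_sq[of ?g] by (simp_all add: s_def power2_eq_square)
  have "t * (2 * s\<^sup>2 * (h x - ip ?g h)) \<le> t\<^sup>2 * (s\<^sup>2 * ip h h - (h x)\<^sup>2)" for t
  proof -
    let ?k = "1 *\<^sub>R ?g + t *\<^sub>R h"
    have k: "?k \<in> V" using g(1) h by (intro subspace_add[OF sub] subspace_scale[OF sub])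
    have "\<bar>?k x\<bar>\<^sup>2 \<le> (nrm (dual E) ?k * s)\<^sup>2"
      using dual_bound[OF E k x] by (intro power_mono) (auto simp: s_def)
    then have "(s\<^sup>2 + t * h x)\<^sup>2 \<le> (s\<^sup>2 + 2 * t * ip ?g h + t\<^sup>2 * ip h h) * s\<^sup>2"
      using ip_expand[OF g(1) h, of 1 t] nrm_sq[OF k] g by (simp add: power_mult_distrib)
    then show ?thesis by (simp add: power2_eq_square algebra_simps)
  qed
  then have "2 * s\<^sup>2 * (h x - ip ?g h) = 0" by (rule linear_le_quadratic)
  then show ?thesis using False by (simp add: s_def)
qed

lemma represent_unique:
  assumes f: "f \<in> V" and x: "x \<in> carr E" and eq: "\<And>h. h \<in> V \<Longrightarrow> ip f h = h x"
  shows "J x = f"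
proof -
  let ?d = "1 *\<^sub>R J x + (- 1) *\<^sub>R f"
  have d: "?d \<in> V" using J_facts(1)[OF x] f by (intro subspace_add[OF sub] subspace_scale[OF sub])
  have "ip ?d ?d = 1 * ip (J x) ?d + (- 1) * ip f ?d"
    using ip_add[of "1 *\<^sub>R J x" "(- 1) *\<^sub>R f" ?d] ip_scale[of "J x" ?d 1] ip_scale[of f ?d "-1"]
      J_facts(1)[OF x] f d subspace_scale[OF sub] by (simp only:)
  also have "\<dots> = 0" using eval_eq_ip[OF x d] eq[OF d] by simp
  finally show ?thesis using ip_eq_0[OF d] by simp
qed

lemma J_add: "x \<in> carr E \<Longrightarrow> y \<in> carr E \<Longrightarrow> J (x + y) = J x + J y"
  using J_facts(1) subspace_add[OF sub] subspace_add[OF normed_subspace[OF E]]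
  by (intro represent_unique) (auto simp: ip_add dual_add eval_eq_ip[symmetric])

lemma J_scale: "x \<in> carr E \<Longrightarrow> J (c *\<^sub>R x) = c *\<^sub>R J x"
  using J_facts(1) subspace_scale[OF sub] subspace_scale[OF normed_subspace[OF E]]
  by (intro represent_unique) (auto simp: ip_scale dual_scale eval_eq_ip[symmetric])

lemma J_sum:
  assumes "finite I" "\<And>i. i \<in> I \<Longrightarrow> x i \<in> carr E"
  shows "(\<Sum>i\<in>I. c i *\<^sub>R x i) \<in> carr E \<and> J (\<Sum>i\<in>I. c i *\<^sub>R x i) = (\<Sum>i\<in>I. c i *\<^sub>R J (x i))"
  using assms
proof induction
  case empty
  have "J 0 = 0" using J_scale[OF normed_zero_mem[OF E], of 0] by simp
  then show ?case by (simp add: normed_zero_mem[OF E])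
next
  case (insert i I)
  then show ?case
    using normed_subspace[OF E] by (simp add: J_add J_scale subspace_add subspace_scale)
qed

lemma riesz: "is_riesz_map E J"
  unfolding is_riesz_map_def
proof (intro exI[of _ "\<lambda>x z. ip (J x) (J z)"] conjI ballI)
  have sq: "ip (J x) (J x) = (nrm E x)\<^sup>2" if "x \<in> carr E" for x
    using nrm_sq[OF J_facts(1)[OF that]] J_facts(2)[OF that] by simp
  show "inner_product_on (carr E) (\<lambda>x z. ip (J x) (J z))"
    unfolding inner_product_on_def
    by (intro conjI ballI allI) (simp_all add: ip_sym J_facts(1) J_add J_scale ip_add ip_scale sq normed_eq_0[OF E])
  show "nrm E x = sqrt (ip (J x) (J x))" if "x \<in> carr E" for x
    using sq[OF that] normed_nonneg[OF E that] by simp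
  fix x assume x: "x \<in> carr E"
  show "J x = (\<lambda>z. if z \<in> carr E then ip (J x) (J z) else 0)"
  proof
    fix z
    show "J x z = (if z \<in> carr E then ip (J x) (J z) else 0)"
      using eval_eq_ip[of z "J x"] J_facts(1)[OF x] J_facts(1)[of z] ip_sym[of "J x" "J z"]
        dual_outside[OF J_facts(1)[OF x], of z] by auto
  qed
qed

end

lemma hilbert_dualI:
  assumes "normed_space E" "hilbert_space (dual E)"
  obtains ip where "hilbert_dual E ip"
  using assms unfolding hilbert_space_def hilbert_dual_def by blast

section \<open>Components of conjugate pairs\<close>

text \<open>This makes the scaling constants positive. If \<open>s $ n\<close> vanished for a
  strictly convex dual norm, deleting the component \<open>y $ n\<close> would not change the
  pairing with s, hence not the norm either, as it cannot drop below the value that the pairing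
  forces. The midpoint of both vectors then contradicts strict convexity. For the 1-norm, s is
  bounded by the norm of y in every component, and equality in the pairing forces the bound to be
  attained on the support of y.\<close>

lemma conjugate_support:
  fixes Z :: "(real^'n) nspace"
  assumes Z: "normed_space Z" and U: "carr Z = UNIV" and A: "absolute_norm Z"
    and conj: "conjugates (vec_dual Z) Z (\<bullet>) y s"
    and strict: "strictly_convex_space (vec_dual Z) \<or> (\<forall>z. nrm (vec_dual Z) z = (\<Sum>n\<in>UNIV. \<bar>z $ n\<bar>))"
    and pos: "\<And>n. 0 \<le> y $ n" and yn: "y $ n \<noteq> 0"
  shows "s $ n \<noteq> 0"
  using strict
proof
  have c: "nrm Z s = nrm (vec_dual Z) y" "y \<bullet> s = nrm (vec_dual Z) y * nrm (vec_dual Z) y"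
    using conj by (simp_all add: conjugates_def)
  let ?r = "nrm (vec_dual Z) y"
  note Z' = normed_vec_dual[OF Z U]
  have r: "?r > 0"
    using normed_nonneg[OF Z', of y] normed_eq_0[OF Z', of y] yn by (auto simp: less_le)
  {
    assume sc: "strictly_convex_space (vec_dual Z)"
    show "s $ n \<noteq> 0"
    proof
      assume s0: "s $ n = 0"
      define y' where "y' = y - y $ n *\<^sub>R axis n 1"
      have ys: "y' \<bullet> s = ?r * ?r"
        by (simp add: y'_def inner_diff_left inner_axis' s0 c(2))
      have large: "?r \<le> nrm (vec_dual Z) v" if "v \<bullet> s = ?r * ?r" for v
      proof -
        have "?r * ?r \<le> nrm (vec_dual Z) v * ?r" using vec_dual_bound[OF Z U, of v s] that c(1) r by simp
        then show ?thesis using r by simp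
      qed
      have "nrm (vec_dual Z) y' \<le> ?r"
        by (rule absolute_norm_mono[OF Z' vec_dual_carr absolute_norm_vec_dual[OF Z U A]])
          (simp add: y'_def axis_def)
      then have "nrm (vec_dual Z) y' = ?r" using large[OF ys] by simp
      moreover have "?r \<le> nrm (vec_dual Z) ((1/2) *\<^sub>R y + (1/2) *\<^sub>R y')"
        by (rule large) (simp add: inner_add_left ys c(2))
      ultimately have "y = y'" using strictly_convex_mid[OF Z' sc, of y ?r y'] by simp
      then have "y $ n = y' $ n" by simp
      then show False using yn by (simp add: y'_def axis_def)
    qed
  next
    assume n1: "\<forall>z. nrm (vec_dual Z) z = (\<Sum>n\<in>UNIV. \<bar>z $ n\<bar>)"
    have rsum: "?r = (\<Sum>n\<in>UNIV. y $ n)" using n1 pos by simp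
    have sle: "s $ k \<le> ?r" for k
    proof -
      have "nrm (vec_dual Z) (axis k 1) = 1" using n1 by (simp add: axis_def if_distrib cong: if_cong)
      then show ?thesis using vec_dual_bound[OF Z U, of "axis k 1" s] c(1) by (simp add: inner_axis')
    qed
    have "(\<Sum>k\<in>UNIV. y $ k * (?r - s $ k)) = ?r * ?r - y \<bullet> s"
      by (simp add: inner_vec_def right_diff_distrib sum_subtractf sum_distrib_right[symmetric] rsum[symmetric])
    also have "\<dots> = 0" using c(2) by simp
    finally have "\<forall>k\<in>UNIV. y $ k * (?r - s $ k) = 0"
      by (subst (asm) sum_nonneg_eq_0_iff) (use pos sle in auto)
    then have "s $ n = ?r" using yn by auto
    then show "s $ n \<noteq> 0" using r by simp
  }
qed

context product_space
begin

text \<open>The chain of inequalities from the pairing over the vectors of component norms to the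
  product of the norms consists of equalities, since its ends agree.\<close>

lemma conjugate_components:
  assumes w: "w \<in> carr PX" and f: "f \<in> carr PX'"
    and eq: "nrm PX' f = nrm PX w" "pairing w f = nrm PX w * nrm PX w"
  defines "y \<equiv> (\<chi> n. nrm (X' n) (f $ n))" and "s \<equiv> (\<chi> n. nrm (X n) (w $ n))"
  shows "conjugates Z' Z (\<bullet>) y s" and "(f $ n) (w $ n) = y $ n * s $ n"
proof -
  have fn: "f $ n \<in> carr (X' n)" and wn: "w $ n \<in> carr (X n)" for n using f w by simp_all
  have nr: "nrm Z' y = nrm PX w" "nrm Z s = nrm PX w" using eq by (simp_all add: product_nrm y_def s_def)
  have lo: "pairing w f \<le> y \<bullet> s" using pairing_le_inner[OF f w] by (simp add: y_def s_def)
  have hi: "y \<bullet> s \<le> nrm PX w * nrm PX w" using vec_dual_bound[OF normed_Z carr_Z, of y s] nr by simp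
  have ys: "y \<bullet> s = nrm PX w * nrm PX w" using lo hi eq(2) by simp
  show "conjugates Z' Z (\<bullet>) y s" using ys nr by (simp add: conjugates_def carr_Z)
  have "(\<Sum>n\<in>UNIV. y $ n * s $ n - (f $ n) (w $ n)) = y \<bullet> s - pairing w f"
    by (simp add: inner_vec_def pairing_def sum_subtractf)
  also have "\<dots> = 0" using ys eq(2) by simp
  finally have "\<forall>n\<in>UNIV. y $ n * s $ n - (f $ n) (w $ n) = 0"
    by (subst (asm) sum_nonneg_eq_0_iff)
      (auto simp: y_def s_def intro: order_trans[OF abs_ge_self dual_bound[OF normed_X fn wn]])
  then show "(f $ n) (w $ n) = y $ n * s $ n" by simp
qed

lemma conjugate_component_formula:
  assumes w: "w \<in> carr PX" and f: "f \<in> carr PX'"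
    and eq: "nrm PX' f = nrm PX w" "pairing w f = nrm PX w * nrm PX w"
    and strict: "strictly_convex_space Z' \<or> (\<forall>z. nrm Z' z = (\<Sum>n\<in>UNIV. \<bar>z $ n\<bar>))"
  defines "y \<equiv> (\<chi> n. nrm (X' n) (f $ n))" and "s \<equiv> (\<chi> n. nrm (X n) (w $ n))"
  shows "y $ n \<noteq> 0 \<Longrightarrow> scaling y s n > 0"
    and "strictly_convex_space (X' n) \<Longrightarrow> f $ n = scaling y s n *\<^sub>R duality_op (X n) (w $ n)"
proof -
  have fn: "f $ n \<in> carr (X' n)" and wn: "w $ n \<in> carr (X n)" using f w by simp_all
  have y0: "0 \<le> y $ n" for n using f by (simp add: y_def dual_nrm_nonneg[OF normed_X])
  have s0: "0 \<le> s $ n" using wn by (simp add: s_def normed_nonneg[OF normed_X])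
  note cc = conjugate_components[OF w f eq, folded y_def s_def]
  have sn: "s $ n \<noteq> 0" if "y $ n \<noteq> 0"
    by (rule conjugate_support[OF normed_Z carr_Z absolute_Z cc(1) strict y0 that])
  show "scaling y s n > 0" if "y $ n \<noteq> 0"
    using that sn[OF that] y0[of n] s0 by (simp add: scaling_def less_le)
  assume sc: "strictly_convex_space (X' n)"
  show "f $ n = scaling y s n *\<^sub>R duality_op (X n) (w $ n)"
  proof (cases "y $ n = 0")
    case True
    then show ?thesis using normed_eq_0[OF normed_X' fn] by (simp add: y_def scaling_def)
  next
    case False
    then have "nrm (X n) (w $ n) \<noteq> 0" using sn by (simp add: s_def)
    then show ?thesis
      using aligned_eq_duality_op[OF normed_X sc fn wn] cc(2)[of n] False
      by (simp add: scaling_def y_def s_def)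
  qed
qed

text \<open>The mean of two elements has the same norm, so the mean of their vectors of component
  norms cannot have a smaller one. Strict convexity forces these vectors to coincide, and by the
  same argument the components in a strictly convex factor.\<close>

lemma component_unique:
  assumes S: "convex S" "S \<subseteq> carr PX'" "\<And>f. f \<in> S \<Longrightarrow> nrm PX' f = r"
    and scZ: "strictly_convex_space Z'" and sc: "strictly_convex_space (X' n)"
    and f: "f \<in> S" and g: "g \<in> S"
  shows "f $ n = g $ n"
proof -
  define y where "y f = (\<chi> n. nrm (X' n) (f $ n))" for f :: "('a \<Rightarrow> real)^'n"
  have ny: "nrm Z' (y f) = r" if "f \<in> S" for f using S(3)[OF that] by (simp add: product_nrm y_def)
  define mid where "mid f g = (1/2) *\<^sub>R f + (1/2) *\<^sub>R g" for f g :: "('a \<Rightarrow> real)^'n"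
  have midS: "mid f g \<in> S" if "f \<in> S" "g \<in> S" for f g
    unfolding mid_def using that by (intro convexD[OF S(1)]) auto
  have yeq: "y f = y g" if f: "f \<in> S" and g: "g \<in> S" for f g
  proof (rule strictly_convex_mid[OF normed_Z' scZ _ ny[OF f] _ ny[OF g]])
    have fn: "f $ n \<in> carr (X' n)" "g $ n \<in> carr (X' n)" for n using S(2) f g by auto
    have "nrm Z' (y (mid f g)) \<le> nrm Z' ((1/2) *\<^sub>R y f + (1/2) *\<^sub>R y g)"
    proof (rule absolute_norm_mono[OF normed_Z' vec_dual_carr absolute_Z'])
      fix n
      have m: "mid f g $ n \<in> carr (X' n)" using midS[OF f g] S(2) by auto
      have "nrm (X' n) (mid f g $ n) \<le> 1/2 * nrm (X' n) (f $ n) + 1/2 * nrm (X' n) (g $ n)"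
        using normed_triangle[OF normed_X', of "(1/2) *\<^sub>R f $ n" n "(1/2) *\<^sub>R g $ n"] fn[of n]
        by (simp add: mid_def normed_scale[OF normed_X'] subspace_scale[OF subspace_dual[OF normed_X]])
      then show "\<bar>y (mid f g) $ n\<bar> \<le> \<bar>((1/2) *\<^sub>R y f + (1/2) *\<^sub>R y g) $ n\<bar>"
        using dual_nrm_nonneg[OF normed_X m] by (simp add: y_def)
    qed
    then show "r \<le> nrm Z' ((1/2) *\<^sub>R y f + (1/2) *\<^sub>R y g)" using ny[OF midS[OF f g]] by simp
  qed simp_all
  have fn: "f $ n \<in> carr (X' n)" "g $ n \<in> carr (X' n)" using S(2) f g by auto
  show ?thesis
  proof (rule strictly_convex_mid[OF normed_X' sc fn(1) refl fn(2)])
    show "nrm (X' n) (g $ n) = nrm (X' n) (f $ n)"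
      using yeq[OF g f] by (simp add: y_def vec_eq_iff)
    have "y f $ n = y (mid f g) $ n" using yeq[OF f midS[OF f g]] by simp
    then show "nrm (X' n) (f $ n) \<le> nrm (X' n) ((1/2) *\<^sub>R f $ n + (1/2) *\<^sub>R g $ n)"
      by (simp add: y_def mid_def)
  qed
qed

end

section \<open>Weak* compactness\<close>

text \<open>The ball is cut out of a compact box by the closed conditions of linearity.\<close>

theorem banach_alaoglu:
  fixes E :: "'a::real_vector nspace"
  assumes E: "normed_space E"
  shows "compact {f \<in> carr (dual E). nrm (dual E) f \<le> r}"
proof (cases "0 \<le> r")
  case False
  then have "{f \<in> carr (dual E). nrm (dual E) f \<le> r} = {}"
    using dual_nrm_nonneg[OF E] by fastforce
  then show ?thesis by (simp only: compact_empty)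
next
  case True
  define B where "B x = (if x \<in> carr E then {- (r * nrm E x)..r * nrm E x} else {0})" for x
  define A where "A = (\<Inter>x\<in>carr E. \<Inter>y\<in>carr E. {f :: 'a \<Rightarrow> real. f (x + y) = f x + f y})"
  define C where "C = (\<Inter>c. \<Inter>x\<in>carr E. {f :: 'a \<Rightarrow> real. f (c *\<^sub>R x) = c * f x})"
  have "{f \<in> carr (dual E). nrm (dual E) f \<le> r} = {f. \<forall>x. f x \<in> B x} \<inter> (A \<inter> C)"
  proof (intro equalityI subsetI)
    fix f assume "f \<in> {f \<in> carr (dual E). nrm (dual E) f \<le> r}"
    then have f: "f \<in> carr (dual E)" and "\<forall>x\<in>carr E. \<bar>f x\<bar> \<le> r * nrm E x"
      using dual_nrm_le_iff[OF E _ True] by auto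
    then show "f \<in> {f. \<forall>x. f x \<in> B x} \<inter> (A \<inter> C)"
      by (auto simp: B_def A_def C_def dual_add[OF f] dual_scale[OF f] dual_outside[OF f] abs_le_iff)
  next
    fix f assume f: "f \<in> {f. \<forall>x. f x \<in> B x} \<inter> (A \<inter> C)"
    have bd: "\<bar>f x\<bar> \<le> r * nrm E x" if "x \<in> carr E" for x
    proof -
      have "f x \<in> B x" using f by blast
      then show ?thesis using that by (simp add: B_def abs_le_iff)
    qed
    have "f x = 0" if "x \<notin> carr E" for x
    proof -
      have "f x \<in> B x" using f by blast
      then show ?thesis using that by (simp add: B_def)
    qed
    then have "f \<in> carr (dual E)"
      using f by (intro dual_carrI[OF _ _ bd]) (auto simp: A_def C_def)
    then show "f \<in> {f \<in> carr (dual E). nrm (dual E) f \<le> r}"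
      using bd by (simp add: dual_nrm_le_iff[OF E _ True])
  qed
  moreover have "compact {f. \<forall>x. f x \<in> B x}" by (rule compact_fun_box) (simp add: B_def)
  moreover have "closed (A \<inter> C)"
    unfolding A_def C_def
    by (intro closed_Int closed_INT ballI closed_Collect_eq continuous_intros continuous_on_product_coordinates)
  ultimately show ?thesis by (simp add: compact_Int_closed)
qed

lemma dual_unit_ball_extreme_point:
  assumes E: "normed_space E"
  shows "\<exists>e. e extreme_point_of unit_ball (dual E)"
proof (rule extreme_point_exists_fun)
  note D = normed_dual[OF E]
  show "compact (unit_ball (dual E))" using banach_alaoglu[OF E, of 1] by (simp add: unit_ball_def)
  show "unit_ball (dual E) \<noteq> {}"
    using normed_zero_mem[OF D] normed_zero[OF D] by (force simp: unit_ball_def)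
  show "convex (unit_ball (dual E))"
  proof (rule convexI)
    fix f g and u v :: real
    assume fg: "f \<in> unit_ball (dual E)" "g \<in> unit_ball (dual E)" and uv: "0 \<le> u" "0 \<le> v" "u + v = 1"
    have "nrm (dual E) (u *\<^sub>R f + v *\<^sub>R g) \<le> u * nrm (dual E) f + v * nrm (dual E) g"
      using normed_triangle[OF D, of "u *\<^sub>R f" "v *\<^sub>R g"] fg uv normed_subspace[OF D]
      by (simp add: unit_ball_def normed_scale[OF D] subspace_scale)
    also have "\<dots> \<le> 1" using fg uv by (intro convex_bound_le) (auto simp: unit_ball_def)
    finally show "u *\<^sub>R f + v *\<^sub>R g \<in> unit_ball (dual E)"
      using fg normed_subspace[OF D] by (simp add: unit_ball_def subspace_add subspace_scale)
  qed
qed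

context product_space
begin

definition dual_ball :: "real \<Rightarrow> (('a \<Rightarrow> real)^'n) set" where
  "dual_ball r = {f \<in> carr PX'. nrm PX' f \<le> r}"

text \<open>The isometry of the product of the duals onto the dual of the product. Through it the
  compactness of balls in the dual of the product, as sets of functions, becomes available for
  tuples.\<close>

definition emb :: "('a \<Rightarrow> real)^'n \<Rightarrow> 'a^'n \<Rightarrow> real" where
  "emb f x = (if x \<in> carr PX then pairing x f else 0)"

lemma linear_emb: "linear emb"
  by (rule linearI) (auto simp: fun_eq_iff emb_def pairing_add pairing_scale)

lemma convex_dual_ball: "convex (dual_ball r)"
proof (rule convexI)
  fix f g and u v :: real
  assume fg: "f \<in> dual_ball r" "g \<in> dual_ball r" and uv: "0 \<le> u" "0 \<le> v" "u + v = 1"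
  then have c: "f \<in> carr PX'" "g \<in> carr PX'" "nrm PX' f \<le> r" "nrm PX' g \<le> r"
    by (auto simp: dual_ball_def simp del: product_carr_iff)
  note sub = normed_subspace[OF normed_PX']
  have "nrm PX' (u *\<^sub>R f + v *\<^sub>R g) \<le> u * nrm PX' f + v * nrm PX' g"
    using normed_triangle[OF normed_PX' subspace_scale[OF sub c(1)] subspace_scale[OF sub c(2)], of u v] uv
    by (simp add: normed_scale[OF normed_PX' c(1)] normed_scale[OF normed_PX' c(2)])
  also have "\<dots> \<le> r" by (rule convex_bound_le[OF c(3,4) uv])
  finally show "u *\<^sub>R f + v *\<^sub>R g \<in> dual_ball r"
    using subspace_add[OF sub subspace_scale[OF sub c(1)] subspace_scale[OF sub c(2)]]
    by (simp add: dual_ball_def del: product_carr_iff)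
qed

lemma emb_dual:
  assumes f: "f \<in> carr PX'"
  shows "emb f \<in> carr (dual PX)" and "0 \<le> r \<Longrightarrow> nrm (dual PX) (emb f) \<le> r \<longleftrightarrow> nrm PX' f \<le> r"
proof -
  note sub = normed_subspace[OF normed_PX]
  show *: "emb f \<in> carr (dual PX)"
  proof (rule dual_carrI)
    fix x assume x: "x \<in> carr PX"
    show "\<bar>emb f x\<bar> \<le> nrm PX' f * nrm PX x" using pairing_le[OF f x] x by (simp add: emb_def)
  qed (auto simp: emb_def pairing_add_left[OF f] pairing_scale_left[OF f] subspace_add[OF sub] subspace_scale[OF sub]
      simp del: product_carr_iff)
  show "nrm (dual PX) (emb f) \<le> r \<longleftrightarrow> nrm PX' f \<le> r" if "0 \<le> r"
    using that
    by (simp add: dual_nrm_le_iff[OF normed_PX *] product_dual_nrm_le_iff[OF f] emb_def del: product_carr_iff)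
qed

lemma emb_axis:
  assumes f: "f \<in> carr PX'" and x: "x \<in> carr (X n)"
  shows "emb f (axis n x) = (f $ n) x"
proof -
  have fn: "f $ n \<in> carr (X' n)" for n using f by simp
  have "(f $ i) (axis n x $ i) = (if i = n then (f $ n) x else 0)" for i
    using dual_zero[OF normed_X fn] by (simp add: axis_def)
  then have "pairing (axis n x) f = (\<Sum>i\<in>UNIV. if i = n then (f $ n) x else 0)"
    unfolding pairing_def by (intro sum.cong) auto
  then show ?thesis using axis_in_PX[OF x] by (simp add: emb_def del: product_carr_iff)
qed

lemma component_eq_emb:
  assumes f: "f \<in> carr PX'"
  shows "f $ n = (\<lambda>x. if x \<in> carr (X n) then emb f (axis n x) else 0)"
  using dual_outside[of "f $ n" "X n"] f by (auto simp: fun_eq_iff emb_axis[OF f])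

lemma inj_on_emb: "inj_on emb (carr PX')"
proof (rule inj_onI)
  fix f g assume "f \<in> carr PX'" "g \<in> carr PX'" "emb f = emb g"
  then show "f = g" by (auto simp: vec_eq_iff component_eq_emb simp del: product_carr_iff)
qed

lemma compact_emb_dual_ball:
  assumes r: "0 \<le> r"
  shows "compact (emb ` dual_ball r)"
proof -
  have "emb ` dual_ball r = {F \<in> carr (dual PX). nrm (dual PX) F \<le> r}"
  proof (intro equalityI subsetI)
    fix F assume "F \<in> emb ` dual_ball r"
    then show "F \<in> {F \<in> carr (dual PX). nrm (dual PX) F \<le> r}"
      using emb_dual r by (auto simp: dual_ball_def simp del: product_carr_iff)
  next
    fix F assume F: "F \<in> {F \<in> carr (dual PX). nrm (dual PX) F \<le> r}"
    then obtain f where f: "f \<in> carr PX'" "\<forall>x\<in>carr PX. pairing x f = F x"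
      using dual_of_product by blast
    have "emb f = F"
      using f(2) dual_outside[of F PX] F by (auto simp: emb_def fun_eq_iff simp del: product_carr_iff)
    then show "F \<in> emb ` dual_ball r"
      using F f(1) emb_dual(2)[OF f(1) r] by (auto simp: dual_ball_def simp del: product_carr_iff)
  qed
  then show ?thesis using banach_alaoglu[OF normed_PX] by simp
qed

lemma extreme_point_exists_emb:
  assumes K: "convex K" "K \<subseteq> carr PX'" "K \<noteq> {}" "compact (emb ` K)"
  shows "\<exists>e. e extreme_point_of K"
proof -
  obtain h where h: "h extreme_point_of (emb ` K)"
    using extreme_point_exists_fun[OF K(4) convex_linear_image[OF linear_emb K(1)]] K(3) by blast
  then obtain e where e: "e \<in> K" "h = emb e" by (auto simp: extreme_point_of_def)
  then show ?thesis
    using extreme_point_of_inj_image[OF linear_emb inj_on_subset[OF inj_on_emb K(2)]] h by blast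
qed

lemma compact_component:
  assumes S: "S \<subseteq> carr PX'" "compact (emb ` S)"
  shows "compact ((\<lambda>f. f $ n) ` S)"
proof -
  let ?c = "\<lambda>h x. if x \<in> carr (X n) then h (axis n x) else (0::real)"
  have "continuous_on (emb ` S) ?c"
  proof (rule continuous_on_coordinatewise_then_product)
    fix x
    show "continuous_on (emb ` S) (\<lambda>h. ?c h x)"
      by (cases "x \<in> carr (X n)")
        (auto intro: continuous_on_subset[OF continuous_on_product_coordinates])
  qed
  then have "compact (?c ` (emb ` S))" by (rule compact_continuous_image[OF _ S(2)])
  moreover have "?c ` (emb ` S) = (\<lambda>f. f $ n) ` S"
    unfolding image_image by (rule image_cong[OF refl]) (use S(1) component_eq_emb in \<open>metis (no_types) subsetD\<close>)
  ultimately show ?thesis by simp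
qed

text \<open>The elements of S with a prescribed extreme component form a compact face of S, and any
  extreme point of this face will do.\<close>

lemma extreme_component_lift:
  assumes S: "convex S" "S \<subseteq> carr PX'" "compact (emb ` S)"
    and g: "g extreme_point_of ((\<lambda>f. f $ n) ` S)"
  shows "\<exists>f0. f0 extreme_point_of S \<and> f0 $ n = g"
proof -
  define K where "K = {f \<in> S. f $ n = g}"
  have gn: "g = f $ n" if "f \<in> K" for f using that by (simp add: K_def)
  have face: "K face_of S"
    unfolding face_of_def
  proof (intro conjI ballI impI)
    show "K \<subseteq> S" by (auto simp: K_def)
    show "convex K"
    proof (rule convexI)
      fix a b and u v :: real
      assume ab: "a \<in> K" "b \<in> K" and uv: "0 \<le> u" "0 \<le> v" "u + v = 1"
      have "(u *\<^sub>R a + v *\<^sub>R b) $ n = (u + v) *\<^sub>R g" using ab by (simp add: K_def scaleR_add_left)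
      then show "u *\<^sub>R a + v *\<^sub>R b \<in> K" using ab uv convexD[OF S(1)] by (simp add: K_def)
    qed
    fix a b f assume a: "a \<in> S" and b: "b \<in> S" and f: "f \<in> K" and seg: "f \<in> open_segment a b"
    obtain u where u: "0 < u" "u < 1" "f = (1 - u) *\<^sub>R a + u *\<^sub>R b" using seg by (auto simp: in_segment)
    have ge: "g = (1 - u) *\<^sub>R a $ n + u *\<^sub>R b $ n" using gn[OF f] u(3) by simp
    have "a $ n = b $ n"
    proof (rule ccontr)
      assume "a $ n \<noteq> b $ n"
      then have "g \<in> open_segment (a $ n) (b $ n)" unfolding in_segment using u ge by blast
      then show False using g a b by (auto simp: extreme_point_of_def)
    qed
    moreover from this have "g = ((1 - u) + u) *\<^sub>R b $ n" unfolding ge scaleR_add_left by simp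
    ultimately show "a \<in> K" "b \<in> K" using a b by (simp_all add: K_def)
  qed
  have KS: "K \<subseteq> carr PX'" using S(2) by (auto simp: K_def)
  obtain f where f: "f \<in> S" "f $ n = g" using g by (auto simp: extreme_point_of_def)
  then have ne: "K \<noteq> {}" and gc: "g \<in> carr (X' n)" using S(2) by (auto simp: K_def)
  have "emb ` K = emb ` S \<inter> (\<Inter>x\<in>carr (X n). {h. h (axis n x) = g x})"
  proof (intro equalityI subsetI)
    fix h assume "h \<in> emb ` K"
    then show "h \<in> emb ` S \<inter> (\<Inter>x\<in>carr (X n). {h. h (axis n x) = g x})"
      using S(2) emb_axis by (auto simp: K_def simp del: product_carr_iff)
  next
    fix h assume h: "h \<in> emb ` S \<inter> (\<Inter>x\<in>carr (X n). {h. h (axis n x) = g x})"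
    then obtain f where f: "f \<in> S" "h = emb f" by blast
    have fc: "f \<in> carr PX'" using f S(2) by blast
    have "f $ n = g"
      using h f(2) dual_outside[OF gc] by (auto simp: component_eq_emb[OF fc] fun_eq_iff)
    then show "h \<in> emb ` K" using f by (auto simp: K_def)
  qed
  moreover have "closed (\<Inter>x\<in>carr (X n). {h :: 'a^'n \<Rightarrow> real. h (axis n x) = g x})"
    by (intro closed_INT ballI closed_Collect_eq continuous_on_product_coordinates continuous_on_const)
  ultimately have "compact (emb ` K)" using S(3) by (simp add: compact_Int_closed)
  then obtain f0 where f0: "f0 extreme_point_of K"
    using extreme_point_exists_emb[OF face_of_imp_convex[OF face] KS ne] by blast
  then show ?thesis using extreme_point_of_face[OF face] gn by blast
qed

section \<open>Extreme points of the unit ball of a product\<close>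

text \<open>If the normalised component were a proper convex combination, exchanging this component
  alone would write the whole tuple as one; the norm of the tuple does not grow because it is
  monotone in the component norms.\<close>

lemma extreme_ball_component:
  assumes e: "e extreme_point_of dual_ball r" and ne: "e $ n \<noteq> 0"
  shows "(1 / nrm (X' n) (e $ n)) *\<^sub>R e $ n extreme_point_of unit_ball (X' n)"
proof -
  have eb: "e \<in> carr PX'" "nrm PX' e \<le> r"
    using e by (auto simp: extreme_point_of_def dual_ball_def simp del: product_carr_iff)
  have en: "e $ k \<in> carr (X' k)" for k using eb(1) by simp
  note D = normed_X'[of n] and sub = normed_subspace[OF normed_X'[of n]]
  define q where "q = nrm (X' n) (e $ n)"
  have q: "q > 0" using normed_nonneg[OF D en] normed_eq_0[OF D en] ne unfolding q_def by (simp add: less_le)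
  show ?thesis
    unfolding extreme_point_of_def q_def[symmetric]
  proof (intro conjI ballI notI)
    show "(1 / q) *\<^sub>R e $ n \<in> unit_ball (X' n)"
      using q by (simp add: unit_ball_def normed_scale[OF D en] subspace_scale[OF sub en] q_def)
    fix a b assume ab: "a \<in> unit_ball (X' n)" "b \<in> unit_ball (X' n)" "(1 / q) *\<^sub>R e $ n \<in> open_segment a b"
    then obtain t where t: "a \<noteq> b" "0 < t" "t < 1" "(1 / q) *\<^sub>R e $ n = (1 - t) *\<^sub>R a + t *\<^sub>R b"
      by (auto simp: in_segment)
    have een: "e $ n = (1 - t) *\<^sub>R (q *\<^sub>R a) + t *\<^sub>R (q *\<^sub>R b)"
    proof -
      have "e $ n = q *\<^sub>R ((1 / q) *\<^sub>R e $ n)" using q by simp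
      then show ?thesis unfolding t(4) by (simp add: scaleR_add_right mult.commute)
    qed
    define swap where "swap v = (\<chi> i. if i = n then q *\<^sub>R v else e $ i)" for v
    have mem: "swap v \<in> dual_ball r" if "v \<in> unit_ball (X' n)" for v
    proof -
      have v: "v \<in> carr (X' n)" "nrm (X' n) v \<le> 1" using that by (auto simp: unit_ball_def)
      have c: "swap v \<in> carr PX'" using v en subspace_scale[OF sub] by (simp add: swap_def)
      have "nrm PX' (swap v) \<le> nrm PX' e"
        unfolding product_nrm
      proof (rule absolute_norm_mono[OF normed_Z' vec_dual_carr absolute_Z'])
        fix i
        have "nrm (X' i) (swap v $ i) \<le> nrm (X' i) (e $ i)"
          using v q by (cases "i = n") (simp_all add: swap_def normed_scale[OF D] q_def[symmetric] mult_left_le)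
        moreover have "0 \<le> nrm (X' i) (swap v $ i)" using c by (simp add: dual_nrm_nonneg[OF normed_X])
        ultimately show "\<bar>(\<chi> n. nrm (X' n) (swap v $ n)) $ i\<bar> \<le> \<bar>(\<chi> n. nrm (X' n) (e $ n)) $ i\<bar>" by simp
      qed
      then show ?thesis using c eb(2) by (simp add: dual_ball_def)
    qed
    have "swap a \<noteq> swap b"
    proof
      assume "swap a = swap b"
      then have "swap a $ n = swap b $ n" by simp
      then show False using t(1) q by (simp add: swap_def)
    qed
    moreover have "e = (1 - t) *\<^sub>R swap a + t *\<^sub>R swap b"
    proof (rule vec_eq_iff[THEN iffD2], rule allI)
      fix i
      show "e $ i = ((1 - t) *\<^sub>R swap a + t *\<^sub>R swap b) $ i"
        using een by (cases "i = n") (simp_all add: swap_def flip: scaleR_add_left)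
    qed
    ultimately have "e \<in> open_segment (swap a) (swap b)" unfolding in_segment using t by blast
    then show False using e mem ab by (auto simp: extreme_point_of_def)
  qed
qed

text \<open>For the 1-norm, mass can be shifted between two nonzero components without changing the
  norm.\<close>

lemma extreme_ball_support:
  assumes n1: "\<forall>z. nrm Z' z = (\<Sum>n\<in>UNIV. \<bar>z $ n\<bar>)"
    and e: "e extreme_point_of dual_ball r" and ij: "e $ i \<noteq> 0" "e $ j \<noteq> 0"
  shows "i = j"
proof (rule ccontr)
  assume neq: "i \<noteq> j"
  have eb: "e \<in> carr PX'" "nrm PX' e \<le> r"
    using e by (auto simp: extreme_point_of_def dual_ball_def simp del: product_carr_iff)
  have en: "e $ k \<in> carr (X' k)" for k using eb(1) by simp
  define y where "y k = nrm (X' k) (e $ k)" for k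
  have y0: "0 \<le> y k" for k by (simp add: y_def dual_nrm_nonneg[OF normed_X en])
  have pos: "0 < y i" "0 < y j"
    using y0[of i] y0[of j] normed_eq_0[OF normed_X' en] ij by (simp_all add: y_def less_le)
  define s where "s = min (y i) (y j)"
  have s: "0 < s" "s \<le> y i" "s \<le> y j" using pos by (auto simp: s_def)
  define c where "c \<sigma> k = (if k = i then 1 + \<sigma> / y i else if k = j then 1 - \<sigma> / y j else 1)" for \<sigma> k
  define sh where "sh \<sigma> = (\<chi> k. c \<sigma> k *\<^sub>R e $ k)" for \<sigma>
  have mem: "sh \<sigma> \<in> dual_ball r" if \<sigma>: "\<bar>\<sigma>\<bar> \<le> s" for \<sigma>
  proof -
    have "sh \<sigma> \<in> carr PX'" using en by (simp add: sh_def subspace_scale[OF subspace_dual[OF normed_X]])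
    moreover have "nrm PX' (sh \<sigma>) = nrm PX' e"
    proof -
      have "\<bar>\<sigma> / y i\<bar> \<le> 1" "\<bar>\<sigma> / y j\<bar> \<le> 1" using \<sigma> s pos by (simp_all add: abs_divide divide_le_eq_1)
      then have c0: "0 \<le> c \<sigma> k" for k unfolding c_def abs_le_iff by simp
      have "nrm PX' (sh \<sigma>) = (\<Sum>k\<in>UNIV. c \<sigma> k * y k)"
        using n1 by (simp add: product_nrm sh_def normed_scale[OF normed_X' en] c0 y0 y_def[symmetric])
      also have "\<dots> = (\<Sum>k\<in>UNIV. y k + (if k = i then \<sigma> else 0) - (if k = j then \<sigma> else 0))"
        using pos neq by (intro sum.cong refl) (auto simp: c_def field_simps)
      also have "\<dots> = (\<Sum>k\<in>UNIV. y k)" by (simp add: sum.distrib sum_subtractf)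
      also have "\<dots> = nrm PX' e" using n1 y0 by (simp add: product_nrm y_def[symmetric])
      finally show ?thesis .
    qed
    ultimately show ?thesis using eb(2) by (simp add: dual_ball_def)
  qed
  have "sh s \<noteq> sh (- s)"
  proof
    assume "sh s = sh (- s)"
    then have "sh s $ i = sh (- s) $ i" by simp
    then have "(1 + s / y i) *\<^sub>R e $ i = (1 - s / y i) *\<^sub>R e $ i" by (simp add: sh_def c_def)
    then have "1 + s / y i = 1 - s / y i" unfolding scaleR_cancel_right using ij(1) by blast
    then have "s / y i = 0" by simp
    then show False using s pos by simp
  qed
  moreover have "e = (1 - 1/2) *\<^sub>R sh s + (1/2) *\<^sub>R sh (- s)"
  proof (rule vec_eq_iff[THEN iffD2], rule allI)
    fix k
    have "c s k + c (- s) k = 2" by (simp add: c_def)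
    then have "(1 - 1/2) * c s k + (1/2) * c (- s) k = 1" by simp
    then have "((1 - 1/2) * c s k + (1/2) * c (- s) k) *\<^sub>R e $ k = e $ k" by simp
    then show "e $ k = ((1 - 1/2) *\<^sub>R sh s + (1/2) *\<^sub>R sh (- s)) $ k"
      by (simp add: sh_def scaleR_add_left)
  qed
  ultimately have "e \<in> open_segment (sh s) (sh (- s))"
    unfolding in_segment by (intro conjI exI[of _ "1/2"]) auto
  then show False using e mem[of s] mem[of "- s"] s by (auto simp: extreme_point_of_def)
qed

end

text \<open>The element \<open>e0\<close> fills the unused places, with weight 0.\<close>

lemma atomic_expansionI:
  assumes A: "finite A" "card A \<le> K" and p: "\<And>x. x \<in> A \<Longrightarrow> p x extreme_point_of unit_ball E"
    and e0: "e0 extreme_point_of unit_ball E" and g: "g = (\<Sum>x\<in>A. c x *\<^sub>R p x)"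
  shows "\<exists>c e. atomic_expansion E K c e g"
proof -
  obtain h where h: "bij_betw h {0..<card A} A" using ex_bij_betw_nat_finite[OF A(1)] by blast
  have hA: "h k \<in> A" if "k < card A" for k using h that by (auto simp: bij_betw_def)
  let ?c = "\<lambda>k. if k < card A then c (h k) else 0" and ?e = "\<lambda>k. if k < card A then p (h k) else e0"
  have "g = (\<Sum>k\<in>{0..<card A}. c (h k) *\<^sub>R p (h k))"
    unfolding g by (rule sum.reindex_bij_betw[OF h, symmetric])
  also have "\<dots> = (\<Sum>k<card A. ?c k *\<^sub>R ?e k)" by (simp add: atLeast0LessThan)
  also have "\<dots> = (\<Sum>k<K. ?c k *\<^sub>R ?e k)" using A(2) by (intro sum.mono_neutral_left) auto
  finally have "atomic_expansion E K ?c ?e g"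
    unfolding atomic_expansion_def using p hA e0 by auto
  then show ?thesis by blast
qed

section \<open>Structure of the sublevel sets of the interpolation problem\<close>

context interpolation
begin

lemma sublevel_eq: "sublevel z r = {f \<in> dual_ball r. meas f = z}"
  by (auto simp: sublevel_def dual_ball_def)

lemma sublevel_subset: "sublevel z r \<subseteq> carr PX'"
  by (auto simp: sublevel_def)

lemma convex_sublevel: "convex (sublevel z r)"
proof -
  have "convex (meas -` {z})" by (rule convex_linear_vimage[OF linear_meas convex_singleton])
  moreover have "sublevel z r = dual_ball r \<inter> meas -` {z}" by (auto simp: sublevel_eq)
  ultimately show ?thesis using convex_dual_ball by (simp add: convex_Int)
qed

lemma compact_sublevel:
  assumes r: "0 \<le> r"
  shows "compact (emb ` sublevel z r)"
proof -
  have m: "emb f (\<nu> m) = meas f $ m" for f m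
    using \<nu>_carr by (simp add: emb_def meas_def)
  have "emb ` sublevel z r = emb ` dual_ball r \<inter> (\<Inter>m. {h. h (\<nu> m) = z $ m})"
    unfolding sublevel_eq by (auto simp: m vec_eq_iff)
  moreover have "closed (\<Inter>m. {h :: 'a^'n \<Rightarrow> real. h (\<nu> m) = z $ m})"
    by (intro closed_INT ballI closed_Collect_eq continuous_on_product_coordinates continuous_on_const)
  ultimately show ?thesis using compact_emb_dual_ball[OF r] by (simp add: compact_Int_closed)
qed

lemma component_krein_milman:
  fixes z :: "real^'m" and n :: 'n
  assumes r: "0 \<le> r"
  defines "C \<equiv> (\<lambda>f. f $ n) ` sublevel z r"
  shows "C = weak_star (X n) closure_of (convex hull {g. g extreme_point_of C})"
proof -
  have C: "compact C" unfolding C_def by (rule compact_component[OF sublevel_subset compact_sublevel[OF r]])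
  have "linear (\<lambda>f :: ('a \<Rightarrow> real)^'n. f $ n)" by (rule linearI) simp_all
  then have conv: "convex C" unfolding C_def by (rule convex_linear_image[OF _ convex_sublevel])
  have sub: "C \<subseteq> carr (X' n)" by (auto simp: C_def sublevel_def)
  let ?H = "convex hull {g. g extreme_point_of C}"
  have H: "?H \<subseteq> C" using conv by (intro hull_minimal) (auto simp: extreme_point_of_def)
  have "weak_star (X n) closure_of ?H = carr (X' n) \<inter> closure (carr (X' n) \<inter> ?H)"
    by (simp add: weak_star_eq[OF normed_X] closure_of_subtopology)
  also have "carr (X' n) \<inter> ?H = ?H" using H sub by blast
  also have "carr (X' n) \<inter> closure ?H = C" using krein_milman_fun[OF C conv] sub by blast
  finally show ?thesis by simp
qed

text \<open>These hypotheses are what the description of the solution set provides.\<close>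

context
  fixes z :: "real^'m" and r :: real and a :: "real^'m"
  assumes r0: "0 \<le> r" and nr: "\<And>f. f \<in> sublevel z r \<Longrightarrow> nrm PX' f = r"
    and a: "nrm PX (comb a) = r" "a \<bullet> z = r * r"
begin

lemma sublevel_conjugate:
  assumes f: "f \<in> sublevel z r"
  shows "conjugates PX PX' pairing (comb a) f"
proof -
  have fc: "f \<in> carr PX'" "meas f = z" using f by (auto simp: sublevel_def)
  show ?thesis
    using pairing_comb[OF fc(1), of a] nr[OF f] a fc comb_carr[of a] by (simp add: conjugates_def)
qed

lemma sublevel_formulas:
  assumes f: "f \<in> sublevel z r"
  defines "y \<equiv> (\<chi> n. nrm (X' n) (f $ n))"
  shows "\<exists>ystar. conjugates Z' Z (\<bullet>) y ystar \<and>
      (strictly_convex_space Z' \<or> (\<forall>z. nrm Z' z = (\<Sum>n\<in>UNIV. \<bar>z $ n\<bar>)) \<longrightarrow>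
        (\<forall>n. (y $ n \<noteq> 0 \<longrightarrow> scaling y ystar n > 0) \<and>
          (hilbert_space (X' n) \<longrightarrow>
             f $ n = scaling y ystar n *\<^sub>R (\<Sum>m\<in>UNIV. (a $ m) *\<^sub>R duality_op (X n) (\<nu> m $ n))) \<and>
          (strictly_convex_space (X' n) \<longrightarrow>
             f $ n = scaling y ystar n *\<^sub>R duality_op (X n) (\<Sum>m\<in>UNIV. (a $ m) *\<^sub>R (\<nu> m $ n)))))"
proof -
  have cj: "nrm PX' f = nrm PX (comb a)" "pairing (comb a) f = nrm PX (comb a) * nrm PX (comb a)"
    and fc: "f \<in> carr PX'"
    using sublevel_conjugate[OF f] by (simp_all add: conjugates_def del: product_carr_iff)
  have cn: "comb a $ n = (\<Sum>m\<in>UNIV. (a $ m) *\<^sub>R (\<nu> m $ n))" for n by (simp add: comb_def)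
  let ?s = "\<chi> n. nrm (X n) (comb a $ n)"
  note cf = conjugate_component_formula[OF comb_carr fc cj, folded y_def]
  have hil: "f $ n = scaling y ?s n *\<^sub>R (\<Sum>m\<in>UNIV. (a $ m) *\<^sub>R duality_op (X n) (\<nu> m $ n))"
    if strict: "strictly_convex_space Z' \<or> (\<forall>z. nrm Z' z = (\<Sum>n\<in>UNIV. \<bar>z $ n\<bar>))" and h: "hilbert_space (X' n)" for n
  proof -
    obtain ip where "hilbert_dual (X n) ip" using hilbert_dualI[OF normed_X h] by blast
    then interpret H: hilbert_dual "X n" ip .
    have "duality_op (X n) (\<Sum>m\<in>UNIV. (a $ m) *\<^sub>R (\<nu> m $ n)) = (\<Sum>m\<in>UNIV. (a $ m) *\<^sub>R duality_op (X n) (\<nu> m $ n))"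
      using H.J_sum[of UNIV "\<lambda>m. \<nu> m $ n" "\<lambda>m. a $ m"] \<nu>_carr by simp
    then show ?thesis using cf(2)[OF strict H.strictly_convex] by (simp add: cn)
  qed
  show ?thesis
    by (intro exI[of _ ?s] conjI impI allI hil)
      (use conjugate_components(1)[OF comb_carr fc cj] cf in \<open>simp_all add: y_def cn\<close>)
qed

lemma sublevel_component_unique:
  assumes ne: "sublevel z r \<noteq> {}" and scZ: "strictly_convex_space Z'"
    and n: "hilbert_space (X' n) \<or> strictly_convex_space (X' n)"
  shows "\<exists>!g. g \<in> (\<lambda>f. f $ n) ` sublevel z r"
proof -
  have sc: "strictly_convex_space (X' n)"
    using n hilbert_dualI[OF normed_X] hilbert_dual.strictly_convex by blast
  obtain f where f: "f \<in> sublevel z r" using ne by blast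
  show ?thesis
  proof (rule ex1I[of _ "f $ n"])
    show "f $ n \<in> (\<lambda>f. f $ n) ` sublevel z r" using f by blast
    fix g assume "g \<in> (\<lambda>f. f $ n) ` sublevel z r"
    then show "g = f $ n"
      using component_unique[OF convex_sublevel sublevel_subset nr scZ sc _ f] by blast
  qed
qed

text \<open>The slice touches the ball: over the ball, the functional with coefficients a has the
  maximum \<open>r * r\<close>, and it is attained on the slice. For \<open>r = 0\<close> the slice
  is \<open>{0}\<close>, and the empty combination serves.\<close>

lemma sublevel_extreme_atoms:
  assumes f0: "f0 extreme_point_of sublevel z r"
  shows "\<exists>A w. finite A \<and> card A \<le> CARD('m) \<and> (\<forall>e\<in>A. e extreme_point_of dual_ball r) \<and>
    f0 = (\<Sum>e\<in>A. w e *\<^sub>R e)"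
proof -
  have f0S: "f0 \<in> sublevel z r" using f0 by (simp add: extreme_point_of_def)
  then have f0c: "f0 \<in> carr PX'" "meas f0 = z" by (auto simp: sublevel_def)
  show ?thesis
  proof (cases "r = 0")
    case True
    then have "f0 = 0" using normed_eq_0[OF normed_PX' f0c(1)] nr[OF f0S] by simp
    then show ?thesis by (intro exI[of _ "{}"]) simp
  next
    case False
    have slice: "f0 extreme_point_of {f \<in> dual_ball r. meas f = meas f0}" using f0 f0c by (simp add: sublevel_eq)
    have bd: "bounded (meas ` dual_ball r)"
    proof (rule boundedI)
      fix w assume "w \<in> meas ` dual_ball r"
      then obtain f where f: "w = meas f" "f \<in> carr PX'" "nrm PX' f \<le> r"
        by (auto simp: dual_ball_def simp del: product_carr_iff)
      have "norm w \<le> (\<Sum>m\<in>UNIV. \<bar>w $ m\<bar>)" by (rule norm_le_l1_cart)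
      also have "\<dots> \<le> (\<Sum>m\<in>UNIV. r * nrm PX (\<nu> m))"
      proof (rule sum_mono)
        fix m
        have "\<forall>x\<in>carr PX. \<bar>pairing x f\<bar> \<le> r * nrm PX x"
          using product_dual_nrm_le_iff[OF f(2) r0] f(3) by blast
        then show "\<bar>w $ m\<bar> \<le> r * nrm PX (\<nu> m)" using \<nu>_carr f(1) by (simp add: meas_def del: product_carr_iff)
      qed
      finally show "norm w \<le> (\<Sum>m\<in>UNIV. r * nrm PX (\<nu> m))" .
    qed
    have cl: "closed {w. f0 + g w \<in> dual_ball r}"
      if g: "linear g" "range g \<subseteq> span ((\<lambda>f. f - f0) ` dual_ball r)" for g :: "real^'m \<Rightarrow> ('a \<Rightarrow> real)^'n"
    proof -
      note sub = normed_subspace[OF normed_PX']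
      have "span ((\<lambda>f. f - f0) ` dual_ball r) \<subseteq> carr PX'"
        using f0c(1) sub by (intro span_minimal) (auto simp: dual_ball_def intro: subspace_diff simp del: product_carr_iff)
      then have "g w \<in> carr PX'" for w using g(2) by blast
      then have in_c: "f0 + g w \<in> carr PX'" for w by (rule subspace_add[OF sub f0c(1)])
      have "{w. f0 + g w \<in> dual_ball r} = (\<Inter>x\<in>carr PX. {w. \<bar>pairing x f0 + pairing x (g w)\<bar> \<le> r * nrm PX x})"
        using in_c product_dual_nrm_le_iff[OF in_c r0]
        by (auto simp: dual_ball_def pairing_add simp del: product_carr_iff)
      moreover have "closed {w. \<bar>pairing x f0 + pairing x (g w)\<bar> \<le> r * nrm PX x}" for x
      proof -
        have "linear (\<lambda>w. pairing x (g w))"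
          by (rule linearI) (simp_all add: linear_add[OF g(1)] linear_scale[OF g(1)] pairing_add pairing_scale)
        then have "continuous_on UNIV (\<lambda>w. pairing x (g w))"
          by (simp add: linear_continuous_on linear_conv_bounded_linear)
        then show ?thesis by (intro closed_Collect_le continuous_intros)
      qed
      ultimately show ?thesis by (simp add: closed_INT)
    qed
    have a0: "a \<noteq> 0"
    proof
      assume "a = 0"
      then have "comb a = 0" by (simp add: comb_eq_0)
      then show False using a(1) False by (simp add: normed_zero[OF normed_PX])
    qed
    have sup: "a \<bullet> meas f \<le> a \<bullet> meas f0" if f: "f \<in> dual_ball r" for f
    proof -
      have fc: "f \<in> carr PX'" "nrm PX' f \<le> r" using f by (auto simp: dual_ball_def simp del: product_carr_iff)
      have "a \<bullet> meas f \<le> nrm PX' f * nrm PX (comb a)"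
        using pairing_le[OF fc(1) comb_carr[of a]] pairing_comb[OF fc(1), of a] by simp
      also have "\<dots> \<le> r * r" using fc(2) a(1) r0 by (simp add: mult_right_mono)
      finally show ?thesis using a(2) f0c(2) by simp
    qed
    obtain A where A: "finite A" "card A \<le> CARD('m)" "A \<subseteq> {e. e extreme_point_of dual_ball r}" "f0 \<in> convex hull A"
      using extreme_slice_atoms[OF convex_dual_ball linear_meas bd cl slice a0 sup] by blast
    then obtain w where "(\<Sum>e\<in>A. w e *\<^sub>R e) = f0" unfolding convex_hull_finite[OF A(1)] by blast
    then show ?thesis using A by blast
  qed
qed

text \<open>An atom of the product contributes to the n-th component its own n-th component, which
  is zero or a multiple of an extreme point of the unit ball of the factor.\<close>

lemma component_atoms:
  assumes A: "finite A" "\<And>e. e \<in> A \<Longrightarrow> e extreme_point_of dual_ball r" "card A \<le> K"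
    and g: "g = (\<Sum>e\<in>A. w e *\<^sub>R e $ n)"
  shows "\<exists>c e. atomic_expansion (X' n) K c e g"
proof -
  obtain e0 where e0: "e0 extreme_point_of unit_ball (X' n)"
    using dual_unit_ball_extreme_point[OF normed_X] by blast
  define p where "p e = (if e $ n = 0 then e0 else (1 / nrm (X' n) (e $ n)) *\<^sub>R e $ n)" for e :: "('a \<Rightarrow> real)^'n"
  show ?thesis
  proof (rule atomic_expansionI[OF A(1,3) _ e0])
    show "p e extreme_point_of unit_ball (X' n)" if "e \<in> A" for e
      using extreme_ball_component[OF A(2)[OF that]] e0 by (simp add: p_def)
    show "g = (\<Sum>e\<in>A. (w e * nrm (X' n) (e $ n)) *\<^sub>R p e)"
      unfolding g
    proof (rule sum.cong[OF refl])
      fix e assume "e \<in> A"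
      then have "e $ n \<in> carr (X' n)" using A(2) by (auto simp: extreme_point_of_def dual_ball_def)
      then show "w e *\<^sub>R e $ n = (w e * nrm (X' n) (e $ n)) *\<^sub>R p e"
        using normed_eq_0[OF normed_X'] normed_zero[OF normed_X'] by (simp add: p_def)
    qed
  qed
qed

lemma sublevel_extreme_expansion:
  assumes f0: "f0 extreme_point_of sublevel z r"
  shows "\<exists>c e. atomic_expansion (X' n) CARD('m) c e (f0 $ n)"
proof -
  obtain A w where A: "finite A" "card A \<le> CARD('m)" "\<forall>e\<in>A. e extreme_point_of dual_ball r" "f0 = (\<Sum>e\<in>A. w e *\<^sub>R e)"
    using sublevel_extreme_atoms[OF f0] by blast
  show ?thesis by (rule component_atoms[OF A(1) _ A(2)]) (use A in auto)
qed

text \<open>Every atom has a single nonzero component, so each atom is counted for one factor only.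
  In a strictly convex factor all points of norm 1 are extreme, so the atoms that belong to it can
  be merged into one.\<close>

lemma sublevel_extreme_expansion_norm1:
  assumes n1: "\<forall>z. nrm Z' z = (\<Sum>n\<in>UNIV. \<bar>z $ n\<bar>)" and f0: "f0 extreme_point_of sublevel z r"
  shows "\<exists>K c e. (\<Sum>n\<in>UNIV. K n) \<le> CARD('m) \<and>
     (\<forall>n. atomic_expansion (X' n) (K n) (c n) (e n) (f0 $ n) \<and>
        (strictly_convex_space (X' n) \<longrightarrow>
          (if f0 $ n = 0 then K n = 0
           else K n = 1 \<and> c n 0 = nrm (X' n) (f0 $ n) \<and>
                e n 0 = (1 / nrm (X' n) (f0 $ n)) *\<^sub>R (f0 $ n))))"
proof -
  obtain A w where A: "finite A" "card A \<le> CARD('m)" "\<And>e. e \<in> A \<Longrightarrow> e extreme_point_of dual_ball r" "f0 = (\<Sum>e\<in>A. w e *\<^sub>R e)"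
    using sublevel_extreme_atoms[OF f0] by blast
  have f0n: "f0 $ n \<in> carr (X' n)" for n using f0 by (auto simp: extreme_point_of_def sublevel_def)
  define A' where "A' n = {e \<in> A. e $ n \<noteq> 0}" for n
  have fin: "finite (A' n)" for n using A(1) by (simp add: A'_def)
  have f0A: "f0 $ n = (\<Sum>e\<in>A' n. w e *\<^sub>R e $ n)" for n
    unfolding A(4) A'_def sum_component using A(1) by (intro sum.mono_neutral_cong_right) auto
  have "(\<Sum>n\<in>UNIV. card (A' n)) = card (\<Union>n. A' n)"
  proof (rule card_UN_disjoint[symmetric])
    show "\<forall>i\<in>UNIV. \<forall>j\<in>UNIV. i \<noteq> j \<longrightarrow> A' i \<inter> A' j = {}"
      using extreme_ball_support[OF n1 A(3)] by (auto simp: A'_def)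
  qed (use fin in auto)
  also have "\<dots> \<le> card A" by (intro card_mono A(1)) (auto simp: A'_def)
  finally have tot: "(\<Sum>n\<in>UNIV. card (A' n)) \<le> CARD('m)" using A(2) by simp
  define K where "K n = (if strictly_convex_space (X' n) then (if f0 $ n = 0 then 0 else 1) else card (A' n))" for n
  have K: "K n \<le> card (A' n)" for n
  proof -
    have "A' n \<noteq> {}" if "f0 $ n \<noteq> 0" using that unfolding f0A[of n] by auto
    then have "1 \<le> card (A' n)" if "f0 $ n \<noteq> 0" using that fin by (simp add: Suc_le_eq card_gt_0_iff)
    then show ?thesis by (simp add: K_def)
  qed
  have "(\<Sum>n\<in>UNIV. K n) \<le> (\<Sum>n\<in>UNIV. card (A' n))" by (intro sum_mono K)
  then have total: "(\<Sum>n\<in>UNIV. K n) \<le> CARD('m)" using tot by simp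
  have "\<exists>c e. atomic_expansion (X' n) (K n) c e (f0 $ n) \<and>
      (strictly_convex_space (X' n) \<longrightarrow> (if f0 $ n = 0 then K n = 0
        else K n = 1 \<and> c 0 = nrm (X' n) (f0 $ n) \<and> e 0 = (1 / nrm (X' n) (f0 $ n)) *\<^sub>R (f0 $ n)))" for n
  proof (cases "strictly_convex_space (X' n)")
    case False
    then show ?thesis
      using component_atoms[OF fin _ _ f0A, of n "K n"] A(3) by (auto simp: K_def A'_def)
  next
    case sc: True
    show ?thesis
    proof (cases "f0 $ n = 0")
      case True
      then show ?thesis using sc by (simp add: K_def atomic_expansion_def)
    next
      case False
      let ?q = "nrm (X' n) (f0 $ n)"
      have q: "?q > 0"
        using normed_nonneg[OF normed_X' f0n] normed_eq_0[OF normed_X' f0n] False by (simp add: less_le)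
      have "(1 / ?q) *\<^sub>R f0 $ n extreme_point_of unit_ball (X' n)"
        using q f0n by (intro strictly_convex_extreme[OF normed_X' sc])
          (simp_all add: normed_scale[OF normed_X'] subspace_scale[OF subspace_dual[OF normed_X]])
      then show ?thesis
        using sc False q
        by (intro exI[of _ "\<lambda>_. ?q"] exI[of _ "\<lambda>_. (1 / ?q) *\<^sub>R f0 $ n"]) (simp add: K_def atomic_expansion_def)
    qed
  qed
  then obtain c e where "\<And>n. atomic_expansion (X' n) (K n) (c n) (e n) (f0 $ n) \<and>
      (strictly_convex_space (X' n) \<longrightarrow> (if f0 $ n = 0 then K n = 0
        else K n = 1 \<and> c n 0 = nrm (X' n) (f0 $ n) \<and> e n 0 = (1 / nrm (X' n) (f0 $ n)) *\<^sub>R (f0 $ n)))"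
    by metis
  then show ?thesis using total by blast
qed

lemma sublevel_component_lift:
  assumes "g extreme_point_of ((\<lambda>f. f $ n) ` sublevel z r)"
  shows "\<exists>f0. f0 extreme_point_of sublevel z r \<and> f0 $ n = g"
  by (rule extreme_component_lift[OF convex_sublevel sublevel_subset compact_sublevel[OF r0] assms])

end

end

theorem theorem2:
  fixes X :: "'n::finite \<Rightarrow> 'a::real_vector nspace"
    and Z :: "(real^'n) nspace"
    and \<nu> :: "'m::finite \<Rightarrow> 'a^'n"
    and E :: "real^'m \<Rightarrow> real^'m \<Rightarrow> ennreal"
    and \<psi> :: "real \<Rightarrow> real"
    and b :: "real^'m"
  assumes X: "\<And>n. banach_space (X n)"
    and Z: "normed_space Z" "carr Z = UNIV" "absolute_norm Z"
    and \<nu>: "\<And>m. \<nu> m \<in> carr (direct_product Z X)" "inj \<nu>" "independent (range \<nu>)"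
    and E: "proper_fun (E b)" "lsc_fun (E b)" "strictly_convex_fun (E b)"
    and \<psi>: "\<And>t. 0 \<le> t \<Longrightarrow> 0 \<le> \<psi> t" "strict_mono_on {0..} \<psi>" "strictly_convex_on {0..} \<psi>"
  defines "Z' \<equiv> vec_dual Z"
    and "X' \<equiv> \<lambda>n. dual (X n)"
  defines "PX \<equiv> direct_product Z X"
    and "PX' \<equiv> direct_product Z' X'"
  defines "S \<equiv> solution_set Z X \<nu> E \<psi> b"
  defines "Sn \<equiv> \<lambda>n. (\<lambda>f. f $ n) ` S"
    and "y \<equiv> \<lambda>f. \<chi> n. nrm (X' n) (f $ n)"
    and "norm1 \<equiv> \<forall>z. nrm Z' z = (\<Sum>n\<in>UNIV. \<bar>z $ n\<bar>)"
  defines "expandable \<equiv> \<lambda>K.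
      (\<forall>n g. \<not> strictly_convex_space (X' n) \<and> g extreme_point_of Sn n \<longrightarrow>
         (\<exists>c e. atomic_expansion (X' n) K c e g)) \<and>
      (\<forall>f0 n. f0 extreme_point_of S \<and>
         (\<not> strictly_convex_space (X' n) \<or> \<not> reflexive_space (X n)) \<longrightarrow>
         (\<exists>c e. atomic_expansion (X' n) K c e (f0 $ n)))"
  shows
    \<comment> \<open>common conjugate; linear (Hilbert) and nonlinear (strictly convex) solution formulas\<close>
    "(\<exists>a :: real^'m. \<forall>f0\<in>S.
        conjugates PX PX' pairing (\<Sum>m\<in>UNIV. (a $ m) *\<^sub>R \<nu> m) f0 \<and>
        (\<exists>ystar. conjugates Z' Z (\<bullet>) (y f0) ystar \<and>
           (strictly_convex_space Z' \<or> norm1 \<longrightarrow>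
             (\<forall>n.
               (y f0 $ n \<noteq> 0 \<longrightarrow> scaling (y f0) ystar n > 0) \<and>
               (hilbert_space (X' n) \<longrightarrow>
                  f0 $ n = scaling (y f0) ystar n *\<^sub>R
                    (\<Sum>m\<in>UNIV. (a $ m) *\<^sub>R duality_op (X n) (\<nu> m $ n))) \<and>
               (strictly_convex_space (X' n) \<longrightarrow>
                  f0 $ n = scaling (y f0) ystar n *\<^sub>R
                    duality_op (X n) (\<Sum>m\<in>UNIV. (a $ m) *\<^sub>R (\<nu> m $ n)))))))
    \<and>
    \<comment> \<open>the duality operator in the Hilbert formula is the Riesz map\<close>
     (\<forall>n. hilbert_space (X' n) \<longrightarrow> is_riesz_map (X n) (duality_op (X n)))
    \<and>
    \<comment> \<open>uniqueness of Hilbert and of strictly convex components\<close>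
     (strictly_convex_space Z' \<longrightarrow>
        (\<forall>n. hilbert_space (X' n) \<or> strictly_convex_space (X' n) \<longrightarrow> (\<exists>!g. g \<in> Sn n)))
    \<and>
    \<comment> \<open>item 3\<close>
     (\<forall>n. \<not> strictly_convex_space (X' n) \<longrightarrow>
        Sn n = weak_star (X n) closure_of (convex hull {g. g extreme_point_of Sn n})) \<and>
     (\<exists>K0. K0 \<le> CARD('m) \<and> expandable K0 \<and> (\<forall>K. expandable K \<longrightarrow> K0 \<le> K))
    \<and>
    \<comment> \<open>sharper form of the expansion for the 1-norm\<close>
     (norm1 \<longrightarrow>
        (\<forall>f0. f0 extreme_point_of S \<longrightarrow>
           (\<exists>K c e. (\<Sum>n\<in>UNIV. K n) \<le> CARD('m) \<and>
             (\<forall>n. atomic_expansion (X' n) (K n) (c n) (e n) (f0 $ n) \<and>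
                (strictly_convex_space (X' n) \<longrightarrow>
                  (if f0 $ n = 0 then K n = 0
                   else K n = 1 \<and> c n 0 = nrm (X' n) (f0 $ n) \<and>
                        e n 0 = (1 / nrm (X' n) (f0 $ n)) *\<^sub>R (f0 $ n)))))) \<and>
        (\<forall>n g. g extreme_point_of Sn n \<longrightarrow> (\<exists>f0. f0 extreme_point_of S \<and> f0 $ n = g)))"
proof -
  interpret I: interpolation Z X \<nu>
    using Z X \<nu> by unfold_locales (auto simp: banach_space_def PX_def)
  have reg: "regulariser \<psi>" using \<psi> by unfold_locales
  obtain z r a where S_eq: "solution_set Z X \<nu> E \<psi> b = I.sublevel z r" and ne: "I.sublevel z r \<noteq> {}"
    and nr: "\<forall>f\<in>I.sublevel z r. nrm (direct_product (vec_dual Z) (\<lambda>n. dual (X n))) f = r"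
    and r0: "0 \<le> r" and a: "nrm (direct_product Z X) (I.comb a) = r" "a \<bullet> z = r * r"
    using I.solution_set_eq[where E=E and b=b, OF E reg] by blast
  note nr' = nr[rule_format]
  have S: "S = I.sublevel z r" by (simp add: S_def S_eq)
  have Sn: "Sn n = (\<lambda>f. f $ n) ` I.sublevel z r" for n by (simp add: Sn_def S)
  have X': "X' n = dual (X n)" for n by (simp add: X'_def)
  have comb: "(\<Sum>m\<in>UNIV. (a $ m) *\<^sub>R \<nu> m) = I.comb a" for a by (simp add: I.comb_def)
  have part1: "\<exists>a :: real^'m. \<forall>f0\<in>S.
        conjugates PX PX' pairing (\<Sum>m\<in>UNIV. (a $ m) *\<^sub>R \<nu> m) f0 \<and>
        (\<exists>ystar. conjugates Z' Z (\<bullet>) (y f0) ystar \<and>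
           (strictly_convex_space Z' \<or> norm1 \<longrightarrow>
             (\<forall>n.
               (y f0 $ n \<noteq> 0 \<longrightarrow> scaling (y f0) ystar n > 0) \<and>
               (hilbert_space (X' n) \<longrightarrow>
                  f0 $ n = scaling (y f0) ystar n *\<^sub>R
                    (\<Sum>m\<in>UNIV. (a $ m) *\<^sub>R duality_op (X n) (\<nu> m $ n))) \<and>
               (strictly_convex_space (X' n) \<longrightarrow>
                  f0 $ n = scaling (y f0) ystar n *\<^sub>R
                    duality_op (X n) (\<Sum>m\<in>UNIV. (a $ m) *\<^sub>R (\<nu> m $ n))))))"
    using I.sublevel_conjugate[OF r0 nr' a] I.sublevel_formulas[OF r0 nr' a]
    unfolding S comb PX_def PX'_def y_def norm1_def Z'_def X'_def by blast
  have part2: "\<forall>n. hilbert_space (X' n) \<longrightarrow> is_riesz_map (X n) (duality_op (X n))"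
    using hilbert_dualI[OF I.normed_X] hilbert_dual.riesz unfolding X' by blast
  have part3: "\<forall>n. hilbert_space (X' n) \<or> strictly_convex_space (X' n) \<longrightarrow> (\<exists>!g. g \<in> Sn n)"
    if "strictly_convex_space Z'"
    using that unfolding Sn X' Z'_def using I.sublevel_component_unique[OF r0 nr' a ne] by blast
  have part4: "\<forall>n. \<not> strictly_convex_space (X' n) \<longrightarrow>
        Sn n = weak_star (X n) closure_of (convex hull {g. g extreme_point_of Sn n})"
    unfolding Sn using I.component_krein_milman[OF r0] by blast
  note lift = I.sublevel_component_lift[OF r0 nr' a]
  have M: "expandable CARD('m)"
    unfolding expandable_def S Sn X'
    using lift I.sublevel_extreme_expansion[OF r0 nr' a] by blast
  have part5: "\<exists>K0. K0 \<le> CARD('m) \<and> expandable K0 \<and> (\<forall>K. expandable K \<longrightarrow> K0 \<le> K)"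
    using LeastI[of expandable, OF M] Least_le[of expandable] M by blast
  have part6: "\<forall>f0. f0 extreme_point_of S \<longrightarrow>
           (\<exists>K c e. (\<Sum>n\<in>UNIV. K n) \<le> CARD('m) \<and>
             (\<forall>n. atomic_expansion (X' n) (K n) (c n) (e n) (f0 $ n) \<and>
                (strictly_convex_space (X' n) \<longrightarrow>
                  (if f0 $ n = 0 then K n = 0
                   else K n = 1 \<and> c n 0 = nrm (X' n) (f0 $ n) \<and>
                        e n 0 = (1 / nrm (X' n) (f0 $ n)) *\<^sub>R (f0 $ n)))))" if norm1
    using I.sublevel_extreme_expansion_norm1[OF r0 nr' a that[unfolded norm1_def Z'_def]]
    unfolding S X' by blast
  have part7: "\<forall>n g. g extreme_point_of Sn n \<longrightarrow> (\<exists>f0. f0 extreme_point_of S \<and> f0 $ n = g)"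
    using lift unfolding Sn S by blast
  show ?thesis
    by (intro conjI impI part1 part2 part3 part4 part5 part6 part7)
qed

end
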